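(* Let $N\ge 1$ and let $M$ be a smooth manifold of dimension $2N+3$. The differential relation $\mathfrak R\subset X^{(1)}$ on $X=\mathrm{Gr}_{2N+1}(TM)$, consisting of the $1$-jets of corank two distributions whose dual Levi map has two-dimensional image lying in the generic $\mathrm{GL}(D(q))$-orbit of $\mathrm{Gr}_2(\bigwedge^2D(q)^* )$, is ample.
   Context: Bundles. $\pi\colon X=\mathrm{Gr}_{2N+1}(TM)\to M$ is the Grassmannian bundle of $(2N+1)$-dimensional subspaces of the tangent spaces; its smooth sections are the rank $2N+1$ (corank two) distributions on $M$. $X^{(1)}$ is the bundle of $1$-jets of local sections of $X$. Dual Levi map. For a local distribution $D$ near $q$ let $D^\perp(q)=\{\alpha\in T^*_qM:\alpha|_{D(q)}=0\}$. The dual Levi map $L_q\colon D^\perp(q)\to\bigwedge^2D(q)^*$ is $L_q(\alpha)=d\tilde\alpha|_{D(q)}$, where $\tilde\alpha$ is any local $1$-form with $\tilde\alpha|_D=0$ and $\tilde\alpha(q)=\alpha$. It is well defined and linear, and depends only on the $1$-jet of $D$ at $q$. Generic orbit. For a real vector space $V$ with $\dim V=2N+1$, the generic orbit is the nonempty Zariski open $\mathrm{GL}(V)$-orbit in $\mathrm{Gr}_2(\bigwedge^2V^* )$. A plane $\mathcal P$ lies in it iff any of the following equivalent conditions holds: for some basis $\varepsilon_1,\dots,\varepsilon_{2N+1}$ of $V^*$, $\mathcal P=\{\sum_{k=1}^N(\mu\varepsilon_k+\lambda\varepsilon_{k+1})\wedge\varepsilon_{2N+2-k}:\lambda,\mu\in\mathbb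 R\}$; every nonzero $\omega$ in the complexification $\mathcal P^{\mathbb C}$ has one-dimensional kernel in $V^{\mathbb C}$; for some (equivalently any) basis $\omega_1,\omega_2$ of $\mathcal P^{\mathbb C}$ the forms $\omega_1^i\wedge\omega_2^{N-i}$, $0\le i\le N$, are linearly independent. A $1$-jet at $q$ of a distribution $D$ belongs to $\mathfrak R$ iff $\mathrm{Im}\,L_q$ is two-dimensional and lies in the generic orbit in $\mathrm{Gr}_2(\bigwedge^2D(q)^* )$. Ampleness. Let $V_x$ be the vertical tangent space of $X\to M$ at $x\in X$, and fix a connection on $X$, i.e. a projection $\mathbb A\colon TX\to V$ onto the vertical distribution; it identifies the fibre $X^{(1)}|_x$ with $\mathrm{Hom}(T_{\pi(x)}M,V_x)$ via $J^1f(\pi(x))\mapsto\mathbb A_x\circ df_{\pi(x)}$. For a hyperplane $\tau\subset T_{\pi(x)}M$ and a linear map $\ell\colon\tau\to V_x$, the principal subspace is the affine subspace $P^\ell_\tau=\{L\in\mathrm{Hom}(T_{\pi(x)}M,V_x):L|_\tau=\ell\}\subset X^{(1)}|_x$. A subset $S$ of an affine space $E$ is ample if $S=\emptyset$ or the convex hull of every connected component of $S$ equals $E$. A relation $\mathcal R\subset X^{(1)}$ is ample if $\mathcal R\cap P^\ell_\tau$ is an ample subset of $P^\ell_\tau$ for all $x,\tau,\ell$. *)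

theory Defs
  imports "HOL-Analysis.Analysis"
begin

section \<open>Smooth manifolds and tangent spaces\<close>

text \<open>Meaningful for open \<open>S\<close> only.\<close>

primrec Ck_on :: "nat \<Rightarrow> 'a::real_normed_vector set \<Rightarrow> ('a \<Rightarrow> 'b::real_normed_vector) \<Rightarrow> bool" where
  "Ck_on 0 S f \<longleftrightarrow> continuous_on S f"
| "Ck_on (Suc k) S f \<longleftrightarrow> (\<forall>x\<in>S. f differentiable (at x)) \<and>
     (\<forall>v. Ck_on k S (\<lambda>x. frechet_derivative f (at x) v))"

definition smooth_on :: "'a::real_normed_vector set \<Rightarrow> ('a \<Rightarrow> 'b::real_normed_vector) \<Rightarrow> bool" where
  "smooth_on S f \<longleftrightarrow> (\<forall>k. Ck_on k S f)"

type_synonym ('m, 'e) chart = "'m set \<times> ('m \<Rightarrow> 'e)"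

abbreviation chart_inv :: "('m, 'e) chart \<Rightarrow> 'e \<Rightarrow> 'm" where
  "chart_inv c \<equiv> inv_into (fst c) (snd c)"

definition smooth_atlas ::
  "('m::{t2_space,second_countable_topology}, 'e::euclidean_space) chart set \<Rightarrow> bool" where
  "smooth_atlas \<A> \<longleftrightarrow>
     (\<Union>c\<in>\<A>. fst c) = UNIV \<and>
     (\<forall>(U, \<phi>)\<in>\<A>. open U \<and> open (\<phi> ` U) \<and> (\<exists>\<psi>. homeomorphism U (\<phi> ` U) \<phi> \<psi>)) \<and>
     (\<forall>c\<in>\<A>. \<forall>d\<in>\<A>. smooth_on (snd c ` (fst c \<inter> fst d)) (snd d \<circ> chart_inv c))"

text \<open>A tangent vector at \<open>q\<close> is represented by its coordinates in one chart around \<open>q\<close>, chosen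
  once and for all; thus every tangent space is (a copy of) the model space \<open>'e\<close>, and covectors at
  \<open>q\<close> are elements of \<open>'e \<Rightarrow>\<^sub>L real\<close>. The inner product of \<open>'e\<close> has no geometric meaning:
  it only serves to select the complement \<open>D\<^sup>\<bottom>\<close> of a subspace \<open>D\<close>.\<close>

definition chart_at :: "('m, 'e) chart set \<Rightarrow> 'm \<Rightarrow> ('m, 'e) chart" where
  "chart_at \<A> q = (SOME c. c \<in> \<A> \<and> q \<in> fst c)"

definition coord_at :: "('m, 'e) chart set \<Rightarrow> 'm \<Rightarrow> 'e" where
  "coord_at \<A> q = snd (chart_at \<A> q) q"

text \<open>The differential at \<open>p\<close> of a chart \<open>c\<close>, as a map from the tangent space at \<open>p\<close> to \<open>'e\<close>,
  and its inverse.\<close>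

definition chart_diff ::
  "('m, 'e::euclidean_space) chart set \<Rightarrow> ('m, 'e) chart \<Rightarrow> 'm \<Rightarrow> 'e \<Rightarrow>\<^sub>L 'e" where
  "chart_diff \<A> c p = Blinfun (frechet_derivative
     (snd c \<circ> chart_inv (chart_at \<A> p)) (at (coord_at \<A> p)))"

definition chart_diff_inv ::
  "('m, 'e::euclidean_space) chart set \<Rightarrow> ('m, 'e) chart \<Rightarrow> 'm \<Rightarrow> 'e \<Rightarrow>\<^sub>L 'e" where
  "chart_diff_inv \<A> c p = Blinfun (frechet_derivative
     (snd (chart_at \<A> p) \<circ> chart_inv c) (at (snd c p)))"

section \<open>The Grassmannian bundle and its first jet space\<close>

definition Gr_bundle :: "nat \<Rightarrow> ('m \<times> 'e::euclidean_space set) set" where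
  "Gr_bundle k = {(q, D). subspace D \<and> dim D = k}"

text \<open>\<open>Hom(D, D\<^sup>\<bottom>)\<close>, realised as the endomorphisms of \<open>'e\<close> that vanish on \<open>D\<^sup>\<bottom>\<close> and map into
  \<open>D\<^sup>\<bottom>\<close>. The standard chart of the Grassmannian centred at \<open>D\<close> sends \<open>B\<close> in this space to its
  graph over \<open>D\<close>; hence \<open>Hom(D, D\<^sup>\<bottom>)\<close> is the tangent space of the Grassmannian at \<open>D\<close>.\<close>

definition Hom_perp :: "'e::euclidean_space set \<Rightarrow> ('e \<Rightarrow>\<^sub>L 'e) set" where
  "Hom_perp D = {B. (\<forall>u. blinfun_apply B u \<in> D\<^sup>\<bottom>) \<and> (\<forall>w\<in>D\<^sup>\<bottom>. blinfun_apply B w = 0)}"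

definition graph_over :: "'e::euclidean_space set \<Rightarrow> ('e \<Rightarrow>\<^sub>L 'e) \<Rightarrow> 'e set" where
  "graph_over D B = {u + blinfun_apply B u | u. u \<in> D}"

text \<open>The chart of the total space of the Grassmannian bundle centred at a point \<open>x\<close>; its values
  lie in \<open>'e \<times> Hom(D, D\<^sup>\<bottom>)\<close> if \<open>x = (q, D)\<close>.\<close>

definition Gr_chart_domain ::
  "('m, 'e::euclidean_space) chart set \<Rightarrow> 'm \<times> 'e set \<Rightarrow> ('m \<times> 'e set) set" where
  "Gr_chart_domain \<A> x = {(p, K). p \<in> fst (chart_at \<A> (fst x)) \<and> subspace K \<and>
     (\<exists>B\<in>Hom_perp (snd x).
        blinfun_apply (chart_diff \<A> (chart_at \<A> (fst x)) p) ` K = graph_over (snd x) B)}"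

definition Gr_chart ::
  "('m, 'e::euclidean_space) chart set \<Rightarrow> 'm \<times> 'e set \<Rightarrow> 'm \<times> 'e set \<Rightarrow> 'e \<times> ('e \<Rightarrow>\<^sub>L 'e)" where
  "Gr_chart \<A> x = (\<lambda>(p, K). (snd (chart_at \<A> (fst x)) p,
     THE B. B \<in> Hom_perp (snd x) \<and>
       blinfun_apply (chart_diff \<A> (chart_at \<A> (fst x)) p) ` K = graph_over (snd x) B))"

text \<open>The section \<open>p \<mapsto> (p, D p)\<close> read in the chosen chart around \<open>q\<close> and the chart of the
  total space centred at \<open>(q, D q)\<close>.\<close>

definition section_rep ::
  "('m, 'e::euclidean_space) chart set \<Rightarrow> 'm \<Rightarrow> ('m \<Rightarrow> 'e set) \<Rightarrow> 'e \<Rightarrow> 'e \<times> ('e \<Rightarrow>\<^sub>L 'e)" where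
  "section_rep \<A> q D y =
     (let p = chart_inv (chart_at \<A> q) y in Gr_chart \<A> (q, D q) (p, D p))"

text \<open>Smooth rank \<open>k\<close> distributions near \<open>q\<close>; only the values of \<open>D\<close> near \<open>q\<close> matter.\<close>

definition local_distribution ::
  "('m::topological_space, 'e::euclidean_space) chart set \<Rightarrow> nat \<Rightarrow> 'm \<Rightarrow> ('m \<Rightarrow> 'e set) \<Rightarrow> bool" where
  "local_distribution \<A> k q D \<longleftrightarrow>
     (\<exists>W. open W \<and> q \<in> W \<and> W \<subseteq> fst (chart_at \<A> q) \<and>
        (\<forall>p\<in>W. (p, D p) \<in> Gr_bundle k \<inter> Gr_chart_domain \<A> (q, D q)) \<and>
        smooth_on (snd (chart_at \<A> q) ` W) (section_rep \<A> q D))"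

text \<open>Tangent spaces of the total space, represented in the chart centred at the point in question.
  In these charts the differential of the bundle projection is \<open>fst\<close>.\<close>

definition tangent_Gr :: "'m \<times> 'e::euclidean_space set \<Rightarrow> ('e \<times> ('e \<Rightarrow>\<^sub>L 'e)) set" where
  "tangent_Gr x = UNIV \<times> Hom_perp (snd x)"

definition vertical :: "'m \<times> 'e::euclidean_space set \<Rightarrow> ('e \<times> ('e \<Rightarrow>\<^sub>L 'e)) set" where
  "vertical x = {w \<in> tangent_Gr x. fst w = 0}"

definition section_diff ::
  "('m, 'e::euclidean_space) chart set \<Rightarrow> 'm \<Rightarrow> ('m \<Rightarrow> 'e set) \<Rightarrow> 'e \<Rightarrow>\<^sub>L ('e \<times> ('e \<Rightarrow>\<^sub>L 'e))" where
  "section_diff \<A> q D = Blinfun (frechet_derivative (section_rep \<A> q D) (at (coord_at \<A> q)))"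

text \<open>The \<open>1\<close>-jet of a local section at \<open>q\<close>, encoded by its value and its differential at \<open>q\<close>.\<close>

type_synonym ('m, 'e) jet = "('m \<times> 'e set) \<times> ('e \<Rightarrow>\<^sub>L ('e \<times> ('e \<Rightarrow>\<^sub>L 'e)))"

definition jet1 ::
  "('m, 'e::euclidean_space) chart set \<Rightarrow> 'm \<Rightarrow> ('m \<Rightarrow> 'e set) \<Rightarrow> ('m, 'e) jet" where
  "jet1 \<A> q D = ((q, D q), section_diff \<A> q D)"

section \<open>The dual Levi map\<close>

definition form_rep ::
  "('m, 'e::euclidean_space) chart set \<Rightarrow> 'm \<Rightarrow> ('m \<Rightarrow> 'e \<Rightarrow>\<^sub>L real) \<Rightarrow> 'e \<Rightarrow> 'e \<Rightarrow>\<^sub>L real" where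
  "form_rep \<A> q a y =
     (let c = chart_at \<A> q; p = chart_inv c y in a p o\<^sub>L chart_diff_inv \<A> c p)"

text \<open>Smooth \<open>1\<close>-forms near \<open>q\<close> that annihilate \<open>D\<close>.\<close>

definition local_annihilating_form ::
  "('m::topological_space, 'e::euclidean_space) chart set \<Rightarrow> 'm \<Rightarrow> ('m \<Rightarrow> 'e set) \<Rightarrow>
     ('m \<Rightarrow> 'e \<Rightarrow>\<^sub>L real) \<Rightarrow> bool" where
  "local_annihilating_form \<A> q D a \<longleftrightarrow>
     (\<exists>W. open W \<and> q \<in> W \<and> W \<subseteq> fst (chart_at \<A> q) \<and>
        smooth_on (snd (chart_at \<A> q) ` W) (form_rep \<A> q a) \<and>
        (\<forall>p\<in>W. \<forall>u\<in>D p. blinfun_apply (a p) u = 0))"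

text \<open>The exterior derivative at \<open>q\<close>: \<open>(u, v) \<mapsto> \<partial>\<^sub>u a(v) - \<partial>\<^sub>v a(u)\<close> in coordinates.\<close>

definition ext_deriv ::
  "('m, 'e::euclidean_space) chart set \<Rightarrow> 'm \<Rightarrow> ('m \<Rightarrow> 'e \<Rightarrow>\<^sub>L real) \<Rightarrow> 'e \<Rightarrow>\<^sub>L 'e \<Rightarrow>\<^sub>L real" where
  "ext_deriv \<A> q a =
     (let a' = frechet_derivative (form_rep \<A> q a) (at (coord_at \<A> q))
      in Blinfun (\<lambda>u. a' u - Blinfun (\<lambda>v. blinfun_apply (a' v) u)))"

text \<open>For a subspace \<open>V\<close> of \<open>'e\<close>, linear and alternating bilinear forms on \<open>V\<close> are represented
  by their extensions to \<open>'e\<close> that vanish as soon as one argument lies in \<open>V\<^sup>\<bottom>\<close>.\<close>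

definition dual_space :: "'e::euclidean_space set \<Rightarrow> ('e \<Rightarrow>\<^sub>L real) set" where
  "dual_space V = {\<epsilon>. \<forall>w\<in>V\<^sup>\<bottom>. blinfun_apply \<epsilon> w = 0}"

definition alt_forms :: "'e::euclidean_space set \<Rightarrow> ('e \<Rightarrow>\<^sub>L 'e \<Rightarrow>\<^sub>L real) set" where
  "alt_forms V = {\<omega>. (\<forall>u. blinfun_apply (blinfun_apply \<omega> u) u = 0) \<and>
     (\<forall>w\<in>V\<^sup>\<bottom>. blinfun_apply \<omega> w = 0)}"

definition restrict_form ::
  "'e::euclidean_space set \<Rightarrow> ('e \<Rightarrow>\<^sub>L 'e \<Rightarrow>\<^sub>L real) \<Rightarrow> 'e \<Rightarrow>\<^sub>L 'e \<Rightarrow>\<^sub>L real" where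
  "restrict_form V \<omega> = (THE \<eta>. \<eta> \<in> alt_forms V \<and>
     (\<forall>u\<in>V. \<forall>v\<in>V. blinfun_apply (blinfun_apply \<eta> u) v = blinfun_apply (blinfun_apply \<omega> u) v))"

definition annihilator :: "'e::euclidean_space set \<Rightarrow> ('e \<Rightarrow>\<^sub>L real) set" where
  "annihilator D = {\<alpha>. \<forall>u\<in>D. blinfun_apply \<alpha> u = 0}"

definition dual_Levi ::
  "('m::topological_space, 'e::euclidean_space) chart set \<Rightarrow> 'm \<Rightarrow> ('m \<Rightarrow> 'e set) \<Rightarrow>
     ('e \<Rightarrow>\<^sub>L real) \<Rightarrow> 'e \<Rightarrow>\<^sub>L 'e \<Rightarrow>\<^sub>L real" where
  "dual_Levi \<A> q D \<alpha> = (THE \<omega>. \<exists>a. local_annihilating_form \<A> q D a \<and> a q = \<alpha> \<and>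
     \<omega> = restrict_form (D q) (ext_deriv \<A> q a))"

section \<open>The generic orbit and the relation\<close>

definition wedge ::
  "('e::euclidean_space \<Rightarrow>\<^sub>L real) \<Rightarrow> ('e \<Rightarrow>\<^sub>L real) \<Rightarrow> 'e \<Rightarrow>\<^sub>L 'e \<Rightarrow>\<^sub>L real" where
  "wedge \<epsilon> \<eta> = Blinfun (\<lambda>u. blinfun_apply \<epsilon> u *\<^sub>R \<eta> - blinfun_apply \<eta> u *\<^sub>R \<epsilon>)"

text \<open>The \<open>GL(V)\<close>-orbit of planes having, in some basis \<open>\<epsilon> 1, \<dots>, \<epsilon> (2 * N + 1)\<close> of the
  dual of \<open>V\<close>, the normal form below.\<close>

definition generic_orbit :: "nat \<Rightarrow> 'e::euclidean_space set \<Rightarrow> ('e \<Rightarrow>\<^sub>L 'e \<Rightarrow>\<^sub>L real) set set" where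
  "generic_orbit N V = {P. \<exists>\<epsilon> :: nat \<Rightarrow> 'e \<Rightarrow>\<^sub>L real.
     inj_on \<epsilon> {1..2 * N + 1} \<and> independent (\<epsilon> ` {1..2 * N + 1}) \<and>
     span (\<epsilon> ` {1..2 * N + 1}) = dual_space V \<and>
     P = {\<Sum>k = 1..N. wedge (s *\<^sub>R \<epsilon> k + t *\<^sub>R \<epsilon> (k + 1)) (\<epsilon> (2 * N + 2 - k)) | s t. True}}"

definition generic_relation ::
  "('m::topological_space, 'e::euclidean_space) chart set \<Rightarrow> nat \<Rightarrow> ('m, 'e) jet set" where
  "generic_relation \<A> N = {jet1 \<A> q D | q D. local_distribution \<A> (2 * N + 1) q D \<and>
     dim (dual_Levi \<A> q D ` annihilator (D q)) = 2 \<and>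
     dual_Levi \<A> q D ` annihilator (D q) \<in> generic_orbit N (D q)}"

section \<open>Ampleness\<close>

definition linear_between ::
  "'a::real_vector set \<Rightarrow> 'b::real_vector set \<Rightarrow> ('a \<Rightarrow> 'b) \<Rightarrow> bool" where
  "linear_between S T f \<longleftrightarrow> f ` S \<subseteq> T \<and>
     (\<forall>u\<in>S. \<forall>v\<in>S. f (u + v) = f u + f v) \<and> (\<forall>r. \<forall>u\<in>S. f (r *\<^sub>R u) = r *\<^sub>R f u)"

text \<open>Fibrewise linear projections of the tangent bundle of the total space onto the vertical
  distribution. Smoothness in \<open>x\<close> is not required, since ampleness over \<open>x\<close> involves only the
  value at \<open>x\<close>; in particular all smooth connections are included.\<close>

definition connection ::
  "nat \<Rightarrow> ('m \<times> 'e::euclidean_space set \<Rightarrow> 'e \<times> ('e \<Rightarrow>\<^sub>L 'e) \<Rightarrow> 'e \<times> ('e \<Rightarrow>\<^sub>L 'e)) \<Rightarrow> bool" where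
  "connection k \<AA> \<longleftrightarrow> (\<forall>x\<in>Gr_bundle k.
     linear_between (tangent_Gr x) (vertical x) (\<AA> x) \<and> (\<forall>w\<in>vertical x. \<AA> x w = w))"

definition principal_subspace ::
  "'b set \<Rightarrow> 'e set \<Rightarrow> ('e \<Rightarrow> 'b) \<Rightarrow> ('e::real_normed_vector \<Rightarrow>\<^sub>L 'b::real_normed_vector) set" where
  "principal_subspace V \<tau> l =
     {L. (\<forall>v. blinfun_apply L v \<in> V) \<and> (\<forall>v\<in>\<tau>. blinfun_apply L v = l v)}"

definition ample_in :: "'a::real_normed_vector set \<Rightarrow> 'a set \<Rightarrow> bool" where
  "ample_in E S \<longleftrightarrow> S = {} \<or> (\<forall>C\<in>components S. convex hull C = E)"

text \<open>The fibre over \<open>x\<close> of the relation, transported to \<open>Hom(T\<^sub>qM, V\<^sub>x)\<close> by the connection.\<close>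

definition relation_fibre ::
  "('m \<times> 'e::euclidean_space set \<Rightarrow> 'e \<times> ('e \<Rightarrow>\<^sub>L 'e) \<Rightarrow> 'e \<times> ('e \<Rightarrow>\<^sub>L 'e)) \<Rightarrow> ('m, 'e) jet set \<Rightarrow>
     'm \<times> 'e set \<Rightarrow> ('e \<Rightarrow>\<^sub>L ('e \<times> ('e \<Rightarrow>\<^sub>L 'e))) set" where
  "relation_fibre \<AA> R x = {Blinfun (\<lambda>v. \<AA> x (blinfun_apply j v)) | j. (x, j) \<in> R}"

definition ample_relation ::
  "nat \<Rightarrow> ('m \<times> 'e::euclidean_space set \<Rightarrow> 'e \<times> ('e \<Rightarrow>\<^sub>L 'e) \<Rightarrow> 'e \<times> ('e \<Rightarrow>\<^sub>L 'e)) \<Rightarrow>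
     ('m, 'e) jet set \<Rightarrow> bool" where
  "ample_relation k \<AA> R \<longleftrightarrow> (\<forall>x\<in>Gr_bundle k. \<forall>\<tau> l.
     subspace \<tau> \<and> dim \<tau> = DIM('e) - 1 \<and> linear_between \<tau> (vertical x) l \<longrightarrow>
     ample_in (principal_subspace (vertical x) \<tau> l)
       (relation_fibre \<AA> R x \<inter> principal_subspace (vertical x) \<tau> l))"

end

theory Submission
  imports Defs "HOL-Computational_Algebra.Fundamental_Theorem_Algebra"
begin

text \<open>The fibre of the relation asks that two alternating forms on \<open>D\<close>, of dimension \<open>2 * N + 1\<close>, span
  a plane with a basis in normal form. A principal subspace prescribes the jet along
  \<open>\<tau> = ker \<theta>\<close>. If \<open>D \<subseteq> \<tau>\<close>, the dual Levi map is constant on it, and the relation contains all or nothing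
  of it. Otherwise fix a point of the relation, with Levi forms \<open>\<omega>1, \<omega>2\<close> in normal form; the other points
  of the principal subspace have the Levi forms \<open>\<omega>i + xi \<and> \<theta>\<close>, with \<open>x1, x2\<close> arbitrary
  (\<open>ample_slice\<close>). So the claim is that, among the pairs \<open>(x1, x2)\<close> for which these forms are still in
  normal form, the connected component of \<open>0\<close> has the whole space as its convex hull
  (\<open>pencil_slice.convex_hull_component\<close>).

  If it had not, a nonzero functional \<open>(y1, y2)\<close> would be bounded above on the component. Such a functional
  vanishes on the direction of every line inside the slice that meets the component, and is nonpositive on
  directions of rays. Pairs that do not change the forms on \<open>D\<close> show that \<open>y1, y2\<close> lie in \<open>D\<close> and are
  orthogonal to \<open>\<theta>\<close>. Transvections scaling a vector \<open>w\<close> with \<open>\<theta> \<bullet> w = 1\<close> move each point along a ray;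
  since the component contains a neighbourhood of \<open>0\<close> (\<open>nf_pair_open\<close>), the rays show that the functional is
  zero once \<open>\<omega>1 y1 w + \<omega>2 y2 w = 0\<close> for some such \<open>w\<close> (\<open>functional_zero_if_base\<close>). There are two cases. The normal
  form has a distinguished isotropic subspace, the span of the \<open>e i\<close>.

  \<^item> If \<open>\<theta>\<close> does not vanish on it (\<open>functional_zero_regular\<close>), then nilpotent maps with Hankel matrices
    generate one-parameter groups of shears that preserve \<open>\<omega>1\<close>, \<open>\<omega>2\<close> and \<open>\<theta>\<close>, and their orbits are lines in the
    slice. This forces \<open>y1, y2\<close> into the isotropic subspace, which also contains a suitable \<open>w\<close>.
  \<^item> If \<open>\<theta>\<close> vanishes on it (\<open>functional_zero_singular\<close>), then lines are written down explicitly. Here the forms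
    reduce to a pencil \<open>g \<mapsto> (1 - \<mu> x) g + L g (\<Gamma>1 - \<mu> \<Gamma>2)\<close> on polynomials of degree less than \<open>N\<close>, and the
    pair is in normal form as soon as this pencil is injective for all complex \<open>\<mu>\<close>, including infinity
    (\<open>nf_pair_of_injective_pencil\<close>). For \<open>\<Gamma>1, \<Gamma>2\<close> built from powers of \<open>(x - c)\<^sup>2 + d\<^sup>2\<close> a kernel would make a
    nonreal number real; the parity of \<open>N\<close> decides which construction is available.

  Normal forms are recognised throughout by a chain \<open>\<omega>2 (e 1) = 0\<close>, \<open>\<omega>2 (e (k + 1)) = \<omega>1 (e k)\<close>
  with independent \<open>\<omega>1 (e 1), \<dots>, \<omega>1 (e N)\<close> (\<open>nf_table_of_chain\<close>). On the geometric side, \<open>generic_relation_iff\<close> turns membership in the relation into a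
  condition on the differential of the section: the Levi form of \<open>\<alpha>\<close> is \<open>\<alpha> (j v u - j u v)\<close>, and every
  admissible differential is realised by a distribution that is affine in the charts.\<close>

section \<open>Dual families in Euclidean spaces\<close>

lemma riesz_in_subspace:
  fixes g :: "'a::euclidean_space \<Rightarrow> real"
  assumes "subspace D" "linear g"
  obtains y where "y \<in> D" "\<And>v. v \<in> D \<Longrightarrow> g v = y \<bullet> v"
proof -
  define y0 where "y0 = adjoint g 1"
  have g: "g v = y0 \<bullet> v" for v
    using adjoint_works[OF assms(2), of v 1] by (simp add: y0_def inner_commute)
  obtain y z where yz: "y \<in> span D" "\<And>w. w \<in> span D \<Longrightarrow> orthogonal z w" "y0 = y + z"
    using orthogonal_subspace_decomp_exists[of D y0] by blast
  have "g v = y \<bullet> v" if "v \<in> D" for v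
    using yz(2)[of v] that by (simp add: g yz(3) inner_add_left span_base orthogonal_def)
  moreover have "y \<in> D" using yz(1) assms(1) by (metis span_eq_iff)
  ultimately show ?thesis using that by blast
qed

text \<open>In contrast to independence of the image \<open>z ` I\<close>, repetitions in the family are excluded.\<close>

definition independent_family :: "'i set \<Rightarrow> ('i \<Rightarrow> 'a::real_vector) \<Rightarrow> bool" where
  "independent_family I z \<longleftrightarrow> (\<forall>c. (\<Sum>i\<in>I. c i *\<^sub>R z i) = 0 \<longrightarrow> (\<forall>i\<in>I. c i = 0))"

lemma dual_system_independent:
  fixes z :: "'i \<Rightarrow> 'a::real_vector"
  assumes "\<And>i. i \<in> I \<Longrightarrow> linear (h i :: 'a \<Rightarrow> real)"
    and "\<And>i j. i \<in> I \<Longrightarrow> j \<in> I \<Longrightarrow> h i (z j) = (if i = j then 1 else 0)"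
  shows "inj_on z I" "independent (z ` I)"
proof -
  show inj: "inj_on z I"
    by (rule inj_onI) (metis assms(2) zero_neq_one)
  show "independent (z ` I)"
    unfolding dependent_def
  proof
    assume "\<exists>a\<in>z ` I. a \<in> span (z ` I - {a})"
    then obtain j where j: "j \<in> I" "z j \<in> span (z ` I - {z j})" by blast
    have sub: "subspace {x. h j x = 0}"
      using assms(1)[OF j(1)] by (rule linear_subspace_kernel)
    have "z ` I - {z j} \<subseteq> {x. h j x = 0}"
      using assms(2) j by (force split: if_splits)
    then have "span (z ` I - {z j}) \<subseteq> {x. h j x = 0}"
      using span_minimal sub by blast
    then have "h j (z j) = 0" using j by blast
    then show False using assms(2) j by simp
  qed
qed

lemma span_family_sum:
  assumes "finite I" "x \<in> span (z ` I)"
  shows "\<exists>u. x = (\<Sum>i\<in>I. u i *\<^sub>R z i)"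
  using assms(2)
proof (induction rule: span_induct_alt)
  case base
  show ?case by (rule exI[of _ "\<lambda>_. 0"]) simp
next
  case (step c x w)
  then obtain i u where i: "i \<in> I" "x = z i" and u: "w = (\<Sum>i\<in>I. u i *\<^sub>R z i)"
    by blast
  have "c *\<^sub>R x + w = (\<Sum>k\<in>I. (u k + (if k = i then c else 0)) *\<^sub>R z k)"
    using i assms(1) by (simp add: u scaleR_left_distrib sum.distrib if_distrib[of "\<lambda>r. r *\<^sub>R _"] sum.delta cong: if_cong)
  then show ?case by (rule exI[of _ "\<lambda>k. u k + (if k = i then c else 0)"])
qed

text \<open>The vector dual to \<open>y j\<close> is a multiple of the component of \<open>y j\<close> orthogonal to the other \<open>y i\<close>.\<close>

lemma dual_family:
  fixes y :: "'i \<Rightarrow> 'a::euclidean_space"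
  assumes fin: "finite I" and ind: "independent_family I y"
  obtains g where "\<And>i. i \<in> I \<Longrightarrow> g i \<in> span (y ` I)"
    "\<And>i j. i \<in> I \<Longrightarrow> j \<in> I \<Longrightarrow> y i \<bullet> g j = (if i = j then 1 else 0)"
proof -
  have "\<exists>g. g \<in> span (y ` I) \<and> (\<forall>i\<in>I. y i \<bullet> g = (if i = j then 1 else 0))" if j: "j \<in> I" for j
  proof -
    let ?S = "y ` (I - {j})"
    obtain a b where ab: "a \<in> span ?S" "\<And>w. w \<in> span ?S \<Longrightarrow> orthogonal b w" "y j = a + b"
      using orthogonal_subspace_decomp_exists[of ?S "y j"] by blast
    have "y j \<notin> span ?S"
    proof
      assume "y j \<in> span ?S"
      then obtain u where "y j = (\<Sum>i\<in>I - {j}. u i *\<^sub>R y i)"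
        using span_family_sum[of "I - {j}" "y j" y, OF finite_Diff[OF fin]] by auto
      then have "(\<Sum>i\<in>I. (if i = j then -1 else u i) *\<^sub>R y i) = 0"
        using j fin by (simp add: sum.remove[of I j])
      from ind[unfolded independent_family_def, rule_format, OF this j] show False by simp
    qed
    then have "b \<noteq> 0" using ab by auto
    have bb: "y j \<bullet> b = b \<bullet> b" using ab(2)[OF ab(1)] ab(3)
      by (simp add: inner_add_left inner_add_right orthogonal_def inner_commute)
    let ?g = "b /\<^sub>R (b \<bullet> b)"
    have "b = y j - a" using ab by simp
    moreover have "a \<in> span (y ` I)" using ab(1) span_mono[of ?S "y ` I"] by blast
    ultimately have "b \<in> span (y ` I)" using j by (simp add: span_base span_diff)
    then have "?g \<in> span (y ` I)" by (simp add: span_mul)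
    moreover have "y i \<bullet> ?g = (if i = j then 1 else 0)" if "i \<in> I" for i
    proof (cases "i = j")
      case True
      then show ?thesis using bb \<open>b \<noteq> 0\<close> by simp
    next
      case False
      then have "y i \<in> span ?S" using that by (simp add: span_base)
      from ab(2)[OF this] show ?thesis using False by (simp add: orthogonal_def inner_commute)
    qed
    ultimately show ?thesis by blast
  qed
  then obtain g where "\<forall>j\<in>I. g j \<in> span (y ` I) \<and> (\<forall>i\<in>I. y i \<bullet> g j = (if i = j then 1 else 0))"
    by metis
  then show ?thesis using that by blast
qed

lemma dual_family_on:
  fixes h :: "'i \<Rightarrow> 'a::euclidean_space \<Rightarrow> real"
  assumes fin: "finite I" and D: "subspace D" and lin: "\<And>i. i \<in> I \<Longrightarrow> linear (h i)"
    and ind: "\<And>c. (\<And>v. v \<in> D \<Longrightarrow> (\<Sum>i\<in>I. c i * h i v) = 0) \<Longrightarrow> \<forall>i\<in>I. c i = 0"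
  obtains g where "\<And>i. i \<in> I \<Longrightarrow> g i \<in> D"
    "\<And>i j. i \<in> I \<Longrightarrow> j \<in> I \<Longrightarrow> h i (g j) = (if i = j then 1 else 0)"
proof -
  have "\<exists>y. y \<in> D \<and> (\<forall>v\<in>D. h i v = y \<bullet> v)" if "i \<in> I" for i
    using riesz_in_subspace[OF D lin[OF that]] by metis
  then obtain y where y: "\<And>i. i \<in> I \<Longrightarrow> y i \<in> D" "\<And>i v. i \<in> I \<Longrightarrow> v \<in> D \<Longrightarrow> h i v = y i \<bullet> v"
    by metis
  have "independent_family I y"
    unfolding independent_family_def
  proof (intro allI impI)
    fix c assume c: "(\<Sum>i\<in>I. c i *\<^sub>R y i) = 0"
    have "(\<Sum>i\<in>I. c i * h i v) = 0" if "v \<in> D" for v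
    proof -
      have "(\<Sum>i\<in>I. c i * h i v) = (\<Sum>i\<in>I. c i *\<^sub>R y i) \<bullet> v"
        using y(2) that by (simp add: inner_sum_left)
      then show ?thesis using c by simp
    qed
    then show "\<forall>i\<in>I. c i = 0" by (rule ind)
  qed
  then obtain g where g: "\<And>i. i \<in> I \<Longrightarrow> g i \<in> span (y ` I)"
    "\<And>i j. i \<in> I \<Longrightarrow> j \<in> I \<Longrightarrow> y i \<bullet> g j = (if i = j then 1 else 0)"
    using dual_family[OF fin] by metis
  have "span (y ` I) \<subseteq> D" by (rule span_minimal) (use y(1) D in auto)
  with g y show ?thesis using that[of g] by (metis subsetD)
qed

lemma independent_family_spans:
  fixes z :: "'i \<Rightarrow> 'a::euclidean_space"
  assumes fin: "finite I" and ind: "independent_family I z"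
    and mem: "\<And>i. i \<in> I \<Longrightarrow> z i \<in> D" and D: "subspace D" and card: "card I = dim D"
  shows "inj_on z I" "independent (z ` I)" "span (z ` I) = D"
proof -
  obtain g where g: "\<And>i j. i \<in> I \<Longrightarrow> j \<in> I \<Longrightarrow> z i \<bullet> g j = (if i = j then 1 else 0)"
    using dual_family[OF fin ind] by metis
  have l: "linear (\<lambda>v. v \<bullet> g i)" for i
    by (simp add: linear_iff inner_add_left)
  show inj: "inj_on z I" and ind': "independent (z ` I)"
    using dual_system_independent[of I "\<lambda>i v. v \<bullet> g i" z] l g by auto
  show "span (z ` I) = D"
  proof (rule subspace_dim_equal)
    show "span (z ` I) \<subseteq> D" by (rule span_minimal) (use mem D in auto)
    show "dim D \<le> dim (span (z ` I))"
      using card card_image[OF inj] ind' by (simp add: dim_eq_card_independent)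
  qed (use D in auto)
qed

lemma two_families_span:
  fixes e :: "'i \<Rightarrow> 'a::euclidean_space" and f :: "'j \<Rightarrow> 'a"
  assumes fin: "finite I" "finite J" and D: "subspace D" and dim: "dim D = card I + card J"
    and mem: "\<And>i. i \<in> I \<Longrightarrow> e i \<in> D" "\<And>j. j \<in> J \<Longrightarrow> f j \<in> D"
    and ind: "\<And>c d. (\<Sum>i\<in>I. c i *\<^sub>R e i) + (\<Sum>j\<in>J. d j *\<^sub>R f j) = 0 \<Longrightarrow>
      (\<forall>i\<in>I. c i = 0) \<and> (\<forall>j\<in>J. d j = 0)"
    and v: "v \<in> D"
  obtains c d where "v = (\<Sum>i\<in>I. c i *\<^sub>R e i) + (\<Sum>j\<in>J. d j *\<^sub>R f j)"
proof -
  have "independent_family (I <+> J) (case_sum e f)"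
    unfolding independent_family_def
  proof (intro allI impI)
    fix c assume "(\<Sum>i\<in>I <+> J. c i *\<^sub>R case_sum e f i) = 0"
    then have "(\<Sum>i\<in>I. c (Inl i) *\<^sub>R e i) + (\<Sum>j\<in>J. c (Inr j) *\<^sub>R f j) = 0"
      using fin by (simp add: sum.Plus)
    from ind[OF this] show "\<forall>i\<in>I <+> J. c i = 0" by auto
  qed
  then have "span (case_sum e f ` (I <+> J)) = D"
  proof (rule independent_family_spans(3)[rotated])
    show "case_sum e f i \<in> D" if "i \<in> I <+> J" for i
      using that mem by auto
  qed (use fin D dim in \<open>simp_all add: card_Plus\<close>)
  then obtain u where "v = (\<Sum>i\<in>I <+> J. u i *\<^sub>R case_sum e f i)"
    using span_family_sum[of "I <+> J" v "case_sum e f"] v fin by (metis finite_Plus)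
  then have "v = (\<Sum>i\<in>I. u (Inl i) *\<^sub>R e i) + (\<Sum>j\<in>J. u (Inr j) *\<^sub>R f j)"
    using fin by (simp add: sum.Plus)
  then show ?thesis by (rule that)
qed

text \<open>The sum is the Riesz representative of \<open>g\<close> in \<open>D\<close>; being explicit, it depends linearly and
  continuously on parameters in \<open>g\<close>.\<close>

lemma orthonormal_rep:
  fixes D :: "'a::euclidean_space set"
  assumes "subspace D"
  obtains B where "finite B" "B \<subseteq> D" "\<And>b. b \<in> B \<Longrightarrow> norm b = 1"
    "\<And>g v. linear (g :: 'a \<Rightarrow> real) \<Longrightarrow> v \<in> D \<Longrightarrow> (\<Sum>b\<in>B. g b *\<^sub>R b) \<bullet> v = g v"
proof -
  obtain B where B: "B \<subseteq> D" "pairwise orthogonal B" "\<And>x. x \<in> B \<Longrightarrow> norm x = 1"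
    "independent B" "span B = D"
    using orthonormal_basis_subspace[OF assms] by metis
  have fin: "finite B" using B(4) independent_imp_finite by blast
  have "(\<Sum>b\<in>B. g b *\<^sub>R b) \<bullet> v = g v" if g: "linear g" and v: "v \<in> D" for g :: "'a \<Rightarrow> real" and v
  proof -
    have "v = (\<Sum>b\<in>B. (v \<bullet> b) *\<^sub>R b)"
      using orthonormal_basis_expand[OF B(2) B(3) _ fin, of v] B(5) v by simp
    then have "g v = g (\<Sum>b\<in>B. (v \<bullet> b) *\<^sub>R b)" by simp
    also have "\<dots> = (\<Sum>b\<in>B. (v \<bullet> b) * g b)" by (simp add: linear_sum[OF g] linear_cmul[OF g])
    finally have "g v = (\<Sum>b\<in>B. (v \<bullet> b) * g b)" .
    then show ?thesis by (simp add: inner_sum_right inner_commute[of _ v] mult.commute)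
  qed
  then show ?thesis using that fin B by blast
qed

section \<open>Pairs of alternating forms in normal form\<close>

definition alternating :: "('a::euclidean_space \<Rightarrow> 'a \<Rightarrow> real) \<Rightarrow> bool" where
  "alternating \<omega> \<longleftrightarrow> bilinear \<omega> \<and> (\<forall>u. \<omega> u u = 0)"

lemma alternating_linear:
  assumes "alternating \<omega>"
  shows "linear (\<lambda>v. \<omega> u v)" "linear (\<lambda>u. \<omega> u v)"
  using assms by (auto simp: alternating_def bilinear_def)

lemma alternating_bilinear: "alternating \<omega> \<Longrightarrow> bilinear \<omega>"
  by (simp add: alternating_def)

lemma alternating_self [simp]: "alternating \<omega> \<Longrightarrow> \<omega> u u = 0"
  by (simp add: alternating_def)

lemma alternating_commute:
  assumes "alternating \<omega>"
  shows "\<omega> u v = - \<omega> v u"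
proof -
  have b: "bilinear \<omega>" using assms by (simp add: alternating_def)
  have "\<omega> (u + v) (u + v) = 0" using assms by simp
  then have "\<omega> u u + \<omega> u v + (\<omega> v u + \<omega> v v) = 0"
    by (simp add: bilinear_ladd[OF b] bilinear_radd[OF b])
  then show ?thesis using assms by simp
qed

lemma alternating_sum:
  assumes "alternating \<omega>"
  shows "\<omega> (\<Sum>i\<in>I. c i *\<^sub>R x i) v = (\<Sum>i\<in>I. c i * \<omega> (x i) v)"
    "\<omega> u (\<Sum>i\<in>I. c i *\<^sub>R x i) = (\<Sum>i\<in>I. c i * \<omega> u (x i))"
  by (simp_all add: linear_sum[OF alternating_linear(2)[OF assms]] linear_sum[OF alternating_linear(1)[OF assms]]
      linear_cmul[OF alternating_linear(2)[OF assms]] linear_cmul[OF alternating_linear(1)[OF assms]])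

lemma alternating_add:
  assumes "alternating \<omega>"
  shows "\<omega> (x + y) v = \<omega> x v + \<omega> y v" "\<omega> u (x + y) = \<omega> u x + \<omega> u y"
    "\<omega> (x - y) v = \<omega> x v - \<omega> y v" "\<omega> u (x - y) = \<omega> u x - \<omega> u y"
    "\<omega> (r *\<^sub>R x) v = r * \<omega> x v" "\<omega> u (r *\<^sub>R x) = r * \<omega> u x"
    "\<omega> 0 v = 0" "\<omega> u 0 = 0"
  using alternating_bilinear[OF assms]
  by (auto simp: bilinear_ladd bilinear_radd bilinear_lsub bilinear_rsub bilinear_lmul bilinear_rmul
      bilinear_lzero bilinear_rzero)

text \<open>If \<open>\<epsilon> 1, \<dots>, \<epsilon> (2 * N + 1)\<close> is the basis dual to \<open>e 1, \<dots>, e (N + 1), f N, \<dots>, f 1\<close>, then these are the values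
  of \<open>\<omega>1 = (\<Sum>k=1..N. \<epsilon> k \<and> \<epsilon> (2 * N + 2 - k))\<close> and \<open>\<omega>2 = (\<Sum>k=1..N. \<epsilon> (k + 1) \<and> \<epsilon> (2 * N + 2 - k))\<close>.\<close>

definition nf_table :: "nat \<Rightarrow> 'a::euclidean_space set \<Rightarrow> ('a \<Rightarrow> 'a \<Rightarrow> real) \<Rightarrow> ('a \<Rightarrow> 'a \<Rightarrow> real) \<Rightarrow>
    (nat \<Rightarrow> 'a) \<Rightarrow> (nat \<Rightarrow> 'a) \<Rightarrow> bool" where
  "nf_table N D \<omega>1 \<omega>2 e f \<longleftrightarrow>
     (\<forall>i\<in>{1..N+1}. e i \<in> D) \<and> (\<forall>j\<in>{1..N}. f j \<in> D) \<and>
     (\<forall>i\<in>{1..N+1}. \<forall>j\<in>{1..N+1}. \<omega>1 (e i) (e j) = 0 \<and> \<omega>2 (e i) (e j) = 0) \<and>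
     (\<forall>i\<in>{1..N}. \<forall>j\<in>{1..N}. \<omega>1 (f i) (f j) = 0 \<and> \<omega>2 (f i) (f j) = 0) \<and>
     (\<forall>i\<in>{1..N+1}. \<forall>j\<in>{1..N}. \<omega>1 (e i) (f j) = (if i = j then 1 else 0) \<and>
        \<omega>2 (e i) (f j) = (if i = j + 1 then 1 else 0))"

definition nf_pair :: "nat \<Rightarrow> 'a::euclidean_space set \<Rightarrow> ('a \<Rightarrow> 'a \<Rightarrow> real) \<Rightarrow> ('a \<Rightarrow> 'a \<Rightarrow> real) \<Rightarrow> bool" where
  "nf_pair N D \<omega>1 \<omega>2 \<longleftrightarrow> (\<exists>e f. nf_table N D \<omega>1 \<omega>2 e f)"

text \<open>These relations reduce \<open>\<omega>2 - \<lambda> \<omega>1\<close>, applied to the polynomial \<open>\<Sum>k=1..n. \<lambda> ^ (k - 1) e k\<close>, to its top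
  term \<open>- \<lambda> ^ n \<omega>1 (e n)\<close>. Once that vanishes too, the \<open>e k\<close> are the coefficients of a kernel vector of the pencil.\<close>

definition kernel_chain :: "nat \<Rightarrow> 'a::euclidean_space set \<Rightarrow> ('a \<Rightarrow> 'a \<Rightarrow> real) \<Rightarrow> ('a \<Rightarrow> 'a \<Rightarrow> real) \<Rightarrow>
    (nat \<Rightarrow> 'a) \<Rightarrow> bool" where
  "kernel_chain n D \<omega>1 \<omega>2 e \<longleftrightarrow>
     (\<forall>i\<in>{1..n}. e i \<in> D) \<and> (\<forall>v\<in>D. \<omega>2 (e 1) v = 0) \<and>
     (\<forall>i\<in>{1..<n}. \<forall>v\<in>D. \<omega>2 (e (i + 1)) v = \<omega>1 (e i) v)"

definition forms_indep :: "nat \<Rightarrow> 'a::euclidean_space set \<Rightarrow> ('a \<Rightarrow> 'a \<Rightarrow> real) \<Rightarrow> (nat \<Rightarrow> 'a) \<Rightarrow> bool" where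
  "forms_indep N D \<omega> e \<longleftrightarrow>
     (\<forall>c. (\<forall>v\<in>D. (\<Sum>i=1..N. c i * \<omega> (e i) v) = 0) \<longrightarrow> (\<forall>i\<in>{1..N}. c i = 0))"

lemma forms_indep_dual:
  assumes alt: "alternating \<omega>" and D: "subspace D" and ind: "forms_indep N D \<omega> e"
  obtains f where "\<And>j. j \<in> {1..N} \<Longrightarrow> f j \<in> D"
    "\<And>i j. i \<in> {1..N} \<Longrightarrow> j \<in> {1..N} \<Longrightarrow> \<omega> (e i) (f j) = (if i = j then 1 else 0)"
proof (rule dual_family_on[of "{1..N}" D "\<lambda>i. \<omega> (e i)"])
  show "linear (\<omega> (e i))" for i using alternating_linear(1)[OF alt] .
  show "\<forall>i\<in>{1..N}. c i = 0" if "\<And>v. v \<in> D \<Longrightarrow> (\<Sum>i=1..N. c i * \<omega> (e i) v) = 0" for c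
    using ind that unfolding forms_indep_def by blast
qed (use D that in auto)

text \<open>The relations and antisymmetry give \<open>\<omega>2 (e (i + 1)) (e j) = \<omega>2 (e i) (e (j + 1))\<close>. Moving the two indices
  towards each other ends at equal indices, or at neighbours, where the value equals its own negative.\<close>

lemma kernel_chain_isotropic2:
  assumes alt: "alternating \<omega>1" "alternating \<omega>2" and ch: "kernel_chain n D \<omega>1 \<omega>2 e"
    and ij: "i \<in> {1..n}" "j \<in> {1..n}"
  shows "\<omega>2 (e i) (e j) = 0"
proof -
  have mem: "e i \<in> D" if "i \<in> {1..n}" for i using ch that by (auto simp: kernel_chain_def)
  have rel: "\<omega>2 (e (i + 1)) (e j) = \<omega>1 (e i) (e j)" if "i \<in> {1..<n}" "j \<in> {1..n}" for i j
    using ch that mem by (auto simp: kernel_chain_def)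
  have shift: "\<omega>2 (e (i + 1)) (e j) = \<omega>2 (e i) (e (j + 1))" if "i \<in> {1..<n}" "j \<in> {1..<n}" for i j
  proof -
    have "\<omega>2 (e (i + 1)) (e j) = \<omega>1 (e i) (e j)" using rel that by auto
    also have "\<dots> = - \<omega>1 (e j) (e i)" by (rule alternating_commute[OF alt(1)])
    also have "\<dots> = - \<omega>2 (e (j + 1)) (e i)" using rel that by auto
    also have "\<dots> = \<omega>2 (e i) (e (j + 1))" using alternating_commute[OF alt(2)] by metis
    finally show ?thesis .
  qed
  have main: "\<omega>2 (e (i + d)) (e i) = 0" if "i \<ge> 1" "i + d \<le> n" for i d
    using that
  proof (induction d arbitrary: i rule: less_induct)
    case (less d)
    consider "d = 0" | "d = 1" | d' where "d = Suc (Suc d')" by (metis One_nat_def not0_implies_Suc)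
    then show ?case
    proof cases
      case 1
      then show ?thesis using alt by simp
    next
      case 2
      have "\<omega>2 (e (i + 1)) (e i) = \<omega>2 (e i) (e (i + 1))" using shift[of i i] less.prems 2 by simp
      moreover have "\<omega>2 (e i) (e (i + 1)) = - \<omega>2 (e (i + 1)) (e i)"
        by (rule alternating_commute[OF alt(2)])
      ultimately show ?thesis using 2 by simp
    next
      case 3
      have "\<omega>2 (e (i + d)) (e i) = \<omega>2 (e (i + d - 1)) (e (i + 1))"
        using shift[of "i + d - 1" i] less.prems 3 by simp
      also have "\<dots> = \<omega>2 (e ((i + 1) + d')) (e (i + 1))" using 3 by simp
      also have "\<dots> = 0" using less.IH[of d' "i + 1"] less.prems 3 by simp
      finally show ?thesis .
    qed
  qed
  show ?thesis
  proof (cases "j \<le> i")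
    case True
    then show ?thesis using main[of j "i - j"] ij by simp
  next
    case False
    then have "\<omega>2 (e j) (e i) = 0" using main[of i "j - i"] ij by simp
    then show ?thesis using alternating_commute[OF alt(2), of "e i" "e j"] by simp
  qed
qed

lemma kernel_chain_isotropic1:
  assumes alt: "alternating \<omega>1" "alternating \<omega>2" and ch: "kernel_chain n D \<omega>1 \<omega>2 e"
    and ij: "i \<in> {1..n}" "j \<in> {1..n}"
  shows "\<omega>1 (e i) (e j) = 0"
proof -
  have rel: "\<omega>2 (e (i + 1)) (e j) = \<omega>1 (e i) (e j)" if "i \<in> {1..<n}" "j \<in> {1..n}" for i j
    using ch that by (auto simp: kernel_chain_def)
  have *: "\<omega>1 (e i) (e j) = 0" if "i \<in> {1..<n}" "j \<in> {1..n}" for i j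
    using rel[OF that] kernel_chain_isotropic2[OF alt ch, of "i + 1" j] that by simp
  consider "i < n" | "j < n" | "i = j" using ij by fastforce
  then show ?thesis
  proof cases
    case 1
    then show ?thesis using * ij by simp
  next
    case 2
    then show ?thesis using *[of j i] ij alternating_commute[OF alt(1), of "e i" "e j"] by simp
  next
    case 3
    then show ?thesis using alt by simp
  qed
qed

lemma nf_table_mem:
  assumes "nf_table N D \<omega>1 \<omega>2 e f"
  shows "i \<in> {1..N+1} \<Longrightarrow> e i \<in> D" "j \<in> {1..N} \<Longrightarrow> f j \<in> D"
  using assms by (auto simp: nf_table_def)

lemma chain_pairing_expand:
  assumes alt: "alternating \<omega>1" "alternating \<omega>2" and D: "subspace D" "dim D = 2 * N + 1" and N: "N \<ge> 1"
    and e: "\<And>i. i \<in> {1..N+1} \<Longrightarrow> e i \<in> D" and f: "\<And>j. j \<in> {1..N} \<Longrightarrow> f j \<in> D"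
    and iso: "\<And>i j. i \<in> {1..N} \<Longrightarrow> j \<in> {1..N+1} \<Longrightarrow> \<omega>1 (e i) (e j) = 0"
    and p1: "\<And>i j. i \<in> {1..N} \<Longrightarrow> j \<in> {1..N} \<Longrightarrow> \<omega>1 (e i) (f j) = (if i = j then 1 else 0)"
    and p2: "\<And>i j. i \<in> {1..N+1} \<Longrightarrow> j \<in> {1..N} \<Longrightarrow> \<omega>2 (e i) (f j) = (if i = j + 1 then 1 else 0)"
    and v: "v \<in> D"
  obtains c where "v = (\<Sum>i=1..N+1. c i *\<^sub>R e i) + (\<Sum>j=1..N. \<omega>1 (e j) v *\<^sub>R f j)"
proof -
  have co: "\<omega>1 (e l) ((\<Sum>i=1..N+1. c i *\<^sub>R e i) + (\<Sum>j=1..N. d j *\<^sub>R f j)) = d l" if "l \<in> {1..N}" for c d l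
  proof -
    have "\<omega>1 (e l) (\<Sum>i=1..N+1. c i *\<^sub>R e i) = 0"
      by (simp only: alternating_sum(2)[OF alt(1)]) (intro sum.neutral ballI, use iso that in auto)
    moreover have "\<omega>1 (e l) (\<Sum>j=1..N. d j *\<^sub>R f j) = (\<Sum>j=1..N. if l = j then d j else 0)"
      by (simp only: alternating_sum(2)[OF alt(1)]) (intro sum.cong, use p1 that in auto)
    ultimately show ?thesis using that by (simp add: alternating_add[OF alt(1)])
  qed
  obtain c d where cd: "v = (\<Sum>i=1..N+1. c i *\<^sub>R e i) + (\<Sum>j=1..N. d j *\<^sub>R f j)"
  proof (rule two_families_span[of "{1..N+1}" "{1..N}" D e f v])
    fix c d assume z: "(\<Sum>i=1..N+1. c i *\<^sub>R e i) + (\<Sum>j=1..N. d j *\<^sub>R f j) = 0"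
    have d0: "d l = 0" if "l \<in> {1..N}" for l
      using co[OF that, of c d] unfolding z by (simp add: alternating_add[OF alt(1)])
    have "(\<Sum>j=1..N. d j *\<^sub>R f j) = 0"
      by (intro sum.neutral ballI) (use d0 in auto)
    then have z': "(\<Sum>i=1..N+1. c i *\<^sub>R e i) = 0" using z by simp
    have c': "c (l + 1) = 0" if "l \<in> {1..N}" for l
    proof -
      have "\<omega>2 (\<Sum>i=1..N+1. c i *\<^sub>R e i) (f l) = (\<Sum>i=1..N+1. if i = l + 1 then c i else 0)"
        by (simp only: alternating_sum(1)[OF alt(2)]) (intro sum.cong, use p2 that in auto)
      also have "\<dots> = c (l + 1)" using that by (simp only: sum.delta finite_atLeastAtMost) simp
      finally show ?thesis unfolding z' by (simp add: alternating_add[OF alt(2)])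
    qed
    have c2: "c i = 0" if "i \<in> {2..N+1}" for i
    proof -
      have "i - 1 \<in> {1..N}" "i - 1 + 1 = i" using that by auto
      then show ?thesis using c'[of "i - 1"] by metis
    qed
    have "(\<Sum>i=1..N+1. c i *\<^sub>R e i) = c 1 *\<^sub>R e 1"
    proof -
      have "(\<Sum>i=1..N+1. c i *\<^sub>R e i) = (\<Sum>i\<in>{1}. c i *\<^sub>R e i)"
        by (rule sum.mono_neutral_right) (use c2 in auto)
      then show ?thesis by simp
    qed
    moreover have "e 1 \<noteq> 0"
      using p1[of 1 1] N by (auto simp: alternating_add[OF alt(1)])
    ultimately have "c 1 = 0" using z' by simp
    then have "c i = 0" if "i \<in> {1..N+1}" for i
      using c2[of i] that by (cases "i = 1") auto
    then show "(\<forall>i\<in>{1..N+1}. c i = 0) \<and> (\<forall>j\<in>{1..N}. d j = 0)" using d0 by blast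
  qed (use D e f v in auto)
  have "\<omega>1 (e l) v = d l" if "l \<in> {1..N}" for l
    using co[OF that, of c d] cd by simp
  then have "(\<Sum>j=1..N. \<omega>1 (e j) v *\<^sub>R f j) = (\<Sum>j=1..N. d j *\<^sub>R f j)"
    by (intro sum.cong) auto
  then show ?thesis using cd that[of c] by simp
qed

text \<open>The functional \<open>\<omega>1 (e (N + 1))\<close> vanishes on all \<open>e j\<close> and hence is a combination of the \<open>\<omega>1 (e j)\<close> with
  \<open>j \<le> N\<close>. Replacing \<open>e i\<close> by \<open>\<Sum>j\<le>i. d (i - j) e j\<close> keeps the relations, and \<open>d\<close> can be chosen to cancel
  that combination.\<close>

lemma kernel_chain_terminate:
  assumes alt: "alternating \<omega>1" "alternating \<omega>2" and D: "subspace D" "dim D = 2 * N + 1" and N: "N \<ge> 1"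
    and ch: "kernel_chain (N + 1) D \<omega>1 \<omega>2 e" and ind: "forms_indep N D \<omega>1 e"
  obtains e' where "kernel_chain (N + 1) D \<omega>1 \<omega>2 e'" "forms_indep N D \<omega>1 e'"
    "\<And>v. v \<in> D \<Longrightarrow> \<omega>1 (e' (N + 1)) v = 0"
proof -
  note iso1 = kernel_chain_isotropic1[OF alt ch]
  have mem: "e i \<in> D" if "i \<in> {1..N+1}" for i using ch that by (auto simp: kernel_chain_def)
  have start: "\<omega>2 (e 1) v = 0" if "v \<in> D" for v using ch that by (auto simp: kernel_chain_def)
  have rel: "\<omega>2 (e (i + 1)) v = \<omega>1 (e i) v" if "i \<in> {1..N}" "v \<in> D" for i v
    using ch that by (auto simp: kernel_chain_def)
  obtain f where f: "\<And>j. j \<in> {1..N} \<Longrightarrow> f j \<in> D"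
    "\<And>i j. i \<in> {1..N} \<Longrightarrow> j \<in> {1..N} \<Longrightarrow> \<omega>1 (e i) (f j) = (if i = j then 1 else 0)"
    using forms_indep_dual[OF alt(1) D(1) ind] by blast
  have p2: "\<omega>2 (e i) (f j) = (if i = j + 1 then 1 else 0)" if "i \<in> {1..N+1}" "j \<in> {1..N}" for i j
  proof (cases "i = 1")
    case True
    then show ?thesis using start f(1) that by auto
  next
    case False
    then have i: "i - 1 \<in> {1..N}" "i - 1 + 1 = i" using that by auto
    then have "\<omega>2 (e i) (f j) = \<omega>1 (e (i - 1)) (f j)"
      using rel[OF i(1) f(1)[OF that(2)]] by simp
    then show ?thesis using f(2)[OF i(1) that(2)] False i(2) by auto
  qed
  define \<eta> where "\<eta> j = \<omega>1 (e (N + 1)) (f j)" for j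
  have last: "\<omega>1 (e (N + 1)) v = (\<Sum>j=1..N. \<eta> j * \<omega>1 (e j) v)" if v: "v \<in> D" for v
  proof -
    obtain c where c: "v = (\<Sum>i=1..N+1. c i *\<^sub>R e i) + (\<Sum>j=1..N. \<omega>1 (e j) v *\<^sub>R f j)"
    proof (rule chain_pairing_expand[OF alt D N mem f(1) _ f(2) p2 v])
      show "\<omega>1 (e i) (e j) = 0" if "i \<in> {1..N}" "j \<in> {1..N+1}" for i j
        using iso1[of i j] that by simp
    qed
    have "\<omega>1 (e (N + 1)) (\<Sum>i=1..N+1. c i *\<^sub>R e i) = 0"
      by (simp only: alternating_sum(2)[OF alt(1)]) (intro sum.neutral ballI, use iso1 in auto)
    then have "\<omega>1 (e (N + 1)) v = \<omega>1 (e (N + 1)) (\<Sum>j=1..N. \<omega>1 (e j) v *\<^sub>R f j)"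
      by (subst c) (simp only: alternating_add(2)[OF alt(1)] add_0)
    also have "\<dots> = (\<Sum>j=1..N. \<eta> j * \<omega>1 (e j) v)"
      by (simp add: alternating_sum(2)[OF alt(1)] \<eta>_def mult.commute)
    finally show ?thesis .
  qed
  define d where "d m = (if m = 0 then 1 else - \<eta> (N + 1 - m))" for m
  define e' where "e' i = (\<Sum>j=1..i. d (i - j) *\<^sub>R e j)" for i
  have o1: "\<omega>1 (e' i) v = (\<Sum>j=1..i. d (i - j) * \<omega>1 (e j) v)" for i v
    by (simp add: e'_def alternating_sum(1)[OF alt(1)])
  have mem': "e' i \<in> D" if "i \<in> {1..N+1}" for i
    unfolding e'_def by (intro subspace_sum subspace_mul D mem) (use that in auto)
  have "kernel_chain (N + 1) D \<omega>1 \<omega>2 e'"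
    unfolding kernel_chain_def
  proof (intro conjI ballI)
    show "\<omega>2 (e' 1) v = 0" if "v \<in> D" for v
      using start[OF that] by (simp add: e'_def alternating_add[OF alt(2)])
    fix i v assume i: "i \<in> {1..<N+1}" and v: "v \<in> D"
    have "\<omega>2 (e' (i + 1)) v = (\<Sum>j=1..i+1. d (i + 1 - j) * \<omega>2 (e j) v)"
      by (simp only: e'_def alternating_sum(1)[OF alt(2)])
    also have "\<dots> = (\<Sum>j=1+1..i+1. d (i + 1 - j) * \<omega>2 (e j) v)"
      by (rule sum.mono_neutral_right) (use start v in \<open>auto simp: not_less_eq_eq le_Suc_eq\<close>)
    also have "\<dots> = (\<Sum>j=1..i. d (i - j) * \<omega>2 (e (j + 1)) v)"
      by (simp only: sum.shift_bounds_cl_nat_ivl add_diff_cancel_right)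
    also have "\<dots> = (\<Sum>j=1..i. d (i - j) * \<omega>1 (e j) v)"
      by (intro sum.cong) (use rel i v in auto)
    finally show "\<omega>2 (e' (i + 1)) v = \<omega>1 (e' i) v" by (simp add: o1)
  qed (use mem' in auto)
  moreover have "forms_indep N D \<omega>1 e'"
    unfolding forms_indep_def
  proof (intro allI impI)
    fix c assume c: "\<forall>v\<in>D. (\<Sum>i=1..N. c i * \<omega>1 (e' i) v) = 0"
    show "\<forall>i\<in>{1..N}. c i = 0"
    proof (rule ccontr)
      assume "\<not> ?thesis"
      then have ne: "{i\<in>{1..N}. c i \<noteq> 0} \<noteq> {}" by auto
      define m where "m = Max {i\<in>{1..N}. c i \<noteq> 0}"
      have m: "m \<in> {1..N}" "c m \<noteq> 0"
        using Max_in[OF _ ne] unfolding m_def by auto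
      have top: "c i = 0" if "i \<in> {1..N}" "i > m" for i
      proof (rule ccontr)
        assume "c i \<noteq> 0"
        then have "i \<le> m" unfolding m_def using that(1) by (intro Max_ge) auto
        then show False using that(2) by simp
      qed
      have "\<omega>1 (e' i) (f m) = (if i = m then 1 else 0)" if "i \<in> {1..m}" for i
      proof -
        have "\<omega>1 (e' i) (f m) = (\<Sum>j=1..i. if j = m then d (i - j) else 0)"
          unfolding o1 by (intro sum.cong) (use f(2)[OF _ m(1)] that m in auto)
        then show ?thesis using that by (auto simp: d_def)
      qed
      then have "(\<Sum>i=1..N. c i * \<omega>1 (e' i) (f m)) = (\<Sum>i=1..N. if i = m then c m else 0)"
        by (intro sum.cong) (use top in \<open>force simp: not_le\<close>)+
      also have "\<dots> = c m" using m by simp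
      finally show False using c f(1) m by auto
    qed
  qed
  moreover have "\<omega>1 (e' (N + 1)) v = 0" if v: "v \<in> D" for v
  proof -
    have "\<omega>1 (e' (N + 1)) v = (\<Sum>j=1..N. d (N + 1 - j) * \<omega>1 (e j) v) + \<omega>1 (e (N + 1)) v"
      by (simp add: o1 d_def)
    also have "(\<Sum>j=1..N. d (N + 1 - j) * \<omega>1 (e j) v) = (\<Sum>j=1..N. - (\<eta> j * \<omega>1 (e j) v))"
      by (intro sum.cong) (auto simp: d_def)
    finally show ?thesis using last[OF v] by (simp add: sum_negf)
  qed
  ultimately show ?thesis by (rule that)
qed

text \<open>A solution of \<open>s p j = s j p + g p j\<close> for \<open>p < j\<close> and \<open>s (j + 1) k = s (k + 1) j + h j k\<close> for \<open>j < k\<close>. These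
  equations couple only entries on one antidiagonal; the recursion runs along it towards the diagonal,
  where the value is free.\<close>

function shear_coeff :: "(nat \<Rightarrow> nat \<Rightarrow> real) \<Rightarrow> (nat \<Rightarrow> nat \<Rightarrow> real) \<Rightarrow> nat \<Rightarrow> nat \<Rightarrow> real" where
  "shear_coeff g h p j =
     (if p < j then g p j + shear_coeff g h j p
      else if p \<le> j + 1 then 0
      else shear_coeff g h (j + 1) (p - 1) - h j (p - 1))"
  by pat_completeness auto
termination
  by (relation "Wellfounded.measure (\<lambda>(g, h, p, j). if p < j then 2 * (j - p) + 1 else 2 * (p - j))") auto

declare shear_coeff.simps [simp del]

text \<open>The family \<open>f\<close> is dual to the functionals \<open>\<omega>1 (e j)\<close> with \<open>j \<le> N\<close>, and the chain relations determine the
  remaining pairings with \<open>e\<close>. Adding combinations of the \<open>e i\<close> to the \<open>f j\<close> does not affect these pairings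
  and makes the \<open>f j\<close> isotropic.\<close>

lemma nf_table_of_chain:
  assumes alt: "alternating \<omega>1" "alternating \<omega>2" and D: "subspace D" "dim D = 2 * N + 1" and N: "N \<ge> 1"
    and ch: "kernel_chain (N + 1) D \<omega>1 \<omega>2 e" and ind: "forms_indep N D \<omega>1 e"
  shows "nf_pair N D \<omega>1 \<omega>2"
proof -
  obtain e where ch: "kernel_chain (N + 1) D \<omega>1 \<omega>2 e" and ind: "forms_indep N D \<omega>1 e"
    and last: "\<And>v. v \<in> D \<Longrightarrow> \<omega>1 (e (N + 1)) v = 0"
    using kernel_chain_terminate[OF alt D N ch ind] by metis
  note iso1 = kernel_chain_isotropic1[OF alt ch] and iso2 = kernel_chain_isotropic2[OF alt ch]
  have mem: "e i \<in> D" if "i \<in> {1..N+1}" for i using ch that by (auto simp: kernel_chain_def)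
  have start: "\<omega>2 (e 1) v = 0" if "v \<in> D" for v using ch that by (auto simp: kernel_chain_def)
  have rel: "\<omega>2 (e (i + 1)) v = \<omega>1 (e i) v" if "i \<in> {1..N}" "v \<in> D" for i v
    using ch that by (auto simp: kernel_chain_def)
  obtain f where f: "\<And>j. j \<in> {1..N} \<Longrightarrow> f j \<in> D"
    "\<And>i j. i \<in> {1..N} \<Longrightarrow> j \<in> {1..N} \<Longrightarrow> \<omega>1 (e i) (f j) = (if i = j then 1 else 0)"
    using forms_indep_dual[OF alt(1) D(1) ind] by blast
  have p1: "\<omega>1 (e i) (f j) = (if i = j then 1 else 0)" if "i \<in> {1..N+1}" "j \<in> {1..N}" for i j
    using that f(2)[of i j] last[OF f(1)[of j]] by (cases "i = N + 1") auto
  have p2: "\<omega>2 (e i) (f j) = (if i = j + 1 then 1 else 0)" if "i \<in> {1..N+1}" "j \<in> {1..N}" for i j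
  proof (cases "i = 1")
    case True
    then show ?thesis using start f(1) that by auto
  next
    case False
    then have i: "i - 1 \<in> {1..N}" "i - 1 + 1 = i" using that by auto
    then have "\<omega>2 (e i) (f j) = \<omega>1 (e (i - 1)) (f j)"
      using rel[OF i(1) f(1)[OF that(2)]] by simp
    then show ?thesis using f(2)[OF i(1) that(2)] False i(2) by auto
  qed
  define s where "s = shear_coeff (\<lambda>j k. \<omega>1 (f j) (f k)) (\<lambda>j k. \<omega>2 (f j) (f k))"
  define E where "E j = (\<Sum>i=1..N+1. s i j *\<^sub>R e i)" for j
  define f' where "f' j = f j + E j" for j
  have EE: "\<omega>1 (E j) (E k) = 0" "\<omega>2 (E j) (E k) = 0" for j k
    unfolding E_def
    by (simp_all only: alternating_sum(1)[OF alt(1)] alternating_sum(1)[OF alt(2)]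
        alternating_sum(2)[OF alt(1)] alternating_sum(2)[OF alt(2)])
      (auto intro!: sum.neutral simp: iso1 iso2 simp del: sum.cl_ivl_Suc)
  have eE: "\<omega>1 (e i) (E k) = 0" "\<omega>2 (e i) (E k) = 0" if "i \<in> {1..N+1}" for i k
    unfolding E_def using that
    by (simp_all only: alternating_sum(2)[OF alt(1)] alternating_sum(2)[OF alt(2)])
      (auto intro!: sum.neutral simp: iso1 iso2 simp del: sum.cl_ivl_Suc)
  have Ef1: "\<omega>1 (E j) (f k) = s k j" if "k \<in> {1..N}" for j k
  proof -
    have "\<omega>1 (E j) (f k) = (\<Sum>i=1..N+1. if i = k then s i j else 0)"
      unfolding E_def by (simp only: alternating_sum(1)[OF alt(1)]) (intro sum.cong, use p1 that in auto)
    then show ?thesis using that by (simp only: sum.delta finite_atLeastAtMost) simp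
  qed
  have Ef2: "\<omega>2 (E j) (f k) = s (k + 1) j" if "k \<in> {1..N}" for j k
  proof -
    have "\<omega>2 (E j) (f k) = (\<Sum>i=1..N+1. if i = k + 1 then s i j else 0)"
      unfolding E_def by (simp only: alternating_sum(1)[OF alt(2)]) (intro sum.cong, use p2 that in auto)
    then show ?thesis using that by (simp only: sum.delta finite_atLeastAtMost) simp
  qed
  have ff1: "\<omega>1 (f' j) (f' k) = \<omega>1 (f j) (f k) + s k j - s j k" if "j \<in> {1..N}" "k \<in> {1..N}" for j k
    using that alternating_commute[OF alt(1), of "f j" "E k"]
    by (simp add: f'_def alternating_add[OF alt(1)] EE Ef1)
  have ff2: "\<omega>2 (f' j) (f' k) = \<omega>2 (f j) (f k) + s (k + 1) j - s (j + 1) k" if "j \<in> {1..N}" "k \<in> {1..N}" for j k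
    using that alternating_commute[OF alt(2), of "f j" "E k"] Ef2[of k j] Ef2[of j k]
    by (simp add: f'_def alternating_add[OF alt(2)] EE)
  have lt: "\<omega>1 (f' j) (f' k) = 0 \<and> \<omega>2 (f' j) (f' k) = 0" if "j \<in> {1..N}" "k \<in> {1..N}" "j < k" for j k
  proof -
    have "s j k = \<omega>1 (f j) (f k) + s k j"
      unfolding s_def using that(3) by (subst shear_coeff.simps) simp
    moreover have "s (k + 1) j = s (j + 1) k - \<omega>2 (f j) (f k)"
      unfolding s_def using that(3) by (subst shear_coeff.simps) simp
    ultimately show ?thesis using ff1 ff2 that by simp
  qed
  have ff: "\<omega>1 (f' j) (f' k) = 0 \<and> \<omega>2 (f' j) (f' k) = 0" if "j \<in> {1..N}" "k \<in> {1..N}" for j k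
  proof (rule linorder_cases[of j k])
    assume "k < j"
    then show ?thesis
      using lt[of k j] that alternating_commute[OF alt(1), of "f' j" "f' k"]
        alternating_commute[OF alt(2), of "f' j" "f' k"] by simp
  qed (use lt that alt in auto)
  have "E j \<in> D" for j
    unfolding E_def by (intro subspace_sum subspace_mul D mem)
  then have "f' j \<in> D" if "j \<in> {1..N}" for j
    unfolding f'_def using f(1)[OF that] D by (simp add: subspace_add)
  moreover have "\<omega>1 (e i) (f' j) = \<omega>1 (e i) (f j)" "\<omega>2 (e i) (f' j) = \<omega>2 (e i) (f j)" if "i \<in> {1..N+1}" for i j
    using eE[OF that] by (simp_all add: f'_def alternating_add[OF alt(1)] alternating_add[OF alt(2)])
  ultimately have "nf_table N D \<omega>1 \<omega>2 e f'"
    unfolding nf_table_def using mem iso1 iso2 ff p1 p2 by (simp del: atLeastAtMost_iff)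
  then show ?thesis unfolding nf_pair_def by blast
qed

lemma nf_table_expand:
  assumes alt: "alternating \<omega>1" "alternating \<omega>2" and D: "subspace D" "dim D = 2 * N + 1" and N: "N \<ge> 1"
    and t: "nf_table N D \<omega>1 \<omega>2 e f" and v: "v \<in> D"
  obtains c where "v = (\<Sum>i=1..N+1. c i *\<^sub>R e i) + (\<Sum>j=1..N. \<omega>1 (e j) v *\<^sub>R f j)"
  by (rule chain_pairing_expand[OF alt D N _ _ _ _ _ v, of e f])
    (use t in \<open>auto simp: nf_table_def simp del: sum.cl_ivl_Suc\<close>)

lemma nf_table_apply:
  assumes alt: "alternating \<omega>1" "alternating \<omega>2" and D: "subspace D" "dim D = 2 * N + 1" and N: "N \<ge> 1"
    and t: "nf_table N D \<omega>1 \<omega>2 e f" and v: "v \<in> D" and i: "i \<in> {1..N}"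
  shows "\<omega>2 (e 1) v = 0" "\<omega>2 (e (i + 1)) v = \<omega>1 (e i) v" "\<omega>1 (e (N + 1)) v = 0"
proof -
  obtain c where c: "v = (\<Sum>i=1..N+1. c i *\<^sub>R e i) + (\<Sum>j=1..N. \<omega>1 (e j) v *\<^sub>R f j)"
    using nf_table_expand[OF alt D N t v] by blast
  have zero: "\<omega>1 (e l) (\<Sum>i=1..N+1. c i *\<^sub>R e i) = 0" "\<omega>2 (e l) (\<Sum>i=1..N+1. c i *\<^sub>R e i) = 0"
    if "l \<in> {1..N+1}" for l
    using t that by (simp_all only: alternating_sum(2)[OF alt(1)] alternating_sum(2)[OF alt(2)])
      (auto intro!: sum.neutral simp: nf_table_def simp del: sum.cl_ivl_Suc)
  have 1: "\<omega>1 (e l) v = (\<Sum>j=1..N. \<omega>1 (e j) v * \<omega>1 (e l) (f j))" if "l \<in> {1..N+1}" for l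
    by (subst c, subst alternating_add(2)[OF alt(1)], subst zero(1)[OF that])
      (simp only: alternating_sum(2)[OF alt(1)] add_0)
  have 2: "\<omega>2 (e l) v = (\<Sum>j=1..N. \<omega>1 (e j) v * \<omega>2 (e l) (f j))" if "l \<in> {1..N+1}" for l
    by (subst c, subst alternating_add(2)[OF alt(2)], subst zero(2)[OF that])
      (simp only: alternating_sum(2)[OF alt(2)] add_0)
  show "\<omega>2 (e 1) v = 0"
    by (subst 2) (use t in \<open>auto intro!: sum.neutral simp: nf_table_def\<close>)
  show "\<omega>1 (e (N + 1)) v = 0"
    by (subst 1) (use t in \<open>auto intro!: sum.neutral simp: nf_table_def\<close>)
  have "\<omega>2 (e (i + 1)) v = (\<Sum>j=1..N. \<omega>1 (e j) v * \<omega>2 (e (i + 1)) (f j))"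
    by (rule 2) (use i in auto)
  also have "\<dots> = (\<Sum>j=1..N. if j = i then \<omega>1 (e j) v else 0)"
    by (intro sum.cong) (use t i in \<open>auto simp: nf_table_def\<close>)
  finally show "\<omega>2 (e (i + 1)) v = \<omega>1 (e i) v" using i by simp
qed

lemma nf_table_e_coeff:
  assumes alt: "alternating \<omega>1" "alternating \<omega>2" and t: "nf_table N D \<omega>1 \<omega>2 e f"
  shows "i \<in> {1..N} \<Longrightarrow> \<omega>1 (\<Sum>k=1..N+1. c k *\<^sub>R e k) (f i) = c i"
    "i \<in> {1..N} \<Longrightarrow> \<omega>2 (\<Sum>k=1..N+1. c k *\<^sub>R e k) (f i) = c (i + 1)"
proof -
  assume i: "i \<in> {1..N}"
  have "\<omega>1 (\<Sum>k=1..N+1. c k *\<^sub>R e k) (f i) = (\<Sum>k=1..N+1. if k = i then c k else 0)"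
    by (simp only: alternating_sum(1)[OF alt(1)])
      (intro sum.cong, use t i in \<open>auto simp: nf_table_def\<close>)
  also have "\<dots> = c i" using i by (simp only: sum.delta finite_atLeastAtMost) simp
  finally show "\<omega>1 (\<Sum>k=1..N+1. c k *\<^sub>R e k) (f i) = c i" .
next
  assume i: "i \<in> {1..N}"
  have "\<omega>2 (\<Sum>k=1..N+1. c k *\<^sub>R e k) (f i) = (\<Sum>k=1..N+1. if k = i + 1 then c k else 0)"
    by (simp only: alternating_sum(1)[OF alt(2)])
      (intro sum.cong, use t i in \<open>auto simp: nf_table_def\<close>)
  also have "\<dots> = c (i + 1)" using i by (simp only: sum.delta finite_atLeastAtMost) simp
  finally show "\<omega>2 (\<Sum>k=1..N+1. c k *\<^sub>R e k) (f i) = c (i + 1)" .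
qed

lemma nf_table_e_indep:
  assumes alt: "alternating \<omega>1" "alternating \<omega>2" and N: "N \<ge> 1" and t: "nf_table N D \<omega>1 \<omega>2 e f"
  shows "independent_family {1..N+1} e"
  unfolding independent_family_def
proof (intro allI impI ballI)
  fix c i assume c: "(\<Sum>i=1..N+1. c i *\<^sub>R e i) = 0" and i: "i \<in> {1..N+1}"
  show "c i = 0"
  proof (cases "i = N + 1")
    case True
    then show ?thesis using nf_table_e_coeff(2)[OF alt t, of N c] N unfolding c
      by (simp add: alternating_add[OF alt(2)])
  next
    case False
    then show ?thesis using nf_table_e_coeff(1)[OF alt t, of i c] i unfolding c
      by (simp add: alternating_add[OF alt(1)])
  qed
qed

section \<open>Stability of the normal form under small perturbations\<close>

text \<open>The form \<open>\<omega> + x \<and> \<theta>\<close>, with vectors read as covectors through the inner product.\<close>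

definition add_wedge :: "('a::euclidean_space \<Rightarrow> 'a \<Rightarrow> real) \<Rightarrow> 'a \<Rightarrow> 'a \<Rightarrow> 'a \<Rightarrow> 'a \<Rightarrow> real" where
  "add_wedge \<omega> x \<theta> u v = \<omega> u v + (x \<bullet> u) * (\<theta> \<bullet> v) - (x \<bullet> v) * (\<theta> \<bullet> u)"

lemma alternating_add_wedge:
  assumes "alternating \<omega>"
  shows "alternating (add_wedge \<omega> x \<theta>)"
  using alternating_add[OF assms] alternating_self[OF assms]
  unfolding alternating_def bilinear_def add_wedge_def
  by (auto intro!: linearI simp: inner_add_right algebra_simps)

text \<open>Diagonal dominance, applied in a row where \<open>\<bar>c i\<bar>\<close> is largest.\<close>

lemma near_identity_indep:
  assumes fin: "\<And>i j. i \<in> {1..N::nat} \<Longrightarrow> j \<in> {1..N} \<Longrightarrow> \<bar>a i j - (if i = j then 1 else 0)\<bar> < 1 / (2 * real N)"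
    and z: "\<And>j. j \<in> {1..N} \<Longrightarrow> (\<Sum>i=1..N. c i * a i j) = (0::real)" and i: "i \<in> {1..N}"
  shows "c i = 0"
proof -
  have ne: "{1..N} \<noteq> {}" using i by auto
  obtain m where m: "m \<in> {1..N}" "\<And>i. i \<in> {1..N} \<Longrightarrow> \<bar>c i\<bar> \<le> \<bar>c m\<bar>"
    using obtains_MAX[of "{1..N}" "\<lambda>i. \<bar>c i\<bar>"] ne
    by (metis (mono_tags, lifting) Max_ge finite_atLeastAtMost finite_imageI imageI)
  have N0: "real N > 0" using i by auto
  have "c m = (\<Sum>i=1..N. c i * (if i = m then 1 else 0))" using m(1) by (simp add: if_distrib cong: if_cong)
  also have "\<dots> = (\<Sum>i=1..N. - (c i * (a i m - (if i = m then 1 else 0))))"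
    using z[OF m(1)] by (simp add: right_diff_distrib sum_subtractf sum_negf)
  finally have "\<bar>c m\<bar> \<le> (\<Sum>i=1..N. \<bar>c i * (a i m - (if i = m then 1 else 0))\<bar>)"
    by (metis (no_types, lifting) abs_minus_cancel sum_abs sum.cong)
  also have "\<dots> \<le> (\<Sum>i=1..N. \<bar>c m\<bar> * (1 / (2 * real N)))"
    by (intro sum_mono) (unfold abs_mult, intro mult_mono, use m fin in \<open>auto simp: less_imp_le\<close>)
  also have "\<dots> = \<bar>c m\<bar> / 2" using N0 by simp
  finally have "c m = 0" by simp
  then show ?thesis using m(2)[OF i] by simp
qed

text \<open>The chain of the table is continued to nearby pairs. Its equations are singular, as \<open>\<omega>2\<close> has the kernel vector
  \<open>e 1\<close>. With \<open>\<eta>\<close> dual to \<open>e 1\<close>, the form \<open>q v u = \<omega>2 v u + (\<eta> \<bullet> v) * (\<eta> \<bullet> u)\<close> is invertible, also after a small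
  perturbation, and the equations for \<open>q\<close> have solutions \<open>E\<close> depending continuously on it. They solve the
  original ones: \<open>q (E 0) (E 0) = \<eta> \<bullet> E 0\<close> gives \<open>\<eta> \<bullet> E 0 = 1\<close>, so \<open>E 0\<close> is a kernel vector, and isotropy of
  the part of the chain already obtained gives \<open>\<eta> \<bullet> E n = 0\<close> for \<open>n \<ge> 1\<close>.\<close>

lemma nf_pair_open:
  fixes D :: "'a::euclidean_space set"
  assumes alt: "alternating \<omega>1" "alternating \<omega>2" and D: "subspace D" "dim D = 2 * N + 1" and N: "N \<ge> 1"
    and t: "nf_table N D \<omega>1 \<omega>2 e f"
  shows "\<forall>\<^sub>F x in nhds (0 :: 'a \<times> 'a). nf_pair N D (add_wedge \<omega>1 (fst x) \<theta>) (add_wedge \<omega>2 (snd x) \<theta>)"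
proof -
  define F where "F = nhds (0 :: 'a \<times> 'a)"
  have l1: "(fst \<longlongrightarrow> 0) F" and l2: "(snd \<longlongrightarrow> 0) F"
    unfolding F_def using tendsto_fst[OF filterlim_ident[of "nhds (0::'a\<times>'a)"]]
      tendsto_snd[OF filterlim_ident[of "nhds (0::'a\<times>'a)"]] by simp_all
  define w1 where "w1 x = add_wedge \<omega>1 (fst x) \<theta>" for x :: "'a \<times> 'a"
  define w2 where "w2 x = add_wedge \<omega>2 (snd x) \<theta>" for x :: "'a \<times> 'a"
  have alt': "alternating (w1 x)" "alternating (w2 x)" for x
    by (simp_all add: w1_def w2_def alternating_add_wedge alt)
  have emem: "e i \<in> D" if "i \<in> {1..N+1}" for i using nf_table_mem(1)[OF t that] .
  have fmem: "f i \<in> D" if "i \<in> {1..N}" for i using nf_table_mem(2)[OF t that] .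
  note app = nf_table_apply[OF alt D N t]
  obtain \<eta> where \<eta>: "\<And>i. i \<in> {1..N+1} \<Longrightarrow> \<eta> \<bullet> e i = (if i = 1 then 1 else 0)"
  proof -
    obtain g where g: "\<And>i j. i \<in> {1..N+1} \<Longrightarrow> j \<in> {1..N+1} \<Longrightarrow> e i \<bullet> g j = (if i = j then 1 else 0)"
      using dual_family[OF _ nf_table_e_indep[OF alt N t]] by (metis finite_atLeastAtMost)
    show ?thesis by (rule that[of "g 1"]) (use g[of _ 1] in \<open>simp add: inner_commute\<close>)
  qed
  obtain B where B: "finite B" "B \<subseteq> D" "\<And>b. b \<in> B \<Longrightarrow> norm b = 1"
    and rep: "\<And>g v. linear (g :: 'a \<Rightarrow> real) \<Longrightarrow> v \<in> D \<Longrightarrow> (\<Sum>b\<in>B. g b *\<^sub>R b) \<bullet> v = g v"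
    using orthonormal_rep[OF D(1)] by blast
  define R :: "('a \<Rightarrow> real) \<Rightarrow> 'a" where "R g = (\<Sum>b\<in>B. g b *\<^sub>R b)" for g
  have RD: "R g \<in> D" for g
    unfolding R_def by (intro subspace_sum subspace_mul D) (use B in auto)
  have Rv: "R g \<bullet> v = g v" if "linear g" "v \<in> D" for g v
    using rep[OF that] by (simp add: R_def)
  define q where "q x v u = w2 x v u + (\<eta> \<bullet> v) * (\<eta> \<bullet> u)" for x v u
  have qlin: "linear (q x v)" for x v
    unfolding q_def using alternating_add[OF alt'(2)[of x]]
    by (auto intro!: linearI simp: inner_add_right algebra_simps)
  define Q where "Q x v = R (q x v)" for x v
  have Qlin: "linear (Q x)" for x
    unfolding Q_def R_def q_def
    by (rule linearI)
      (simp_all add: alternating_add[OF alt'(2)] inner_add_right algebra_simps sum.distrib scaleR_sum_right)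
  have QD: "Q x v \<in> D" for x v unfolding Q_def by (rule RD)
  have Qv: "Q x v \<bullet> u = q x v u" if "u \<in> D" for x v u
    unfolding Q_def by (rule Rv[OF qlin that])
  have w20: "w2 0 = \<omega>2" and w10: "w1 0 = \<omega>1"
    by (intro ext; simp add: w2_def w1_def add_wedge_def)+
  have inj0: "v = 0" if v: "v \<in> D" and Q0: "Q 0 v = 0" for v
  proof -
    have q0: "\<omega>2 v u + (\<eta> \<bullet> v) * (\<eta> \<bullet> u) = 0" if "u \<in> D" for u
      using Qv[OF that, of 0 v] Q0 by (simp add: q_def w20)
    have "\<omega>2 v (e 1) = 0" using app(1)[OF v] alternating_commute[OF alt(2), of v "e 1"] N by auto
    then have \<eta>v: "\<eta> \<bullet> v = 0" using q0[OF emem[of 1]] \<eta>[of 1] by simp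
    then have k: "\<omega>2 v u = 0" if "u \<in> D" for u using q0[OF that] by simp
    obtain c where c: "v = (\<Sum>i=1..N+1. c i *\<^sub>R e i) + (\<Sum>j=1..N. \<omega>1 (e j) v *\<^sub>R f j)"
      using nf_table_expand[OF alt D N t v] by blast
    have d: "\<omega>1 (e j) v = 0" if "j \<in> {1..N}" for j
      using app(2)[OF v that] k[OF emem[of "j + 1"]] alternating_commute[OF alt(2), of v "e (j + 1)"] that by simp
    have "(\<Sum>j=1..N. \<omega>1 (e j) v *\<^sub>R f j) = 0" by (intro sum.neutral ballI) (use d in simp)
    then have c': "v = (\<Sum>i=1..N+1. c i *\<^sub>R e i)" using c by simp
    have c2: "c (i + 1) = 0" if "i \<in> {1..N}" for i
      using nf_table_e_coeff(2)[OF alt t that, of c] k[OF fmem[OF that]] c' by simp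
    have "c i = 0" if "i \<in> {1..N+1} - {1}" for i
    proof -
      have "i - 1 \<in> {1..N}" "i - 1 + 1 = i" using that by auto
      then show ?thesis using c2[of "i - 1"] by metis
    qed
    then have "(\<Sum>i=1..N+1. c i *\<^sub>R e i) = (\<Sum>i\<in>{1}. c i *\<^sub>R e i)"
      by (intro sum.mono_neutral_right) auto
    then have v1: "v = c 1 *\<^sub>R e 1" using c' by simp
    then show ?thesis using \<eta>v \<eta>[of 1] by simp
  qed
  obtain m where m: "m > 0" "\<And>v. v \<in> D \<Longrightarrow> norm (Q 0 v) \<ge> m * norm v"
    using injective_imp_isometric[OF closed_subspace[OF D(1)] D(1), of "Q 0"]
      inj0 linear_conv_bounded_linear[of "Q 0"] Qlin by blast
  define good where "good x \<longleftrightarrow> (\<forall>v\<in>D. m / 2 * norm v \<le> norm (Q x v))" for x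
  have diffb: "norm (Q x v - Q 0 v) \<le> (2 * real (card B) * norm \<theta> * norm (snd x)) * norm v" for x v
  proof -
    have "Q x v - Q 0 v = (\<Sum>b\<in>B. ((snd x \<bullet> v) * (\<theta> \<bullet> b) - (snd x \<bullet> b) * (\<theta> \<bullet> v)) *\<^sub>R b)"
      by (simp add: Q_def R_def q_def w2_def add_wedge_def algebra_simps flip: sum_subtractf)
    also have "norm \<dots> \<le> (\<Sum>b\<in>B. 2 * norm \<theta> * norm (snd x) * norm v)"
    proof (rule sum_norm_le)
      fix b assume b: "b \<in> B"
      have "\<bar>(snd x \<bullet> v) * (\<theta> \<bullet> b)\<bar> \<le> (norm (snd x) * norm v) * (norm \<theta> * norm b)"
        unfolding abs_mult by (intro mult_mono Cauchy_Schwarz_ineq2) auto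
      then have 1: "\<bar>(snd x \<bullet> v) * (\<theta> \<bullet> b)\<bar> \<le> norm \<theta> * norm (snd x) * norm v"
        using B(3)[OF b] by (simp add: mult_ac)
      have "\<bar>(snd x \<bullet> b) * (\<theta> \<bullet> v)\<bar> \<le> (norm (snd x) * norm b) * (norm \<theta> * norm v)"
        unfolding abs_mult by (intro mult_mono Cauchy_Schwarz_ineq2) auto
      then have 2: "\<bar>(snd x \<bullet> b) * (\<theta> \<bullet> v)\<bar> \<le> norm \<theta> * norm (snd x) * norm v"
        using B(3)[OF b] by (simp add: mult_ac)
      have "\<bar>(snd x \<bullet> v) * (\<theta> \<bullet> b) - (snd x \<bullet> b) * (\<theta> \<bullet> v)\<bar> \<le> 2 * (norm \<theta> * norm (snd x) * norm v)"
        using 1 2 by linarith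
      then show "norm (((snd x \<bullet> v) * (\<theta> \<bullet> b) - (snd x \<bullet> b) * (\<theta> \<bullet> v)) *\<^sub>R b)
          \<le> 2 * norm \<theta> * norm (snd x) * norm v"
        using B(3)[OF b] by (simp only: norm_scaleR mult_1_right mult.assoc)
    qed
    finally show ?thesis by (simp add: mult.assoc mult.left_commute)
  qed
  have good: "\<forall>\<^sub>F x in F. good x"
  proof -
    have "((\<lambda>x. 2 * real (card B) * norm \<theta> * norm (snd x)) \<longlongrightarrow> 2 * real (card B) * norm \<theta> * norm (0::'a)) F"
      by (intro tendsto_intros l2)
    then have "\<forall>\<^sub>F x in F. 2 * real (card B) * norm \<theta> * norm (snd x) < m / 2"
      by (rule order_tendstoD(2)) (use m in simp)
    then show ?thesis
    proof eventually_elim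
      case (elim x)
      show ?case
        unfolding good_def
      proof
        fix v assume v: "v \<in> D"
        have "norm (Q x v - Q 0 v) \<le> m / 2 * norm v"
          by (rule order_trans[OF diffb]) (use elim in \<open>intro mult_right_mono, auto\<close>)
        moreover have "norm (Q 0 v) \<le> norm (Q x v) + norm (Q x v - Q 0 v)"
          by (metis norm_minus_commute norm_triangle_sub)
        ultimately show "m / 2 * norm v \<le> norm (Q x v)" using m(2)[OF v] by simp
      qed
    qed
  qed
  define sol where "sol x y = (SOME v. v \<in> D \<and> Q x v = y)" for x y
  have sol: "sol x y \<in> D \<and> Q x (sol x y) = y" if g: "good x" and y: "y \<in> D" for x y
  proof -
    have "inj_on (Q x) (span D)"
    proof (rule inj_onI)
      fix u v assume uv: "u \<in> span D" "v \<in> span D" "Q x u = Q x v"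
      then have "u - v \<in> D" using D(1) by (metis span_eq_iff subspace_diff)
      moreover have "Q x (u - v) = 0" using uv(3) by (simp add: linear_diff[OF Qlin])
      ultimately have "m / 2 * norm (u - v) \<le> 0" using g unfolding good_def by (metis norm_zero)
      then show "u = v" using m(1) by (simp add: mult_le_0_iff)
    qed
    then have "dim (Q x ` D) = dim D" by (rule dim_image_eq[OF Qlin])
    then have "Q x ` D = D"
      by (intro subspace_dim_equal linear_subspace_image Qlin D) (use QD[of x] in auto)
    then have "\<exists>v. v \<in> D \<and> Q x v = y" using y by (metis imageE)
    then show ?thesis unfolding sol_def by (rule someI_ex)
  qed
  define E where "E x = rec_nat (sol x (R (\<lambda>u. \<eta> \<bullet> u))) (\<lambda>_ v. sol x (R (w1 x v)))" for x
  have E0: "E x 0 = sol x (R (\<lambda>u. \<eta> \<bullet> u))" and ES: "E x (Suc n) = sol x (R (w1 x (E x n)))" for x n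
    by (simp_all add: E_def)
  have \<eta>lin: "linear (\<lambda>u. \<eta> \<bullet> u)" by (simp add: linear_iff inner_add_right)
  have ED: "E x n \<in> D" if "good x" for x n
    using sol[OF that RD] by (cases n) (simp_all only: E0 ES)
  have Eq0: "q x (E x 0) u = \<eta> \<bullet> u" if "good x" "u \<in> D" for x u
    using Qv[OF that(2), of x "E x 0"] sol[OF that(1) RD] Rv[OF \<eta>lin that(2)] by (simp add: E0)
  have EqS: "q x (E x (Suc n)) u = w1 x (E x n) u" if "good x" "u \<in> D" for x u n
    using Qv[OF that(2), of x "E x (Suc n)"] sol[OF that(1) RD]
      Rv[OF alternating_linear(1)[OF alt'(1)[of x]] that(2)] by (simp add: ES)
  have Qlim: "((\<lambda>x. Q x v) \<longlongrightarrow> Q 0 v) F" for v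
    unfolding Q_def R_def q_def w2_def add_wedge_def
    by (rule tendsto_eq_intros l2 refl | simp)+
  have w1lim: "((\<lambda>x. w1 x (V x) u) \<longlongrightarrow> \<omega>1 v u) F" if V: "(V \<longlongrightarrow> v) F" for V v u
  proof -
    have "((\<lambda>x. \<omega>1 (V x) u) \<longlongrightarrow> \<omega>1 v u) F"
      using bounded_linear.tendsto[OF _ V, of "\<lambda>v. \<omega>1 v u"] alternating_linear(2)[OF alt(1), of u]
      by (simp only: linear_conv_bounded_linear)
    then show ?thesis
      unfolding w1_def add_wedge_def
      using tendsto_diff[OF tendsto_add[OF _ tendsto_mult[OF tendsto_inner[OF l1 V] tendsto_const]]
          tendsto_mult[OF tendsto_inner[OF l1 tendsto_const] tendsto_inner[OF tendsto_const V]]]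
      by fastforce
  qed
  have close: "(V \<longlongrightarrow> v) F"
    if V: "\<forall>\<^sub>F x in F. V x \<in> D \<and> Q x (V x) = Y x" and Y: "(Y \<longlongrightarrow> Q 0 v) F" and v: "v \<in> D" for V v Y
  proof -
    have "((\<lambda>x. 2 / m * norm (Y x - Q x v)) \<longlongrightarrow> 2 / m * norm (Q 0 v - Q 0 v)) F"
      by (intro tendsto_intros Y Qlim)
    then have z: "((\<lambda>x. 2 / m * norm (Y x - Q x v)) \<longlongrightarrow> 0) F" by simp
    have "((\<lambda>x. V x - v) \<longlongrightarrow> 0) F"
    proof (rule Lim_null_comparison[OF _ z])
      show "\<forall>\<^sub>F x in F. norm (V x - v) \<le> 2 / m * norm (Y x - Q x v)"
        using V good
      proof eventually_elim
        case (elim x)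
        then have "V x - v \<in> D" using v D(1) by (simp add: subspace_diff)
        then have "m / 2 * norm (V x - v) \<le> norm (Q x (V x - v))" using elim(2) by (simp add: good_def)
        also have "Q x (V x - v) = Y x - Q x v" using elim(1) by (simp add: linear_diff[OF Qlin])
        finally show ?case using m(1) by (simp add: field_simps)
      qed
    qed
    then show ?thesis using LIM_zero_cancel[of V v] by (simp add: LIM_zero_cancel tendsto_diff)
  qed
  have Q0e: "Q 0 (e 1) = R (\<lambda>u. \<eta> \<bullet> u)" "i \<in> {1..N} \<Longrightarrow> Q 0 (e (i + 1)) = R (\<omega>1 (e i))" for i
  proof -
    show "Q 0 (e 1) = R (\<lambda>u. \<eta> \<bullet> u)"
      unfolding Q_def R_def q_def w20
      by (intro sum.cong refl) (use app(1) B N \<eta>[of 1] in auto)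
    assume i: "i \<in> {1..N}"
    show "Q 0 (e (i + 1)) = R (\<omega>1 (e i))"
      unfolding Q_def R_def q_def w20
      by (intro sum.cong refl) (use app(2)[OF _ i] B \<eta>[of "i + 1"] i in auto)
  qed
  have Elim: "((\<lambda>x. E x n) \<longlongrightarrow> e (n + 1)) F" if "n \<le> N" for n
    using that
  proof (induction n)
    case 0
    show ?case
    proof (rule close)
      show "\<forall>\<^sub>F x in F. E x 0 \<in> D \<and> Q x (E x 0) = R (\<lambda>u. \<eta> \<bullet> u)"
        using good by eventually_elim (simp only: E0 sol RD simp_thms)
      show "((\<lambda>_. R (\<lambda>u. \<eta> \<bullet> u)) \<longlongrightarrow> Q 0 (e (0 + 1))) F" using Q0e(1) by simp
    qed (use emem in auto)
  next
    case (Suc n)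
    then have IH: "((\<lambda>x. E x n) \<longlongrightarrow> e (n + 1)) F" by simp
    show ?case
    proof (rule close)
      show "\<forall>\<^sub>F x in F. E x (Suc n) \<in> D \<and> Q x (E x (Suc n)) = R (w1 x (E x n))"
        using good by eventually_elim (simp only: ES sol RD simp_thms)
      have "((\<lambda>x. R (w1 x (E x n))) \<longlongrightarrow> R (\<omega>1 (e (n + 1)))) F"
        unfolding R_def by (intro tendsto_intros w1lim IH)
      then show "((\<lambda>x. R (w1 x (E x n))) \<longlongrightarrow> Q 0 (e (Suc n + 1))) F"
        using Q0e(2)[of "n + 1"] Suc.prems by simp
    qed (use emem Suc.prems in auto)
  qed
  have ev1: "\<forall>\<^sub>F x in F. \<eta> \<bullet> E x 0 > 1 / 2"
  proof -
    have "((\<lambda>x. \<eta> \<bullet> E x 0) \<longlongrightarrow> \<eta> \<bullet> e (0 + 1)) F" by (intro tendsto_intros Elim) simp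
    then show ?thesis by (rule order_tendstoD(1)) (use \<eta>[of 1] in simp)
  qed
  have ev2: "\<forall>\<^sub>F x in F. \<forall>i\<in>{1..N}. \<forall>j\<in>{1..N}. \<bar>w1 x (E x (i - 1)) (f j) - (if i = j then 1 else 0)\<bar> < 1 / (2 * real N)"
  proof (intro eventually_ball_finite ballI finite_atLeastAtMost)
    fix i j assume i: "i \<in> {1..N}" and j: "j \<in> {1..N}"
    have i1: "i - 1 \<le> N" "i - 1 + 1 = i" using i by auto
    have "((\<lambda>x. E x (i - 1)) \<longlongrightarrow> e i) F" using Elim[OF i1(1)] unfolding i1(2) .
    then have "((\<lambda>x. \<bar>w1 x (E x (i - 1)) (f j) - (if i = j then 1 else 0)\<bar>)
        \<longlongrightarrow> \<bar>\<omega>1 (e i) (f j) - (if i = j then 1 else 0)\<bar>) F"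
      by (intro tendsto_intros w1lim)
    moreover have "\<omega>1 (e i) (f j) = (if i = j then 1 else 0)" using t i j by (auto simp: nf_table_def)
    ultimately show "\<forall>\<^sub>F x in F. \<bar>w1 x (E x (i - 1)) (f j) - (if i = j then 1 else 0)\<bar> < 1 / (2 * real N)"
      by (intro order_tendstoD(2)) (use N in auto)
  qed
  have "\<forall>\<^sub>F x in F. nf_pair N D (w1 x) (w2 x)"
    using good ev1 ev2
  proof eventually_elim
    case (elim x)
    note g = \<open>good x\<close>
    have "(\<eta> \<bullet> E x 0) * (\<eta> \<bullet> E x 0) = \<eta> \<bullet> E x 0"
      using Eq0[OF g ED[OF g], of 0] alt' by (simp add: q_def)
    then have \<eta>1: "\<eta> \<bullet> E x 0 = 1" using elim(2) by auto
    have k0: "w2 x (E x 0) u = 0" if "u \<in> D" for u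
      using Eq0[OF g that] \<eta>1 by (simp add: q_def)
    have ch: "kernel_chain n D (w1 x) (w2 x) (\<lambda>i. E x (i - 1))" for n
    proof (induction n)
      case 0
      show ?case using k0 by (simp add: kernel_chain_def)
    next
      case (Suc n)
      have "w2 x (E x n) v = w1 x (E x (n - 1)) v" if n: "n \<ge> 1" and v: "v \<in> D" for v
      proof -
        have "w1 x (E x (n - 1)) (E x (1 - 1)) = 0"
          by (rule kernel_chain_isotropic1[OF alt' Suc.IH, of n 1]) (use n in auto)
        moreover have nn: "Suc (n - 1) = n" using n by simp
        moreover have "w2 x (E x n) (E x 0) = 0"
          using k0[OF ED[OF g, of n]] alternating_commute[OF alt'(2), of x "E x n" "E x 0"] by simp
        ultimately have "\<eta> \<bullet> E x n = 0"
          using EqS[OF g ED[OF g, of 0], of "n - 1"] \<eta>1 by (simp add: q_def)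
        then show ?thesis using EqS[OF g v, of "n - 1"] nn by (simp add: q_def)
      qed
      then show ?case using Suc.IH ED[OF g] k0
        by (auto simp: kernel_chain_def less_Suc_eq)
    qed
    have "forms_indep N D (w1 x) (\<lambda>i. E x (i - 1))"
      unfolding forms_indep_def
    proof (intro allI impI ballI)
      fix c i assume "\<forall>v\<in>D. (\<Sum>i=1..N. c i * w1 x (E x (i - 1)) v) = 0" and i: "i \<in> {1..N}"
      then show "c i = 0"
        using near_identity_indep[of N "\<lambda>i j. w1 x (E x (i - 1)) (f j)" c i] elim(3) fmem by blast
    qed
    then show ?case using nf_table_of_chain[OF alt' D N ch] by blast
  qed
  then show ?thesis unfolding F_def w1_def w2_def .
qed

section \<open>Pencils of linear maps without complex kernels\<close>

text \<open>The eigenvector \<open>z1 + \<i> z2\<close> for the eigenvalue \<open>r + \<i> s\<close> is obtained from a complex polynomial of least degree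
  that annihilates \<open>z0\<close>, by applying the cofactor of one of its linear factors to \<open>z0\<close>.\<close>

lemma real_operator_complex_eigenvector:
  fixes T :: "'a::euclidean_space \<Rightarrow> 'a"
  assumes T: "linear T" and Z: "subspace Z" "\<And>z. z \<in> Z \<Longrightarrow> T z \<in> Z" "z0 \<in> Z" "z0 \<noteq> 0"
  obtains r s z1 z2 where "z1 \<in> Z" "z2 \<in> Z" "z1 \<noteq> 0 \<or> z2 \<noteq> 0"
    "T z1 = r *\<^sub>R z1 - s *\<^sub>R z2" "T z2 = s *\<^sub>R z1 + r *\<^sub>R z2"
proof -
  define x where "x n = (T ^^ n) z0" for n
  have xZ: "x n \<in> Z" for n unfolding x_def by (induction n) (use Z in auto)
  have Tx: "T (x n) = x (Suc n)" for n by (simp add: x_def)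
  define E1 where "E1 p = (\<Sum>i\<le>degree p. Re (coeff p i) *\<^sub>R x i)" for p
  define E2 where "E2 p = (\<Sum>i\<le>degree p. Im (coeff p i) *\<^sub>R x i)" for p
  have E1_ge: "E1 p = (\<Sum>i\<le>n. Re (coeff p i) *\<^sub>R x i)" if "degree p \<le> n" for p n
    unfolding E1_def by (rule sum.mono_neutral_left) (use that in \<open>auto simp: coeff_eq_0\<close>)
  have E2_ge: "E2 p = (\<Sum>i\<le>n. Im (coeff p i) *\<^sub>R x i)" if "degree p \<le> n" for p n
    unfolding E2_def by (rule sum.mono_neutral_left) (use that in \<open>auto simp: coeff_eq_0\<close>)
  have EZ: "E1 p \<in> Z" "E2 p \<in> Z" for p
    unfolding E1_def E2_def by (intro subspace_sum subspace_mul Z xZ)+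
  have "\<exists>p. p \<noteq> 0 \<and> E1 p = 0 \<and> E2 p = 0"
  proof -
    have "\<not> independent_family {..DIM('a)} x"
    proof
      assume i: "independent_family {..DIM('a)} x"
      obtain g where g: "\<And>i j. i \<in> {..DIM('a)} \<Longrightarrow> j \<in> {..DIM('a)} \<Longrightarrow> x i \<bullet> g j = (if i = j then 1 else 0)"
        using dual_family[OF finite_atMost i] by metis
      have g': "x j \<bullet> g i = (if i = j then 1 else 0)" if "i \<in> {..DIM('a)}" "j \<in> {..DIM('a)}" for i j
        using g[OF that(2,1)] by simp
      have l: "linear (\<lambda>v. v \<bullet> g i)" for i by (simp add: linear_iff inner_add_left)
      have "independent (x ` {..DIM('a)})" "inj_on x {..DIM('a)}"
        using dual_system_independent[of "{..DIM('a)}" "\<lambda>i v. v \<bullet> g i" x, OF l g'] by simp_all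
      then show False using independent_bound[of "x ` {..DIM('a)}"] by (simp add: card_image)
    qed
    then obtain c j where c: "(\<Sum>i\<in>{..DIM('a)}. c i *\<^sub>R x i) = 0" "j \<in> {..DIM('a)}" "c j \<noteq> 0"
      unfolding independent_family_def by blast
    define p where "p = (\<Sum>i\<le>DIM('a). monom (complex_of_real (c i)) i)"
    have cp: "coeff p k = (if k \<le> DIM('a) then complex_of_real (c k) else 0)" for k
      by (simp add: p_def coeff_sum coeff_monom)
    have "degree p \<le> DIM('a)" by (rule degree_le) (simp add: cp)
    then have "E1 p = (\<Sum>i\<le>DIM('a). c i *\<^sub>R x i)" "E2 p = 0"
      by (simp_all add: E1_ge[of p "DIM('a)"] E2_ge[of p "DIM('a)"] cp)
    moreover have "p \<noteq> 0" using cp[of j] c by auto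
    ultimately show ?thesis using c by auto
  qed
  then obtain p where p: "p \<noteq> 0" "E1 p = 0" "E2 p = 0"
    and min: "\<And>q. q \<noteq> 0 \<Longrightarrow> E1 q = 0 \<Longrightarrow> E2 q = 0 \<Longrightarrow> degree p \<le> degree q"
    using ex_has_least_nat[of "\<lambda>p. p \<noteq> 0 \<and> E1 p = 0 \<and> E2 p = 0" _ degree] by blast
  have "degree p \<noteq> 0"
  proof
    assume d: "degree p = 0"
    then have "Re (coeff p 0) *\<^sub>R z0 = 0" "Im (coeff p 0) *\<^sub>R z0 = 0"
      using p(2,3) by (simp_all add: E1_def E2_def x_def)
    then have "coeff p 0 = 0" using Z(4) by (simp add: complex_eq_iff)
    then show False using d p(1) by (metis leading_coeff_0_iff)
  qed
  then have "\<not> constant (poly p)" by (simp add: constant_degree)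
  then obtain \<mu> where "poly p \<mu> = 0" using fundamental_theorem_of_algebra by blast
  then obtain q where q: "p = [:- \<mu>, 1:] * q" by (metis dvdE poly_eq_0_iff_dvd)
  have q0: "q \<noteq> 0" using p(1) q by auto
  have dq: "degree p = Suc (degree q)" unfolding q using q0 by (subst degree_mult_eq) auto
  have ne: "E1 q \<noteq> 0 \<or> E2 q \<noteq> 0" using min[OF q0] dq by force
  define n where "n = degree q"
  have cf: "coeff p 0 = - \<mu> * coeff q 0" "coeff p (Suc i) = coeff q i - \<mu> * coeff q (Suc i)" for i
    unfolding q by (simp_all add: coeff_pCons)
  have top: "coeff q (Suc n) = 0" by (simp add: n_def coeff_eq_0)
  have TE: "T (E1 q) = (\<Sum>i\<le>n. Re (coeff q i) *\<^sub>R x (Suc i))" "T (E2 q) = (\<Sum>i\<le>n. Im (coeff q i) *\<^sub>R x (Suc i))"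
    unfolding E1_def E2_def n_def by (simp_all add: linear_sum[OF T] linear_cmul[OF T] Tx)
  have E1q: "E1 q = Re (coeff q 0) *\<^sub>R x 0 + (\<Sum>i\<le>n. Re (coeff q (Suc i)) *\<^sub>R x (Suc i))"
    using E1_ge[of q "Suc n"] by (simp add: n_def sum.atMost_Suc_shift del: sum.atMost_Suc)
  have E2q: "E2 q = Im (coeff q 0) *\<^sub>R x 0 + (\<Sum>i\<le>n. Im (coeff q (Suc i)) *\<^sub>R x (Suc i))"
    using E2_ge[of q "Suc n"] by (simp add: n_def sum.atMost_Suc_shift del: sum.atMost_Suc)
  have E1p: "E1 p = Re (coeff p 0) *\<^sub>R x 0 + (\<Sum>i\<le>n. Re (coeff p (Suc i)) *\<^sub>R x (Suc i))"
    using E1_ge[of p "Suc n"] dq by (simp add: n_def sum.atMost_Suc_shift del: sum.atMost_Suc)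
  have E2p: "E2 p = Im (coeff p 0) *\<^sub>R x 0 + (\<Sum>i\<le>n. Im (coeff p (Suc i)) *\<^sub>R x (Suc i))"
    using E2_ge[of p "Suc n"] dq by (simp add: n_def sum.atMost_Suc_shift del: sum.atMost_Suc)
  have "E1 p = T (E1 q) - Re \<mu> *\<^sub>R E1 q + Im \<mu> *\<^sub>R E2 q"
    unfolding E1p TE(1) unfolding E1q E2q
    by (simp add: cf algebra_simps scaleR_sum_right sum.distrib sum_subtractf)
  moreover have "E2 p = T (E2 q) - Im \<mu> *\<^sub>R E1 q - Re \<mu> *\<^sub>R E2 q"
    unfolding E2p TE(2) unfolding E1q E2q
    by (simp add: cf algebra_simps scaleR_sum_right sum.distrib sum_subtractf)
  ultimately show ?thesis
    using that[of "E1 q" "E2 q" "Re \<mu>" "Im \<mu>"] EZ ne p by (simp add: algebra_simps)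
qed

lemma chain_family_indep:
  fixes u :: "nat \<Rightarrow> 'a::euclidean_space"
  assumes "\<And>j. j < n \<Longrightarrow> u (Suc j) \<notin> span (u ` {1..j})"
  shows "independent_family {1..n} u"
  unfolding independent_family_def
proof (intro allI impI)
  fix c assume c: "(\<Sum>i=1..n. c i *\<^sub>R u i) = 0"
  show "\<forall>i\<in>{1..n}. c i = 0"
  proof (rule ccontr)
    assume "\<not> ?thesis"
    then have ne: "{i\<in>{1..n}. c i \<noteq> 0} \<noteq> {}" by auto
    define m where "m = Max {i\<in>{1..n}. c i \<noteq> 0}"
    have m: "m \<in> {1..n}" "c m \<noteq> 0"
      using Max_in[OF _ ne] unfolding m_def by auto
    have top: "c i = 0" if "i \<in> {1..n}" "i > m" for i
    proof (rule ccontr)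
      assume "c i \<noteq> 0"
      then have "i \<le> m" unfolding m_def using that(1) by (intro Max_ge) auto
      then show False using that(2) by simp
    qed
    obtain j where j: "m = Suc j" "j < n" using m(1) by (cases m) auto
    have "(\<Sum>i=1..n. c i *\<^sub>R u i) = (\<Sum>i=1..m. c i *\<^sub>R u i)"
      by (rule sum.mono_neutral_right) (use m top in auto)
    then have "c m *\<^sub>R u m = - (\<Sum>i=1..j. c i *\<^sub>R u i)"
      using c j(1) by (simp add: eq_neg_iff_add_eq_0 add.commute)
    also have "\<dots> \<in> span (u ` {1..j})"
      by (intro span_neg span_sum span_mul span_base) auto
    finally have "(1 / c m) *\<^sub>R (c m *\<^sub>R u m) \<in> span (u ` {1..j})" by (rule span_mul)
    then show False using m(2) assms[OF j(2)] j(1) by simp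
  qed
qed

text \<open>The assumptions say that all complex members \<open>M1 - (r + \<i> s) M2\<close> and \<open>M2\<close> are injective as maps from \<open>B\<close> to
  the dual of \<open>A\<close>. Injectivity of \<open>M2\<close> makes its transpose surjective, so the chain can be continued forever.
  If some \<open>u (j + 1)\<close> with \<open>j \<le> N\<close> depended on its predecessors, then the space \<open>Z\<close> of all \<open>g\<close> in \<open>B\<close> with
  \<open>M2 (u k) g = 0\<close> for all \<open>k\<close> would be nonzero by a dimension count, and \<open>M1\<close> would map it into the image of \<open>Z\<close> under
  \<open>M2\<close>. A complex eigenvector of the resulting operator on \<open>Z\<close> contradicts injectivity.\<close>

lemma injective_pencil_chain:
  fixes M1 M2 :: "'a::euclidean_space \<Rightarrow> 'a \<Rightarrow> real"
  assumes bil: "bilinear M1" "bilinear M2"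
    and A: "subspace A" "dim A = N + 1" and B: "subspace B" "dim B = N"
    and inj2: "\<And>g. g \<in> B \<Longrightarrow> (\<And>a. a \<in> A \<Longrightarrow> M2 a g = 0) \<Longrightarrow> g = 0"
    and inj1: "\<And>r s z1 z2. z1 \<in> B \<Longrightarrow> z2 \<in> B \<Longrightarrow>
      (\<And>a. a \<in> A \<Longrightarrow> M1 a z1 = r * M2 a z1 - s * M2 a z2 \<and> M1 a z2 = s * M2 a z1 + r * M2 a z2) \<Longrightarrow>
      z1 = 0 \<and> z2 = 0"
  shows "\<exists>u. (\<forall>k\<in>{1..N+1}. u k \<in> A) \<and> (\<forall>g\<in>B. M2 (u 1) g = 0) \<and>
    (\<forall>k\<in>{1..N}. \<forall>g\<in>B. M2 (u (k + 1)) g = M1 (u k) g) \<and>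
    (\<forall>c. (\<forall>g\<in>B. (\<Sum>k=1..N. c k * M1 (u k) g) = 0) \<longrightarrow> (\<forall>k\<in>{1..N}. c k = 0))"
proof -
  have linr: "linear (M1 a)" "linear (M2 a)" and linl: "linear (\<lambda>a. M1 a g)" "linear (\<lambda>a. M2 a g)" for a g
    using bil by (auto simp: bilinear_def)
  obtain OA where OA: "finite OA" "OA \<subseteq> A"
    and repA: "\<And>g v. linear (g :: 'a \<Rightarrow> real) \<Longrightarrow> v \<in> A \<Longrightarrow> (\<Sum>b\<in>OA. g b *\<^sub>R b) \<bullet> v = g v"
    using orthonormal_rep[OF A(1)] by metis
  obtain OB where OB: "finite OB" "OB \<subseteq> B"
    and repB: "\<And>g v. linear (g :: 'a \<Rightarrow> real) \<Longrightarrow> v \<in> B \<Longrightarrow> (\<Sum>b\<in>OB. g b *\<^sub>R b) \<bullet> v = g v"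
    using orthonormal_rep[OF B(1)] by metis
  define P1 where "P1 g = (\<Sum>b\<in>OA. M1 b g *\<^sub>R b)" for g
  define P2 where "P2 g = (\<Sum>b\<in>OA. M2 b g *\<^sub>R b)" for g
  define Q1 where "Q1 a = (\<Sum>b\<in>OB. M1 a b *\<^sub>R b)" for a
  define Q2 where "Q2 a = (\<Sum>b\<in>OB. M2 a b *\<^sub>R b)" for a
  have Plin: "linear P1" "linear P2" and Qlin: "linear Q1" "linear Q2"
    unfolding P1_def P2_def Q1_def Q2_def
    by (auto intro!: linearI simp: linear_add[OF linr(1)] linear_add[OF linr(2)] linear_add[OF linl(1)]
        linear_add[OF linl(2)] linear_cmul[OF linr(1)] linear_cmul[OF linr(2)] linear_cmul[OF linl(1)]
        linear_cmul[OF linl(2)] scaleR_add_left sum.distrib scaleR_sum_right)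
  have PA: "P1 g \<in> A" "P2 g \<in> A" for g
    unfolding P1_def P2_def by (intro subspace_sum subspace_mul A; use OA in auto)+
  have QB: "Q1 a \<in> B" "Q2 a \<in> B" for a
    unfolding Q1_def Q2_def by (intro subspace_sum subspace_mul B; use OB in auto)+
  have P: "P1 g \<bullet> a = M1 a g" "P2 g \<bullet> a = M2 a g" if "a \<in> A" for a g
    unfolding P1_def P2_def using repA[OF linl(1) that] repA[OF linl(2) that] by auto
  have Q: "Q1 a \<bullet> g = M1 a g" "Q2 a \<bullet> g = M2 a g" if "g \<in> B" for a g
    unfolding Q1_def Q2_def using repB[OF linr(1) that] repB[OF linr(2) that] by auto
  have P2inj: "inj_on P2 B"
  proof (rule inj_onI)
    fix g h assume gh: "g \<in> B" "h \<in> B" "P2 g = P2 h"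
    have "g - h = 0"
    proof (rule inj2)
      show "g - h \<in> B" using gh B by (simp add: subspace_diff)
      show "M2 a (g - h) = 0" if "a \<in> A" for a
        using P(2)[OF that, of g] P(2)[OF that, of h] gh(3) by (simp add: linear_diff[OF linr(2)])
    qed
    then show "g = h" by simp
  qed
  have spA: "span A = A" and spB: "span B = B" using A B by simp_all
  have surj: "Q2 ` A = B"
  proof (rule ccontr)
    assume "Q2 ` A \<noteq> B"
    moreover have "span (Q2 ` A) = Q2 ` A"
      using linear_subspace_image[OF Qlin(2) A(1)] by (simp only: span_eq_iff)
    moreover have "Q2 ` A \<subseteq> B" using QB(2) by blast
    ultimately have "span (Q2 ` A) \<subset> span B" using spB by (simp only: psubset_eq simp_thms)
    then obtain g where g: "g \<noteq> 0" "g \<in> span B" "\<And>y. y \<in> span (Q2 ` A) \<Longrightarrow> orthogonal g y"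
      by (rule orthogonal_to_subspace_exists_gen) blast
    have "M2 a g = 0" if "a \<in> A" for a
      using g(3)[of "Q2 a"] Q(2)[of g a] g(2) that
      by (simp add: spB span_base orthogonal_def inner_commute)
    then show False using inj2[of g] g spB by simp
  qed
  define K where "K = {a \<in> A. \<forall>y\<in>P2 ` B. orthogonal y a}"
  have K: "a \<in> K \<longleftrightarrow> a \<in> A \<and> Q2 a = 0" for a
  proof (cases "a \<in> A")
    case True
    have "(\<forall>y\<in>P2 ` B. orthogonal y a) \<longleftrightarrow> (\<forall>g\<in>B. Q2 a \<bullet> g = 0)"
      using P(2)[OF True] Q(2) by (auto simp: orthogonal_def)
    also have "\<dots> \<longleftrightarrow> Q2 a = 0" using QB(2)[of a] by auto
    finally show ?thesis using True by (simp add: K_def)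
  qed (simp add: K_def)
  have dimK: "dim K = 1"
  proof -
    have "dim (P2 ` B) = N" using dim_image_eq[OF Plin(2), of B] P2inj spB B(2) by simp
    moreover have "dim {y \<in> A. \<forall>x\<in>P2 ` B. orthogonal x y} + dim (P2 ` B) = dim A"
      using dim_subspace_orthogonal_to_vectors[of "P2 ` B" A] linear_subspace_image[OF Plin(2) B(1)] A(1) PA by auto
    ultimately show ?thesis using A(2) by (simp add: K_def)
  qed
  obtain u1 where u1: "u1 \<in> K" "u1 \<noteq> 0"
    using dimK dim_eq_0[of K] by auto
  have "\<forall>b\<in>B. \<exists>a. a \<in> A \<and> Q2 a = b" using surj by blast
  then obtain sol where sol: "\<And>b. b \<in> B \<Longrightarrow> sol b \<in> A \<and> Q2 (sol b) = b"
    using bchoice[of B "\<lambda>b a. a \<in> A \<and> Q2 a = b"] by blast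
  define u where "u = rec_nat 0 (\<lambda>n v. if n = 0 then u1 else sol (Q1 v))"
  have uS: "u 1 = u1" "n \<ge> 1 \<Longrightarrow> u (Suc n) = sol (Q1 (u n))" for n
    by (simp_all add: u_def)
  have uA: "u k \<in> A" if "k \<ge> 1" for k
    using that
  proof (induction k rule: nat_induct_at_least)
    case base
    then show ?case using u1 K uS(1) by simp
  next
    case (Suc n)
    then show ?case using uS(2) sol[OF QB(1)] by simp
  qed
  have ustart: "M2 (u 1) g = 0" if "g \<in> B" for g
    using Q(2)[OF that, of u1] u1(1) uS(1) K by simp
  have urel: "M2 (u (Suc k)) g = M1 (u k) g" if "k \<ge> 1" "g \<in> B" for k g
    using Q(1)[OF that(2), of "u k"] Q(2)[OF that(2), of "u (Suc k)"] sol[OF QB(1), of "u k"] uS(2)[OF that(1)]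
    by simp
  have indep: "independent_family {1..N+1} u"
  proof (rule chain_family_indep)
    fix j assume j: "j < N + 1"
    show "u (Suc j) \<notin> span (u ` {1..j})"
    proof
      assume mem: "u (Suc j) \<in> span (u ` {1..j})"
      define U where "U = span (u ` {1..j})"
      have j1: "j \<ge> 1"
      proof (rule ccontr)
        assume "\<not> j \<ge> 1"
        then have "j = 0" by simp
        then show False using mem u1(2) uS(1) by simp
      qed
      have "u ` {1..j} \<subseteq> A" using uA by (simp add: image_subset_iff)
      then have UA: "U \<subseteq> A" unfolding U_def using A(1) by (rule span_minimal)
      have dimU: "dim U \<le> j"
        unfolding U_def dim_span using dim_le_card'[of "u ` {1..j}"] card_image_le[of "{1..j}" u] by simp
      have uU: "u k \<in> U" if "k \<in> {1..Suc j}" for k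
      proof (cases "k = Suc j")
        case True
        then show ?thesis using mem by (simp add: U_def)
      next
        case False
        then have "k \<in> {1..j}" using that by simp
        then show ?thesis unfolding U_def by (intro span_base imageI)
      qed
      define Z where "Z = {g \<in> B. \<forall>y\<in>Q2 ` U. orthogonal y g}"
      define W where "W = {a \<in> A. \<forall>y\<in>U. orthogonal y a}"
      have subU: "subspace U" by (simp add: U_def)
      have Z1: "g \<in> Z \<longleftrightarrow> g \<in> B \<and> (\<forall>y\<in>U. M2 y g = 0)" for g
        using Q(2)[of g] by (auto simp: Z_def orthogonal_def)
      have subZ: "subspace Z"
        unfolding Z_def using B(1) by (auto simp: subspace_def orthogonal_def inner_add_right)
      have dZ: "dim Z + dim (Q2 ` U) = N"
        unfolding Z_def using dim_subspace_orthogonal_to_vectors[of "Q2 ` U" B]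
          linear_subspace_image[OF Qlin(2) subU] B QB(2) by (simp add: image_subset_iff)
      have dW: "dim W + dim U = N + 1"
        unfolding W_def using dim_subspace_orthogonal_to_vectors[of U A] subU A UA by auto
      have "dim (Q2 ` U) + 1 \<le> dim U"
      proof -
        define U' where "U' = {y \<in> U. \<forall>x\<in>span {u1}. orthogonal x y}"
        have u1U: "u1 \<in> U" using uU[of 1] uS(1) j1 by simp
        have "span {u1} \<subseteq> U" by (rule span_minimal) (use u1U subU in auto)
        then have "dim U' + dim (span {u1}) = dim U"
          unfolding U'_def using dim_subspace_orthogonal_to_vectors[OF subspace_span subU] by blast
        then have dU': "dim U' + 1 = dim U" using u1(2) by simp
        have "Q2 ` U \<subseteq> Q2 ` U'"
        proof clarify
          fix y assume y: "y \<in> U"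
          define c where "c = (u1 \<bullet> y) / (u1 \<bullet> u1)"
          have "u1 \<bullet> (y - c *\<^sub>R u1) = 0" using u1(2) by (simp add: c_def inner_diff_right)
          then have "y - c *\<^sub>R u1 \<in> U'"
            unfolding U'_def using y u1U subU
            by (auto simp: subspace_diff subspace_mul span_singleton orthogonal_def)
          moreover have "Q2 (y - c *\<^sub>R u1) = Q2 y"
            using u1(1) K by (simp add: linear_diff[OF Qlin(2)] linear_cmul[OF Qlin(2)])
          ultimately show "Q2 y \<in> Q2 ` U'" by (metis imageI)
        qed
        then have "dim (Q2 ` U) \<le> dim (Q2 ` U')" by (rule dim_subset)
        also have "\<dots> \<le> dim U'" by (rule dim_image_le[OF Qlin(2)])
        finally show ?thesis using dU' by simp
      qed
      then have dZW: "dim W \<le> dim Z" and dZ0: "dim Z \<noteq> 0"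
        using dZ dW dimU j j1 by linarith+
      have P2Z: "P2 ` Z = W"
      proof (rule subspace_dim_equal)
        show "subspace (P2 ` Z)" by (rule linear_subspace_image[OF Plin(2) subZ])
        show "subspace W" unfolding W_def using A(1) by (auto simp: subspace_def orthogonal_def inner_add_right)
        show "P2 ` Z \<subseteq> W" using PA(2) P(2) UA Z1 by (auto simp: W_def orthogonal_def inner_commute)
        have "Z \<subseteq> B" using Z1 by blast
        then have injZ: "inj_on P2 Z" using inj_on_subset[OF P2inj] by blast
        have "dim (P2 ` Z) = dim Z"
          by (rule dim_image_eq[OF Plin(2)]) (use injZ subZ in \<open>simp add: span_eq_iff[THEN iffD2]\<close>)
        then show "dim W \<le> dim (P2 ` Z)" using dZW by simp
      qed
      have P1W: "P1 z \<in> W" if z: "z \<in> Z" for z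
      proof -
        have zB: "z \<in> B" using z Z1 by blast
        have "U \<subseteq> {a. M1 a z = 0}"
          unfolding U_def
        proof (rule span_minimal)
          show "subspace {a. M1 a z = 0}" by (rule linear_subspace_kernel[OF linl(1)])
          show "u ` {1..j} \<subseteq> {a. M1 a z = 0}"
          proof clarify
            fix k assume k: "k \<in> {1..j}"
            have "M2 (u (Suc k)) z = 0" using z Z1 uU[of "Suc k"] k by auto
            then show "M1 (u k) z = 0" using urel[of k z] k zB by simp
          qed
        qed
        from subsetD[OF this] have M0: "M1 y z = 0" if "y \<in> U" for y using that by simp
        have "y \<bullet> P1 z = 0" if "y \<in> U" for y
        proof -
          have "y \<in> A" using UA that by (rule subsetD)
          then have "P1 z \<bullet> y = 0" using P(1)[of y z] M0[OF that] by simp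
          then show ?thesis using inner_commute[of y "P1 z"] by simp
        qed
        then show ?thesis using PA(1) by (simp add: W_def orthogonal_def)
      qed
      obtain G where G: "linear G" "\<And>z. z \<in> Z \<Longrightarrow> G (P2 z) = z"
      proof -
        have "Z \<subseteq> B" using Z1 by blast
        then have injZ: "inj_on P2 Z" using inj_on_subset[OF P2inj] by blast
        from linear_exists_left_inverse_on[OF Plin(2) subZ this]
        obtain G where "linear G" "\<forall>v\<in>Z. G (P2 v) = v" by (elim exE conjE)
        then show ?thesis using that[of G] by simp
      qed
      have TP: "G (P1 z) \<in> Z \<and> P2 (G (P1 z)) = P1 z" if "z \<in> Z" for z
      proof -
        have "P1 z \<in> P2 ` Z" using P1W[OF that] P2Z by simp
        then show ?thesis using G(2) by auto
      qed
      obtain z0 where z0: "z0 \<in> Z" "z0 \<noteq> 0"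
        using dZ0 dim_eq_0[of Z] by auto
      obtain r s z1 z2 where z: "z1 \<in> Z" "z2 \<in> Z" "z1 \<noteq> 0 \<or> z2 \<noteq> 0"
        "G (P1 z1) = r *\<^sub>R z1 - s *\<^sub>R z2" "G (P1 z2) = s *\<^sub>R z1 + r *\<^sub>R z2"
        using real_operator_complex_eigenvector[OF linear_compose[OF Plin(1) G(1), unfolded comp_def] subZ
            conjunct1[OF TP] z0] .
      have e1: "P1 z1 = r *\<^sub>R P2 z1 - s *\<^sub>R P2 z2" and e2: "P1 z2 = s *\<^sub>R P2 z1 + r *\<^sub>R P2 z2"
        using TP[OF z(1)] TP[OF z(2)] z(4,5)
        by (simp_all add: linear_diff[OF Plin(2)] linear_add[OF Plin(2)] linear_cmul[OF Plin(2)])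
      have "z1 = 0 \<and> z2 = 0"
      proof (rule inj1)
        fix a assume a: "a \<in> A"
        show "M1 a z1 = r * M2 a z1 - s * M2 a z2 \<and> M1 a z2 = s * M2 a z1 + r * M2 a z2"
          using P(1)[OF a, of z1] P(1)[OF a, of z2] P(2)[OF a, of z1] P(2)[OF a, of z2]
          unfolding e1 e2 by (simp add: inner_diff_left inner_add_left)
      qed (use z Z1 in auto)
      then show False using z(3) by simp
    qed
  qed
  have p4: "\<forall>k\<in>{1..N}. c k = 0" if c: "\<forall>g\<in>B. (\<Sum>k=1..N. c k * M1 (u k) g) = 0" for c
  proof -
    define a where "a = (\<Sum>k=1..N. c k *\<^sub>R u (k + 1))"
    have aA: "a \<in> A" unfolding a_def by (intro subspace_sum subspace_mul A uA) simp
    have "Q2 a \<bullet> g = 0" if "g \<in> B" for g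
    proof -
      have "Q2 a \<bullet> g = (\<Sum>k=1..N. c k * M2 (u (k + 1)) g)"
        unfolding Q(2)[OF that] a_def by (simp add: linear_sum[OF linl(2)] linear_cmul[OF linl(2)])
      also have "\<dots> = (\<Sum>k=1..N. c k * M1 (u k) g)"
        by (intro sum.cong) (use urel that in auto)
      finally show ?thesis using bspec[OF c that] by simp
    qed
    from this[OF QB(2)[of a]] have "Q2 a = 0" by simp
    then have "a \<in> K" using aA K by simp
    moreover have "K = span {u1}"
    proof -
      have "subspace K" unfolding K_def using A(1) by (auto simp: subspace_def orthogonal_def inner_add_right)
      then show ?thesis
        using dimK u1 by (intro sym[OF subspace_dim_equal] span_minimal) auto
    qed
    ultimately obtain r where r: "a = r *\<^sub>R u1" by (auto simp: span_singleton)
    define c' where "c' k = (if k = 1 then - r else c (k - 1))" for k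
    have "(\<Sum>k=1..N+1. c' k *\<^sub>R u k) = c' 1 *\<^sub>R u 1 + (\<Sum>k=1+1..N+1. c' k *\<^sub>R u k)"
      by (subst sum.atLeast_Suc_atMost) auto
    also have "(\<Sum>k=1+1..N+1. c' k *\<^sub>R u k) = (\<Sum>k=1..N. c' (k + 1) *\<^sub>R u (k + 1))"
      by (simp only: sum.shift_bounds_cl_nat_ivl)
    also have "\<dots> = a" unfolding a_def by (intro sum.cong) (auto simp: c'_def)
    also have "c' 1 *\<^sub>R u 1 + a = 0" using r uS(1) by (simp add: c'_def)
    finally have sum0: "(\<Sum>k=1..N+1. c' k *\<^sub>R u k) = 0" .
    have "\<forall>k\<in>{1..N+1}. c' k = 0"
      by (rule mp[OF spec[of _ c', OF indep[unfolded independent_family_def]] sum0])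
    from bspec[OF this] have c'0: "c' (k + 1) = 0" if "k \<in> {1..N}" for k using that by simp
    show "\<forall>k\<in>{1..N}. c k = 0"
    proof
      fix k assume "k \<in> {1..N}"
      from c'0[OF this] this show "c k = 0" by (simp add: c'_def)
    qed
  qed
  have p1: "\<forall>k\<in>{1..N+1}. u k \<in> A" using uA by simp
  have p2: "\<forall>g\<in>B. M2 (u 1) g = 0" using ustart by blast
  have p3: "\<forall>k\<in>{1..N}. \<forall>g\<in>B. M2 (u (k + 1)) g = M1 (u k) g" using urel by simp
  show ?thesis by (intro exI[of _ u] conjI allI impI p1 p2 p3 p4)
qed

section \<open>Hankel sequences satisfying a recurrence\<close>

text \<open>Beyond index \<open>r\<close> the values are determined by the recurrence \<open>(\<Sum>k=1..r. p k * h (k + i)) = 0\<close>.\<close>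

function recurrence_seq :: "(nat \<Rightarrow> real) \<Rightarrow> nat \<Rightarrow> (nat \<Rightarrow> real) \<Rightarrow> nat \<Rightarrow> real" where
  "recurrence_seq p r a n =
     (if n \<le> r then a n else - (\<Sum>k\<in>{1..<r}. p k * recurrence_seq p r a (n - r + k)) / p r)"
  by pat_completeness auto
termination
  by (relation "Wellfounded.measure (\<lambda>(p, r, a, n). n)") auto

declare recurrence_seq.simps [simp del]

text \<open>Let \<open>p r\<close> be the last nonzero coefficient. The values of \<open>h\<close> beyond index \<open>N + r\<close> do not occur in the
  recurrence and give \<open>y j\<close> for \<open>j \<ge> r\<close>; the values at \<open>2, \<dots>, r\<close> are free initial values and give the others.\<close>

lemma hankel_annihilator_separates:
  fixes p y :: "nat \<Rightarrow> real"
  assumes k0: "k0 \<in> {1..N+1}" "p k0 \<noteq> 0"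
    and h: "\<And>h k. (\<And>j. j \<in> {1..N} \<Longrightarrow> (\<Sum>k=1..N+1. p k * h (k + j)) = 0) \<Longrightarrow> k \<in> {1..N+1} \<Longrightarrow>
      (\<Sum>j=1..N. h (k + j) * y j) = 0"
    and j: "j \<in> {1..N}"
  shows "y j = 0"
proof -
  have ne: "{k\<in>{1..N+1}. p k \<noteq> 0} \<noteq> {}" using k0 by auto
  define r where "r = Max {k\<in>{1..N+1}. p k \<noteq> 0}"
  have r: "r \<in> {1..N+1}" "p r \<noteq> 0"
    using Max_in[OF _ ne] unfolding r_def by auto
  have top: "p k = 0" if "k \<in> {1..N+1}" "k > r" for k
  proof (rule ccontr)
    assume "p k \<noteq> 0"
    then have "k \<le> r" unfolding r_def using that(1) by (intro Max_ge) auto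
    then show False using that(2) by simp
  qed
  have high: "y j = 0" if j: "j \<in> {r..N}" for j
  proof -
    define h where "h n = (if n = N + 1 + j then 1 else 0 :: real)" for n
    have "(\<Sum>i=1..N. h (N + 1 + i) * y i) = 0"
    proof (rule h)
      fix i assume i: "i \<in> {1..N}"
      show "(\<Sum>k=1..N+1. p k * h (k + i)) = 0"
      proof (rule sum.neutral, rule ballI)
        fix k assume "k \<in> {1..N+1}"
        then show "p k * h (k + i) = 0" using top[of k] i j by (cases "k > r") (auto simp: h_def)
      qed
    qed simp
    moreover have "(\<Sum>i=1..N. h (N + 1 + i) * y i) = (\<Sum>i=1..N. if i = j then y i else 0)"
      by (intro sum.cong) (auto simp: h_def)
    ultimately show ?thesis using j r by simp
  qed
  show ?thesis
  proof (cases "j \<ge> r")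
    case True
    then show ?thesis using high j by simp
  next
    case False
    define h where "h = recurrence_seq p r (\<lambda>n. if n = 1 + j then 1 else 0)"
    have "(\<Sum>i=1..N. h (1 + i) * y i) = 0"
    proof (rule h)
      fix i assume i: "i \<in> {1..N}"
      have "(\<Sum>k=1..N+1. p k * h (k + i)) = (\<Sum>k=1..r. p k * h (k + i))"
        by (rule sum.mono_neutral_right) (use r top in auto)
      also have "{1..r} = insert r {1..<r}" using r by auto
      also have "(\<Sum>k\<in>insert r {1..<r}. p k * h (k + i)) = p r * h (r + i) + (\<Sum>k=1..<r. p k * h (k + i))"
        by simp
      also have "h (r + i) = - (\<Sum>k\<in>{1..<r}. p k * h (k + i)) / p r"
        unfolding h_def by (subst recurrence_seq.simps) (use i in \<open>auto simp: add.commute\<close>)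
      finally show "(\<Sum>k=1..N+1. p k * h (k + i)) = 0" using r by simp
    qed simp
    moreover have "(\<Sum>i=1..N. h (1 + i) * y i) = (\<Sum>i=1..N. if i = j then y i else 0)"
    proof (intro sum.cong refl)
      fix i assume i: "i \<in> {1..N}"
      show "h (1 + i) * y i = (if i = j then y i else 0)"
      proof (cases "i \<ge> r")
        case True
        then show ?thesis using high[of i] i by auto
      next
        case F: False
        then show ?thesis unfolding h_def by (subst recurrence_seq.simps) auto
      qed
    qed
    ultimately show ?thesis using j by simp
  qed
qed

section \<open>Powers of definite quadratic polynomials\<close>

text \<open>The polynomial \<open>(x - c)\<^sup>2 + d\<^sup>2\<close>.\<close>

definition quad :: "real \<Rightarrow> real \<Rightarrow> real poly" where
  "quad c d = [:c\<^sup>2 + d\<^sup>2, - 2 * c, 1:]"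

text \<open>The functional taking the value \<open>v j\<close> on \<open>x ^ (j - 1)\<close>, in accordance with the indexing of the \<open>e j\<close> and \<open>f j\<close>.\<close>

definition coeff_fun :: "nat \<Rightarrow> (nat \<Rightarrow> real) \<Rightarrow> real poly \<Rightarrow> real" where
  "coeff_fun n v p = (\<Sum>j=1..n. v j * coeff p (j - 1))"

lemma coeff_quad_power_continuous: "continuous_on UNIV (\<lambda>d. coeff (quad c d ^ n) k)"
proof (induction n arbitrary: k)
  case (Suc n)
  have "continuous_on UNIV (\<lambda>d. coeff (quad c d) k)" for k
  proof -
    have "coeff (quad c d) k = (if k = 0 then c\<^sup>2 + d\<^sup>2 else if k = 1 then - 2 * c else if k = 2 then 1 else 0)" for d
      by (auto simp: quad_def coeff_pCons numeral_2_eq_2 split: nat.split)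
    then show ?thesis by (cases "k = 0"; cases "k = 1") (auto intro!: continuous_intros)
  qed
  then show ?case
    unfolding power_Suc coeff_mult by (intro continuous_intros Suc.IH)
qed (simp add: continuous_intros)

lemma continuous_zero_off_0:
  assumes "\<And>d. d \<noteq> 0 \<Longrightarrow> F d = 0" "continuous_on UNIV F"
  shows "F (0::real) = (0::real)"
proof -
  have "(F \<longlongrightarrow> F 0) (at 0)" using assms(2) by (simp add: continuous_on_def)
  moreover have "\<forall>\<^sub>F d in at 0. F d = 0" using assms(1) by (simp add: eventually_at_filter)
  then have "(F \<longlongrightarrow> 0) (at 0)" by (rule tendsto_eventually)
  ultimately show ?thesis using tendsto_unique[of "at (0::real)" F] by simp
qed

lemma quad_0_power: "quad c 0 ^ n = [:- c, 1:] ^ (2 * n)"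
proof -
  have "quad c 0 = [:- c, 1:]\<^sup>2" by (simp add: quad_def power2_eq_square)
  then show ?thesis by (simp add: power_mult)
qed

text \<open>The value of a linear functional on \<open>(x - c) ^ K\<close>, as a polynomial in \<open>c\<close>.\<close>

definition binomial_poly :: "nat \<Rightarrow> (nat \<Rightarrow> real) \<Rightarrow> real poly" where
  "binomial_poly K v = (\<Sum>k\<le>K. monom (v k * real (K choose k) * (- 1) ^ (K - k)) (K - k))"

lemma poly_binomial_poly:
  "poly (binomial_poly K v) c = (\<Sum>k\<le>K. v k * coeff ([:- c, 1:] ^ K) k)"
  unfolding binomial_poly_def poly_sum poly_monom
proof (rule sum.cong)
  fix k assume "k \<in> {..K}"
  then have "coeff ([:- c, 1:] ^ K) k = real (K choose k) * (- c) ^ (K - k)"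
    by (simp add: coeff_linear_poly_power)
  then show "v k * real (K choose k) * (- 1) ^ (K - k) * c ^ (K - k) = v k * coeff ([:- c, 1:] ^ K) k"
    by (simp add: power_minus[of c])
qed simp

lemma binomial_poly_eq_0D:
  assumes "binomial_poly K v = 0" "k \<le> K"
  shows "v k = 0"
proof -
  have "coeff (binomial_poly K v) (K - k) = (\<Sum>i\<le>K. if i = k then v k * real (K choose k) * (- 1) ^ (K - k) else 0)"
    unfolding binomial_poly_def coeff_sum by (intro sum.cong) (use assms in \<open>auto simp: coeff_monom\<close>)
  then have "v k * real (K choose k) * (- 1) ^ (K - k) = 0" using assms by simp
  then show ?thesis using assms(2) by simp
qed

lemma coeff_fun_shift:
  assumes "K < n" "degree p \<le> K"
  shows "coeff_fun n v p = (\<Sum>k\<le>K. v (Suc k) * coeff p k)"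
proof -
  have "coeff_fun n v p = (\<Sum>k<n. v (Suc k) * coeff p k)"
    unfolding coeff_fun_def by (rule sum.reindex_bij_witness[of _ Suc "\<lambda>j. j - 1"]) auto
  also have "\<dots> = (\<Sum>k\<le>K. v (Suc k) * coeff p k)"
    by (rule sum.mono_neutral_right) (use assms in \<open>auto simp: coeff_eq_0\<close>)
  finally show ?thesis .
qed

lemma degree_linear_power: "degree ([:a, 1:] ^ k :: real poly) = k"
  by (simp add: degree_power_eq)

text \<open>Otherwise, letting \<open>d\<close> tend to \<open>0\<close>, the functional vanishes on all \<open>(x - c) ^ (2 * n)\<close>, which span the
  polynomials of degree at most \<open>2 * n\<close>.\<close>

lemma exists_quad_power_odd:
  assumes "k0 \<in> {1..2 * n + 1}" "q k0 \<noteq> 0"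
  obtains c d where "d \<noteq> 0" "coeff_fun (2 * n + 1) q (quad c d ^ n) \<noteq> 0"
proof (rule ccontr)
  assume "\<not> thesis"
  then have z: "coeff_fun (2 * n + 1) q (quad c d ^ n) = 0" if "d \<noteq> 0" for c d
    using that \<open>\<And>d c. d \<noteq> 0 \<Longrightarrow> coeff_fun (2 * n + 1) q (quad c d ^ n) \<noteq> 0 \<Longrightarrow> thesis\<close> by blast
  define R where "R = binomial_poly (2*n) (\<lambda>k. q (Suc k))"
  note R = poly_binomial_poly[of "2*n" "\<lambda>k. q (Suc k)", folded R_def]
  have "poly R c = 0" for c
  proof -
    have "coeff_fun (2 * n + 1) q (quad c 0 ^ n) = 0"
      by (rule continuous_zero_off_0[OF z])
        (auto simp: coeff_fun_def intro!: continuous_intros coeff_quad_power_continuous)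
    moreover have "coeff_fun (2 * n + 1) q (quad c 0 ^ n) = poly R c"
      unfolding R quad_0_power by (rule coeff_fun_shift) (simp_all add: degree_linear_power)
    ultimately show ?thesis by simp
  qed
  then have "R = 0" using poly_all_0_iff_0 by blast
  then have "q (Suc (k0 - 1)) = 0"
    using binomial_poly_eq_0D[of "2*n" "\<lambda>k. q (Suc k)" "k0 - 1"] assms(1) by (auto simp: R_def)
  then show False using assms by simp
qed

text \<open>For fixed \<open>c\<close> and \<open>d\<close>, the condition on \<open>(c1, c2)\<close> excludes a single line, unless \<open>Q0 = Q1 = 0\<close>. So both functionals
  vanish on the power wherever \<open>Q0\<^sup>2 + Q1\<^sup>2\<close> is nonzero. Letting \<open>d\<close> tend to \<open>0\<close> turns this into an identity of
  polynomials in \<open>c\<close>, and there \<open>Q0\<^sup>2 + Q1\<^sup>2\<close> is not the zero polynomial.\<close>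

lemma quad_powers_separate_even:
  assumes n: "n \<ge> 1" and q: "k0 \<in> {1..2 * n}" "q k0 \<noteq> 0"
    and H: "\<And>c d c1 c2. d \<noteq> 0 \<Longrightarrow>
      c1 * coeff_fun (2 * n) q (pCons 0 (quad c d ^ (n - 1))) \<noteq> c2 * coeff_fun (2 * n) q (quad c d ^ (n - 1)) \<Longrightarrow>
      c1 * coeff_fun (2 * n + 1) v1 (quad c d ^ n) + c2 * coeff_fun (2 * n + 1) v2 (quad c d ^ n) = 0"
    and k: "k \<in> {1..2 * n + 1}"
  shows "v1 k = 0 \<and> v2 k = 0"
proof -
  define Q0 where "Q0 c d = coeff_fun (2 * n) q (quad c d ^ (n - 1))" for c d
  define Q1 where "Q1 c d = coeff_fun (2 * n) q (pCons 0 (quad c d ^ (n - 1)))" for c d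
  have prod: "coeff_fun (2 * n + 1) v (quad c d ^ n) * ((Q0 c d)\<^sup>2 + (Q1 c d)\<^sup>2) = 0"
    if d: "d \<noteq> 0" and v: "v = v1 \<or> v = v2" for v c d
  proof (cases "(Q0 c d)\<^sup>2 + (Q1 c d)\<^sup>2 = 0")
    case False
    define V1 where "V1 = coeff_fun (2 * n + 1) v1 (quad c d ^ n)"
    define V2 where "V2 = coeff_fun (2 * n + 1) v2 (quad c d ^ n)"
    \<comment> \<open>Two linearly independent choices of \<open>(c1, c2)\<close> off the excluded line.\<close>
    have "Q1 c d * Q1 c d \<noteq> (- Q0 c d) * Q0 c d"
      "(Q1 c d + Q0 c d) * Q1 c d \<noteq> (Q1 c d - Q0 c d) * Q0 c d"
    proof -
      have ne: "Q0 c d * Q0 c d + Q1 c d * Q1 c d \<noteq> 0"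
        using False by (simp only: power2_eq_square not_False_eq_True)
      then show "Q1 c d * Q1 c d \<noteq> (- Q0 c d) * Q0 c d" by (metis add.commute add.right_inverse mult_minus_left)
      have "(Q1 c d + Q0 c d) * Q1 c d - (Q1 c d - Q0 c d) * Q0 c d = Q0 c d * Q0 c d + Q1 c d * Q1 c d"
        by (simp add: algebra_simps)
      then show "(Q1 c d + Q0 c d) * Q1 c d \<noteq> (Q1 c d - Q0 c d) * Q0 c d" using ne by argo
    qed
    from this[unfolded Q0_def Q1_def, THEN H[OF d]]
    have e1: "Q1 c d * V1 + (- Q0 c d) * V2 = 0"
      and e2: "(Q1 c d + Q0 c d) * V1 + (Q1 c d - Q0 c d) * V2 = 0"
      unfolding V1_def V2_def Q0_def Q1_def .
    have e3: "Q0 c d * V1 + Q1 c d * V2 = 0" using e1 e2 by (simp add: algebra_simps)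
    have "((Q0 c d)\<^sup>2 + (Q1 c d)\<^sup>2) * V1 = Q1 c d * (Q1 c d * V1 + (- Q0 c d) * V2) + Q0 c d * (Q0 c d * V1 + Q1 c d * V2)"
      by (simp add: power2_eq_square algebra_simps)
    moreover have "((Q0 c d)\<^sup>2 + (Q1 c d)\<^sup>2) * V2 = Q1 c d * (Q0 c d * V1 + Q1 c d * V2) - Q0 c d * (Q1 c d * V1 + (- Q0 c d) * V2)"
      by (simp add: power2_eq_square algebra_simps)
    ultimately have "V1 = 0" "V2 = 0" using e1 e3 False by auto
    then show ?thesis using v by (auto simp: V1_def V2_def)
  qed simp
  define R0 where "R0 = binomial_poly (2*(n-1)) (\<lambda>k. q (Suc k))"
  note R0 = poly_binomial_poly[of "2*(n-1)" "\<lambda>k. q (Suc k)", folded R0_def]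
  define R1 where "R1 = binomial_poly (2*(n-1)) (\<lambda>k. q (Suc (Suc k)))"
  note R1 = poly_binomial_poly[of "2*(n-1)" "\<lambda>k. q (Suc (Suc k))", folded R1_def]
  have Q0': "Q0 c 0 = poly R0 c" for c
    unfolding Q0_def R0 quad_0_power
    by (rule coeff_fun_shift) (use n in \<open>auto simp: coeff_eq_0 degree_linear_power\<close>)
  have Q1': "Q1 c 0 = poly R1 c" for c
  proof -
    have "Q1 c 0 = (\<Sum>k\<le>Suc (2*(n-1)). q (Suc k) * coeff (pCons 0 ([:- c, 1:] ^ (2*(n-1)))) k)"
      unfolding Q1_def quad_0_power
      by (rule coeff_fun_shift) (use n in \<open>auto simp: coeff_eq_0 degree_linear_power degree_pCons_eq_if\<close>)
    also have "\<dots> = poly R1 c"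
      unfolding R1 by (subst sum.atMost_Suc_shift) simp
    finally show ?thesis .
  qed
  have R01: "R0\<^sup>2 + R1\<^sup>2 \<noteq> 0"
  proof
    assume z: "R0\<^sup>2 + R1\<^sup>2 = 0"
    have "poly R0 c = 0 \<and> poly R1 c = 0" for c
    proof -
      have "poly (R0\<^sup>2 + R1\<^sup>2) c = 0" using z by simp
      then have "(poly R0 c)\<^sup>2 + (poly R1 c)\<^sup>2 = 0" by simp
      then show ?thesis by (simp add: sum_power2_eq_zero_iff)
    qed
    then have "R0 = 0" "R1 = 0" using poly_all_0_iff_0 by blast+
    then have q0: "q (Suc k) = 0" "q (Suc (Suc k)) = 0" if "k \<le> 2*(n-1)" for k
      using binomial_poly_eq_0D[of _ "\<lambda>k. q (Suc k)"] binomial_poly_eq_0D[of _ "\<lambda>k. q (Suc (Suc k))"] that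
      by (auto simp: R0_def R1_def)
    have "q k0 = 0"
    proof (cases "k0 = 1")
      case True
      then show ?thesis using q0(1)[of 0] by simp
    next
      case False
      then have "k0 = Suc (Suc (k0 - 2))" "k0 - 2 \<le> 2*(n-1)" using q(1) by auto
      then show ?thesis using q0(2)[of "k0 - 2"] by simp
    qed
    then show False using q(2) by simp
  qed
  have "v k = 0" if v: "v = v1 \<or> v = v2" for v
  proof -
    define R where "R = binomial_poly (2*n) (\<lambda>k. v (Suc k))"
    note R = poly_binomial_poly[of "2*n" "\<lambda>k. v (Suc k)", folded R_def]
    have V': "coeff_fun (2 * n + 1) v (quad c 0 ^ n) = poly R c" for c
      unfolding R quad_0_power
      by (rule coeff_fun_shift) (auto simp: coeff_eq_0 degree_linear_power)
    have "poly (R * (R0\<^sup>2 + R1\<^sup>2)) c = 0" for c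
    proof -
      have cont: "continuous_on UNIV (\<lambda>d. coeff (pCons 0 (quad c d ^ (n - 1))) i)" for i
        by (cases i) (auto intro!: coeff_quad_power_continuous)
      have "coeff_fun (2 * n + 1) v (quad c 0 ^ n) * ((Q0 c 0)\<^sup>2 + (Q1 c 0)\<^sup>2) = 0"
        by (rule continuous_zero_off_0[OF prod[OF _ v]], assumption)
          (unfold Q0_def Q1_def coeff_fun_def, intro continuous_intros cont coeff_quad_power_continuous)
      then show ?thesis unfolding V' Q0' Q1' poly_mult poly_add poly_power .
    qed
    then have "R * (R0\<^sup>2 + R1\<^sup>2) = 0" using poly_all_0_iff_0 by blast
    then have "R = 0" using R01 by auto
    then have "v (Suc (k - 1)) = 0"
      using binomial_poly_eq_0D[of "2*n" "\<lambda>k. v (Suc k)" "k - 1"] k by (auto simp: R_def)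
    then show ?thesis using k by simp
  qed
  then show ?thesis by blast
qed

section \<open>Two injective pencils on polynomials\<close>

definition cpoly :: "real poly \<Rightarrow> complex poly" where "cpoly p = map_poly complex_of_real p"

lemma coeff_cpoly [simp]: "coeff (cpoly p) i = complex_of_real (coeff p i)"
  by (simp add: cpoly_def coeff_map_poly)

lemma cpoly_hom:
  "cpoly (p + q) = cpoly p + cpoly q" "cpoly (smult r p) = smult (complex_of_real r) (cpoly p)"
  "cpoly (p * q) = cpoly p * cpoly q" "cpoly 1 = 1" "cpoly 0 = 0" "cpoly (- p) = - cpoly p"
  "cpoly (pCons a p) = pCons (complex_of_real a) (cpoly p)"
  by (auto intro!: poly_eqI simp: coeff_mult coeff_pCons split: nat.split)

lemma cpoly_power: "cpoly (p ^ n) = cpoly p ^ n"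
  by (induction n) (simp_all add: cpoly_hom)

lemma degree_cpoly [simp]: "degree (cpoly p) = degree p"
  by (simp add: cpoly_def degree_map_poly)

definition ccoeff_fun :: "nat \<Rightarrow> (nat \<Rightarrow> real) \<Rightarrow> complex poly \<Rightarrow> complex" where
  "ccoeff_fun n v p = (\<Sum>j=1..n. complex_of_real (v j) * coeff p (j - 1))"

lemma ccoeff_fun_linear:
  "ccoeff_fun n v (p + q) = ccoeff_fun n v p + ccoeff_fun n v q"
  "ccoeff_fun n v (smult r p) = r * ccoeff_fun n v p"
  "ccoeff_fun n v (cpoly h) = complex_of_real (coeff_fun n v h)"
  by (simp_all add: ccoeff_fun_def coeff_fun_def sum.distrib algebra_simps sum_distrib_left)

lemma quad_power_monic: "degree (quad c d ^ n) = 2 * n" "coeff (quad c d ^ n) (2 * n) = 1"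
proof -
  have 1: "degree (quad c d) = 2" by (simp add: quad_def numeral_2_eq_2)
  then show deg: "degree (quad c d ^ n) = 2 * n" using degree_power_eq[of "quad c d" n] by fastforce
  have "lead_coeff (quad c d) = 1" unfolding 1 by (simp add: quad_def numeral_2_eq_2)
  then have "lead_coeff (quad c d ^ n) = 1" by (simp add: lead_coeff_power)
  then show "coeff (quad c d ^ n) (2 * n) = 1" by (simp only: deg)
qed

lemma poly_cpoly_quad: "poly (cpoly (quad c d)) z = of_real (c\<^sup>2 + d\<^sup>2) - 2 * of_real c * z + z\<^sup>2"
  by (simp add: quad_def cpoly_hom algebra_simps power2_eq_square)

lemma square_minus_not_real:
  assumes "z\<^sup>2 = - (complex_of_real d)\<^sup>2" "d \<noteq> 0" shows "z \<noteq> complex_of_real a"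
proof
  assume "z = complex_of_real a"
  then have "complex_of_real (a\<^sup>2) = complex_of_real (- d\<^sup>2)" using assms(1) by simp
  then have "a\<^sup>2 = - d\<^sup>2" by (simp only: of_real_eq_iff)
  then show False using assms(2) by (smt (verit) zero_le_power2 zero_less_power2)
qed

text \<open>The second conclusion concerns \<open>\<mu> = \<infinity>\<close>. In the first one, suppose \<open>L g \<noteq> 0\<close> and let \<open>r2 = c\<^sup>2 + d\<^sup>2\<close>. Evaluating
  at \<open>1 / \<mu>\<close> shows that \<open>1 / \<mu>\<close> is a root of \<open>quad c d\<close>, so that \<open>A = c - \<mu> * r2\<close> satisfies \<open>A\<^sup>2 = - d\<^sup>2\<close>. Dividing
  by \<open>1 - \<mu> x\<close> and applying \<open>L\<close> yields \<open>1 + \<sigma> + \<tau> * A * L H = 0\<close>, so \<open>A\<close> is real, a contradiction. The parameter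
  \<open>\<sigma>\<close> is arbitrary: it will be the parameter of a line.\<close>

lemma odd_pencil_injective:
  fixes q :: "nat \<Rightarrow> real" and n :: nat and c d \<tau> \<sigma> :: real and b0 :: "real poly"
  defines "H \<equiv> quad c d ^ n"
  defines "\<Gamma>1 \<equiv> smult \<tau> ([:c, -1:] * H) + smult \<sigma> b0"
    and "\<Gamma>2 \<equiv> smult \<tau> ([:c\<^sup>2 + d\<^sup>2, - c:] * H) + smult \<sigma> ([:0, 1:] * b0)"
    and "L \<equiv> ccoeff_fun (2 * n + 1) q"
  assumes d: "d \<noteq> 0" and \<tau>: "\<tau> \<noteq> 0" and QH: "coeff_fun (2 * n + 1) q H \<noteq> 0"
    and b0: "coeff_fun (2 * n + 1) q b0 = 1" "degree b0 < 2 * n + 1" and g: "degree g < 2 * n + 1"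
  shows "[:1, - \<mu>:] * g + smult (L g) (cpoly \<Gamma>1 - smult \<mu> (cpoly \<Gamma>2)) = 0 \<Longrightarrow> g = 0"
    and "[:0, 1:] * g + smult (L g) (cpoly \<Gamma>2) = 0 \<Longrightarrow> g = 0"
proof -
  define s where "s = L g"
  define G where "G = g + smult (s * of_real \<sigma>) (cpoly b0)"
  define r2 where "r2 = complex_of_real (c\<^sup>2 + d\<^sup>2)"
  have LG: "L G = s * (1 + of_real \<sigma>)"
    by (simp only: G_def L_def ccoeff_fun_linear b0(1) s_def) (simp add: algebra_simps)
  have dG: "degree G < 2 * n + 1"
    unfolding G_def by (rule degree_add_less) (use g b0 in \<open>auto intro: le_less_trans[OF degree_smult_le]\<close>)
  have LH: "L (cpoly H) = of_real (coeff_fun (2 * n + 1) q H)"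
    by (simp add: L_def ccoeff_fun_linear)
  have \<Gamma>1: "poly (cpoly \<Gamma>1) x = of_real \<tau> * (of_real c - x) * poly (cpoly H) x + of_real \<sigma> * poly (cpoly b0) x" for x
    by (simp add: \<Gamma>1_def cpoly_hom algebra_simps)
  have \<Gamma>2: "poly (cpoly \<Gamma>2) x = of_real \<tau> * (r2 - of_real c * x) * poly (cpoly H) x + of_real \<sigma> * x * poly (cpoly b0) x" for x
    by (simp add: \<Gamma>2_def r2_def cpoly_hom algebra_simps)
  show "g = 0" if eq: "[:1, - \<mu>:] * g + smult (L g) (cpoly \<Gamma>1 - smult \<mu> (cpoly \<Gamma>2)) = 0"
  proof (cases "s = 0")
    case True
    then have "[:1, - \<mu>:] * g = 0" using eq by (simp add: s_def)
    then show ?thesis by (metis mult_eq_0_iff pCons_eq_0_iff zero_neq_one)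
  next
    case s: False
    have ev: "(1 - \<mu> * x) * poly G x + s * of_real \<tau> * ((of_real c - \<mu> * r2) - (1 - \<mu> * of_real c) * x) * poly (cpoly H) x = 0" for x
    proof -
      have "poly ([:1, - \<mu>:] * g + smult s (cpoly \<Gamma>1 - smult \<mu> (cpoly \<Gamma>2))) x = 0"
        using eq by (simp add: s_def)
      then show ?thesis by (simp add: G_def \<Gamma>1 \<Gamma>2 algebra_simps)
    qed
    \<comment> \<open>Compare the coefficients of \<open>x ^ (2 * n + 1)\<close>, which exceeds the degree of \<open>G\<close>.\<close>
    have "\<mu> \<noteq> 0"
    proof
      assume \<mu>: "\<mu> = 0"
      have "poly G = poly (- smult (s * of_real \<tau>) ([:of_real c, -1:] * cpoly H))"
        by (rule ext, use ev in \<open>simp add: \<mu> eq_neg_iff_add_eq_0 algebra_simps\<close>)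
      then have "G = - smult (s * of_real \<tau>) ([:of_real c, -1:] * cpoly H)" by (simp only: poly_eq_poly_eq_iff)
      then have "coeff G (Suc (2 * n)) = - (s * of_real \<tau> * (of_real c * coeff (cpoly H) (Suc (2 * n)) - coeff (cpoly H) (2 * n)))"
        by (simp add: algebra_simps)
      also have "coeff (cpoly H) (Suc (2 * n)) = 0"
        unfolding coeff_cpoly H_def by (simp add: coeff_eq_0 quad_power_monic)
      also have "coeff (cpoly H) (2 * n) = 1" by (simp add: H_def quad_power_monic)
      also have "coeff G (Suc (2 * n)) = 0" using dG by (simp add: coeff_eq_0)
      finally show False using s \<tau> by simp
    qed
    define z where "z = 1 / \<mu>"
    have z: "\<mu> * z = 1" using \<open>\<mu> \<noteq> 0\<close> by (simp add: z_def)
    have "((of_real c - \<mu> * r2) - (1 - \<mu> * of_real c) * z) * poly (cpoly H) z = 0"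
      using ev[of z] z s \<tau> by simp
    then have quad0: "1 - 2 * of_real c * \<mu> + r2 * \<mu>\<^sup>2 = 0"
    proof (rule mult_eq_0_iff[THEN iffD1, THEN disjE])
      assume "(of_real c - \<mu> * r2) - (1 - \<mu> * of_real c) * z = 0"
      then have "\<mu> * ((of_real c - \<mu> * r2) - (1 - \<mu> * of_real c) * z) = 0" by simp
      then have "\<mu> * (of_real c - \<mu> * r2) - (1 - \<mu> * of_real c) * (\<mu> * z) = 0" by (simp add: algebra_simps)
      then show ?thesis unfolding z by (simp add: algebra_simps power2_eq_square)
    next
      assume "poly (cpoly H) z = 0"
      then have "poly (cpoly (quad c d)) z = 0" by (simp add: H_def cpoly_power)
      then have "\<mu>\<^sup>2 * (r2 - 2 * of_real c * z + z\<^sup>2) = 0" by (simp add: poly_cpoly_quad r2_def)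
      then have "r2 * \<mu>\<^sup>2 - 2 * of_real c * \<mu> * (\<mu> * z) + (\<mu> * z)\<^sup>2 = 0"
        by (simp add: algebra_simps power2_eq_square)
      then show ?thesis unfolding z by (simp add: algebra_simps)
    qed
    define A where "A = of_real c - \<mu> * r2"
    have A\<mu>: "1 - \<mu> * of_real c = A * \<mu>" using quad0 by (simp add: A_def algebra_simps power2_eq_square)
    have AA: "A\<^sup>2 = - (complex_of_real d)\<^sup>2"
    proof -
      have "A\<^sup>2 + (complex_of_real d)\<^sup>2 = r2 * (1 - 2 * of_real c * \<mu> + r2 * \<mu>\<^sup>2)"
        by (simp add: A_def r2_def algebra_simps power2_eq_square)
      then show ?thesis using quad0 by (simp add: eq_neg_iff_add_eq_0)
    qed
    have "poly ([:1, - \<mu>:] * (G + smult (s * of_real \<tau> * A) (cpoly H))) x = poly 0 x" for x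
    proof -
      have "(1 - \<mu> * x) * poly G x + s * of_real \<tau> * (A - A * \<mu> * x) * poly (cpoly H) x = 0"
        using ev[of x] A\<mu> by (simp add: A_def)
      then show ?thesis by (simp add: algebra_simps)
    qed
    then have "[:1, - \<mu>:] * (G + smult (s * of_real \<tau> * A) (cpoly H)) = 0"
      by (intro poly_eq_poly_eq_iff[THEN iffD1] ext)
    then have "G + smult (s * of_real \<tau> * A) (cpoly H) = 0"
      by (metis mult_eq_0_iff pCons_eq_0_iff zero_neq_one)
    then have "L (G + smult (s * of_real \<tau> * A) (cpoly H)) = 0" by (simp add: L_def ccoeff_fun_def)
    then have "s * ((1 + of_real \<sigma>) + of_real \<tau> * A * L (cpoly H)) = 0"
      using LG by (simp add: L_def ccoeff_fun_linear algebra_simps)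
    then have "(1 + of_real \<sigma>) + of_real \<tau> * A * L (cpoly H) = 0" using s by simp
    then have "A * of_real (\<tau> * coeff_fun (2 * n + 1) q H) = - of_real (1 + \<sigma>)"
      by (simp add: LH eq_neg_iff_add_eq_0 algebra_simps)
    then have "A = complex_of_real (- (1 + \<sigma>) / (\<tau> * coeff_fun (2 * n + 1) q H))"
      using \<tau> QH by (simp add: field_simps)
    then show ?thesis using square_minus_not_real[OF AA d] by blast
  qed
  show "g = 0" if eq: "[:0, 1:] * g + smult (L g) (cpoly \<Gamma>2) = 0"
  proof -
    have "poly ([:0, 1:] * g + smult s (cpoly \<Gamma>2)) 0 = 0" using eq by (simp add: s_def)
    then have "s * of_real \<tau> * r2 * poly (cpoly H) 0 = 0" by (simp add: \<Gamma>2)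
    moreover have "poly (cpoly H) 0 = r2 ^ n"
      by (simp add: H_def cpoly_power poly_cpoly_quad r2_def)
    moreover have "r2 \<noteq> 0"
    proof -
      have "c\<^sup>2 + d\<^sup>2 \<noteq> 0" using d by (simp add: sum_power2_eq_zero_iff)
      then show ?thesis unfolding r2_def by (simp only: of_real_eq_0_iff not_False_eq_True)
    qed
    ultimately have "s = 0" using \<tau> by simp
    then show ?thesis using eq by (simp add: s_def)
  qed
qed

text \<open>A kernel would make \<open>z = 1 / \<mu>\<close> a root of \<open>quad c d\<close>. Dividing by \<open>1 - \<mu> x\<close> and applying \<open>L\<close> leaves a linear
  equation for \<open>z\<close> with real coefficients, in which \<open>z\<close> has the coefficient \<open>\<tau> * (c2 * Q0 - c1 * Q1)\<close>. Hence \<open>z\<close> is real,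
  which no root of \<open>quad c d\<close> is.\<close>

lemma even_pencil_injective:
  fixes q :: "nat \<Rightarrow> real" and n :: nat and c d c1 c2 :: real
  assumes n: "n \<ge> 1" and d: "d \<noteq> 0" and g: "degree g < 2 * n"
  defines "H \<equiv> quad c d ^ n" and "L \<equiv> ccoeff_fun (2 * n) q"
  defines "Q0 \<equiv> coeff_fun (2 * n) q (quad c d ^ (n - 1))" and "Q1 \<equiv> coeff_fun (2 * n) q (pCons 0 (quad c d ^ (n - 1)))"
  assumes ne: "c1 * Q1 \<noteq> c2 * Q0"
  shows "[:1, - \<mu>:] * g + smult (L g) (cpoly (smult (\<tau> * c1) H) - smult \<mu> (cpoly (smult (\<tau> * c2) H))) = 0 \<Longrightarrow> g = 0"
    and "[:0, 1:] * g + smult (L g) (cpoly (smult (\<tau> * c2) H)) = 0 \<Longrightarrow> g = 0"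
proof -
  define s where "s = L g"
  define r2 where "r2 = complex_of_real (c\<^sup>2 + d\<^sup>2)"
  define \<kappa> where "\<kappa> = of_real c1 - \<mu> * of_real c2"
  show "g = 0" if eq: "[:1, - \<mu>:] * g + smult (L g) (cpoly (smult (\<tau> * c1) H) - smult \<mu> (cpoly (smult (\<tau> * c2) H))) = 0"
  proof (rule ccontr)
    assume g0: "g \<noteq> 0"
    have eq1: "[:1, - \<mu>:] * g + smult (s * of_real \<tau> * \<kappa>) (cpoly H) = 0"
      using eq by (simp add: s_def cpoly_hom \<kappa>_def algebra_simps smult_diff_left smult_diff_right)
    have s\<tau>\<kappa>: "s * of_real \<tau> * \<kappa> \<noteq> 0"
    proof
      assume "s * of_real \<tau> * \<kappa> = 0"
      from eq1[unfolded this] have "[:1, - \<mu>:] * g = 0" by (simp only: smult_0_left add_0_right)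
      then show False using g0 by (metis mult_eq_0_iff pCons_eq_0_iff zero_neq_one)
    qed
    have ev: "(1 - \<mu> * x) * poly g x + s * of_real \<tau> * \<kappa> * poly (cpoly H) x = 0" for x
    proof -
      have "poly ([:1, - \<mu>:] * g + smult (s * of_real \<tau> * \<kappa>) (cpoly H)) x = 0" using eq1 by simp
      then show ?thesis by (simp add: algebra_simps)
    qed
    have "\<mu> \<noteq> 0"
    proof
      assume \<mu>: "\<mu> = 0"
      then have "coeff (g + smult (s * of_real \<tau> * \<kappa>) (cpoly H)) (2 * n) = 0" using eq1 by simp
      moreover have "coeff g (2 * n) = 0" using g by (simp add: coeff_eq_0)
      moreover have "coeff H (2 * n) = 1" by (simp add: H_def quad_power_monic)
      ultimately show False using s\<tau>\<kappa> by simp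
    qed
    define z where "z = 1 / \<mu>"
    have z: "\<mu> * z = 1" using \<open>\<mu> \<noteq> 0\<close> by (simp add: z_def)
    have "poly (cpoly H) z = 0" using ev[of z] z s\<tau>\<kappa> by simp
    then have "poly (cpoly (quad c d)) z = 0" by (simp add: H_def cpoly_power)
    then have z2: "r2 - 2 * of_real c * z + z\<^sup>2 = 0" by (simp add: poly_cpoly_quad r2_def)
    have \<mu>r2: "\<mu> * r2 = 2 * of_real c - z"
    proof -
      have "\<mu> * (r2 - 2 * of_real c * z + z\<^sup>2) = \<mu> * r2 - 2 * of_real c * (\<mu> * z) + (\<mu> * z) * z"
        by (simp add: algebra_simps power2_eq_square)
      then show ?thesis unfolding z z2 by (simp add: algebra_simps)
    qed
    define K where "K = [:r2, - z:] * cpoly (quad c d ^ (n - 1))"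
    have "poly ([:1, - \<mu>:] * (g + smult (s * of_real \<tau> * \<kappa>) K)) x = poly 0 x" for x
    proof -
      have "(1 - \<mu> * x) * (r2 - z * x) = r2 - (\<mu> * r2 + z) * x + (\<mu> * z) * x\<^sup>2"
        by (simp add: algebra_simps power2_eq_square)
      also have "\<dots> = poly (cpoly (quad c d)) x"
        unfolding z \<mu>r2 by (simp add: poly_cpoly_quad r2_def algebra_simps)
      finally have quad: "(1 - \<mu> * x) * (r2 - z * x) = poly (cpoly (quad c d)) x" .
      have "poly K x = (r2 - z * x) * poly (cpoly (quad c d ^ (n - 1))) x"
        by (simp add: K_def algebra_simps)
      then have "(1 - \<mu> * x) * poly K x = ((1 - \<mu> * x) * (r2 - z * x)) * poly (cpoly (quad c d ^ (n - 1))) x"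
        by (simp only: mult.assoc)
      also have "\<dots> = poly (cpoly (quad c d)) x * poly (cpoly (quad c d ^ (n - 1))) x"
        by (simp only: quad)
      also have "\<dots> = poly (cpoly H) x"
        using n by (simp add: H_def cpoly_power flip: power_Suc)
      finally have KH: "(1 - \<mu> * x) * poly K x = poly (cpoly H) x" .
      have "poly ([:1, - \<mu>:] * (g + smult (s * of_real \<tau> * \<kappa>) K)) x =
          (1 - \<mu> * x) * poly g x + s * of_real \<tau> * \<kappa> * ((1 - \<mu> * x) * poly K x)"
        by (simp add: algebra_simps)
      then show ?thesis unfolding KH using ev[of x] by simp
    qed
    then have "[:1, - \<mu>:] * (g + smult (s * of_real \<tau> * \<kappa>) K) = 0"
      by (intro poly_eq_poly_eq_iff[THEN iffD1] ext)
    then have "g + smult (s * of_real \<tau> * \<kappa>) K = 0"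
      by (metis mult_eq_0_iff pCons_eq_0_iff zero_neq_one)
    then have "L (g + smult (s * of_real \<tau> * \<kappa>) K) = 0" by (simp add: L_def ccoeff_fun_def)
    then have "s + s * of_real \<tau> * \<kappa> * L K = 0"
      by (simp add: L_def ccoeff_fun_linear s_def)
    moreover have "L K = r2 * of_real Q0 - z * of_real Q1"
    proof -
      have "K = smult r2 (cpoly (quad c d ^ (n - 1))) + smult (- z) (cpoly (pCons 0 (quad c d ^ (n - 1))))"
        by (simp add: K_def cpoly_hom)
      then show ?thesis by (simp only: L_def ccoeff_fun_linear Q0_def Q1_def) simp
    qed
    ultimately have "s * (1 + of_real \<tau> * (\<kappa> * (r2 * of_real Q0 - z * of_real Q1))) = 0"
      by (simp add: algebra_simps)
    then have one: "1 + of_real \<tau> * (\<kappa> * (r2 * of_real Q0 - z * of_real Q1)) = 0" using s\<tau>\<kappa> by simp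
    have "\<kappa> * (r2 * of_real Q0 - z * of_real Q1) =
        of_real c1 * r2 * of_real Q0 - of_real c1 * z * of_real Q1 - of_real c2 * of_real Q0 * (\<mu> * r2)
          + of_real c2 * of_real Q1 * (\<mu> * z)"
      by (simp add: \<kappa>_def algebra_simps)
    also have "\<dots> = of_real (c1 * (c\<^sup>2 + d\<^sup>2) * Q0 - 2 * c * c2 * Q0 + c2 * Q1) + of_real (c2 * Q0 - c1 * Q1) * z"
      unfolding z \<mu>r2 unfolding r2_def by (simp add: algebra_simps)
    finally have "1 + of_real \<tau> * (of_real (c1 * (c\<^sup>2 + d\<^sup>2) * Q0 - 2 * c * c2 * Q0 + c2 * Q1) + of_real (c2 * Q0 - c1 * Q1) * z) = 0"
      using one by simp
    then have "of_real (\<tau> * (c2 * Q0 - c1 * Q1)) * z = - of_real (1 + \<tau> * (c1 * (c\<^sup>2 + d\<^sup>2) * Q0 - 2 * c * c2 * Q0 + c2 * Q1))"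
      by (simp add: eq_neg_iff_add_eq_0 algebra_simps)
    moreover have "\<tau> * (c2 * Q0 - c1 * Q1) \<noteq> 0" using ne s\<tau>\<kappa> by auto
    ultimately have zr: "z = of_real (- (1 + \<tau> * (c1 * (c\<^sup>2 + d\<^sup>2) * Q0 - 2 * c * c2 * Q0 + c2 * Q1)) / (\<tau> * (c2 * Q0 - c1 * Q1)))"
      by (metis (no_types, opaque_lifting) nonzero_mult_div_cancel_left of_real_divide of_real_eq_0_iff of_real_minus)
    have "(z - of_real c)\<^sup>2 = (r2 - 2 * of_real c * z + z\<^sup>2) - (of_real d)\<^sup>2"
      by (simp add: r2_def algebra_simps power2_eq_square)
    then have "(z - of_real c)\<^sup>2 = - (complex_of_real d)\<^sup>2" unfolding z2 by simp
    then have "z - of_real c \<noteq> of_real a" for a using square_minus_not_real d by blast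
    then show False using zr by (metis of_real_diff)
  qed
  show "g = 0" if eq: "[:0, 1:] * g + smult (L g) (cpoly (smult (\<tau> * c2) H)) = 0"
  proof (rule ccontr)
    assume g0: "g \<noteq> 0"
    have "poly ([:0, 1:] * g + smult s (cpoly (smult (\<tau> * c2) H))) 0 = 0" using eq by (simp add: s_def)
    then have "s * of_real (\<tau> * c2) * poly (cpoly H) 0 = 0" by (simp add: cpoly_hom)
    moreover have "poly (cpoly H) 0 = r2 ^ n"
      by (simp add: H_def cpoly_power poly_cpoly_quad r2_def)
    moreover have "r2 \<noteq> 0"
    proof -
      have "c\<^sup>2 + d\<^sup>2 \<noteq> 0" using d by (simp add: sum_power2_eq_zero_iff)
      then show ?thesis unfolding r2_def by (simp only: of_real_eq_0_iff not_False_eq_True)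
    qed
    ultimately have "s * of_real (\<tau> * c2) = 0" by simp
    then have "[:0, 1:] * g = 0" using eq by (auto simp add: s_def cpoly_hom)
    then show False using g0 by simp
  qed
qed

section \<open>Normal forms from injective pencils\<close>

lemma nf_table_e_isotropic:
  assumes alt: "alternating \<omega>1" "alternating \<omega>2" and t: "nf_table N D \<omega>1 \<omega>2 e f"
    and a: "a \<in> span (e ` {1..N+1})" "b \<in> span (e ` {1..N+1})"
  shows "\<omega>1 a b = 0" "\<omega>2 a b = 0"
proof -
  obtain c c' where c: "a = (\<Sum>i=1..N+1. c i *\<^sub>R e i)" "b = (\<Sum>i=1..N+1. c' i *\<^sub>R e i)"
    using span_family_sum[OF finite_atLeastAtMost a(1)] span_family_sum[OF finite_atLeastAtMost a(2)] by blast
  show "\<omega>1 a b = 0" "\<omega>2 a b = 0"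
    unfolding c alternating_sum[OF alt(1)] alternating_sum[OF alt(2)]
    using t by (auto intro!: sum.neutral simp: nf_table_def simp del: sum.cl_ivl_Suc)
qed

lemma nf_table_f_isotropic:
  assumes alt: "alternating \<omega>1" "alternating \<omega>2" and t: "nf_table N D \<omega>1 \<omega>2 e f"
    and a: "a \<in> span (f ` {1..N})" "b \<in> span (f ` {1..N})"
  shows "\<omega>1 a b = 0" "\<omega>2 a b = 0"
proof -
  obtain c c' where c: "a = (\<Sum>i=1..N. c i *\<^sub>R f i)" "b = (\<Sum>i=1..N. c' i *\<^sub>R f i)"
    using span_family_sum[OF finite_atLeastAtMost a(1)] span_family_sum[OF finite_atLeastAtMost a(2)] by blast
  show "\<omega>1 a b = 0" "\<omega>2 a b = 0"
    unfolding c alternating_sum[OF alt(1)] alternating_sum[OF alt(2)]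
    using t by (auto intro!: sum.neutral simp: nf_table_def)
qed

lemma nf_table_f_coeff:
  assumes alt: "alternating \<omega>1" and t: "nf_table N D \<omega>1 \<omega>2 e f" and i: "i \<in> {1..N}"
  shows "\<omega>1 (e i) (\<Sum>j=1..N. c j *\<^sub>R f j) = c i"
proof -
  have "\<omega>1 (e i) (\<Sum>j=1..N. c j *\<^sub>R f j) = (\<Sum>j=1..N. if j = i then c j else 0)"
    by (simp only: alternating_sum(2)[OF alt])
      (intro sum.cong, use t i in \<open>auto simp: nf_table_def\<close>)
  then show ?thesis using i by simp
qed

lemma nf_table_f_expand:
  assumes alt: "alternating \<omega>1" and t: "nf_table N D \<omega>1 \<omega>2 e f" and z: "z \<in> span (f ` {1..N})"
  shows "z = (\<Sum>j=1..N. \<omega>1 (e j) z *\<^sub>R f j)"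
proof -
  obtain c where c: "z = (\<Sum>i=1..N. c i *\<^sub>R f i)"
    using span_family_sum[OF finite_atLeastAtMost z] by blast
  have "(\<Sum>j=1..N. \<omega>1 (e j) z *\<^sub>R f j) = (\<Sum>j=1..N. c j *\<^sub>R f j)"
    by (intro sum.cong refl) (simp only: c nf_table_f_coeff[OF alt t])
  then show ?thesis using c by simp
qed

lemma nf_table_spans_dim:
  assumes alt: "alternating \<omega>1" "alternating \<omega>2" and N: "N \<ge> 1" and t: "nf_table N D \<omega>1 \<omega>2 e f"
  shows "dim (span (e ` {1..N+1})) = N + 1" "dim (span (f ` {1..N})) = N"
proof -
  have d: "\<omega>1 (e i) (f j) = (if i = j then 1 else 0)" if "i \<in> {1..N}" "j \<in> {1..N}" for i j
    using t that by (auto simp: nf_table_def)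
  have "independent (f ` {1..N})" "inj_on f {1..N}"
    using dual_system_independent[of "{1..N}" "\<lambda>i. \<omega>1 (e i)" f, OF alternating_linear(1)[OF alt(1)] d] by simp_all
  then show "dim (span (f ` {1..N})) = N" by (simp add: dim_eq_card_independent card_image)
  obtain g where g: "\<And>i j. i \<in> {1..N+1} \<Longrightarrow> j \<in> {1..N+1} \<Longrightarrow> e i \<bullet> g j = (if i = j then 1 else 0)"
    using dual_family[OF _ nf_table_e_indep[OF alt N t]] by (metis finite_atLeastAtMost)
  have l: "linear (\<lambda>v. v \<bullet> g i)" for i by (simp add: linear_iff inner_add_left)
  have g': "e j \<bullet> g i = (if i = j then 1 else 0)" if "i \<in> {1..N+1}" "j \<in> {1..N+1}" for i j
    using g[OF that(2,1)] by simp
  note ind = dual_system_independent[of "{1..N+1}" "\<lambda>i v. v \<bullet> g i" e, OF l g']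
  have "dim (span (e ` {1..N+1})) = card (e ` {1..N+1})"
    unfolding dim_span by (rule dim_eq_card_independent[OF ind(2)])
  also have "\<dots> = N + 1" using card_image[OF ind(1)] by simp
  finally show "dim (span (e ` {1..N+1})) = N + 1" .
qed

text \<open>A vector \<open>z1 + \<i> z2\<close> in the complexified span of \<open>f\<close> is encoded by the polynomial \<open>g\<close> with coefficients
  \<open>\<omega>1 (e j) z1 + \<i> \<omega>1 (e j) z2\<close>. Pairing with the \<open>e k\<close>, the form \<open>\<omega>1\<close> becomes the identity, \<open>\<omega>2\<close> becomes
  multiplication by \<open>x\<close>, and \<open>\<theta>\<close> becomes the functional \<open>L\<close>. The two conditions are therefore the injectivity that
  provides a chain in the span of \<open>e\<close>.\<close>

lemma nf_pair_of_injective_pencil: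
  assumes alt: "alternating \<omega>1" "alternating \<omega>2" and D: "subspace D" "dim D = 2 * N + 1" and N: "N \<ge> 1"
    and t: "nf_table N D \<omega>1 \<omega>2 e f"
    and \<theta>e: "\<And>k. k \<in> {1..N+1} \<Longrightarrow> \<theta> \<bullet> e k = 0"
    and x1: "\<And>k. k \<in> {1..N+1} \<Longrightarrow> x1 \<bullet> e k = coeff \<Gamma>1 (k - 1)" "\<And>j. j \<in> {1..N} \<Longrightarrow> x1 \<bullet> f j = 0"
    and x2: "\<And>k. k \<in> {1..N+1} \<Longrightarrow> x2 \<bullet> e k = coeff \<Gamma>2 (k - 1)" "\<And>j. j \<in> {1..N} \<Longrightarrow> x2 \<bullet> f j = 0"
    and deg: "degree \<Gamma>1 \<le> N" "degree \<Gamma>2 \<le> N"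
  defines "L \<equiv> ccoeff_fun N (\<lambda>j. \<theta> \<bullet> f j)"
  assumes inj: "\<And>g \<mu>. degree g < N \<Longrightarrow> [:1, - \<mu>:] * g + smult (L g) (cpoly \<Gamma>1 - smult \<mu> (cpoly \<Gamma>2)) = 0 \<Longrightarrow> g = 0"
    and inj2: "\<And>g. degree g < N \<Longrightarrow> [:0, 1:] * g + smult (L g) (cpoly \<Gamma>2) = 0 \<Longrightarrow> g = 0"
  shows "nf_pair N D (add_wedge \<omega>1 x1 \<theta>) (add_wedge \<omega>2 x2 \<theta>)"
proof -
  define A where "A = span (e ` {1..N+1})"
  define B where "B = span (f ` {1..N})"
  define M1 where "M1 = add_wedge \<omega>1 x1 \<theta>"
  define M2 where "M2 = add_wedge \<omega>2 x2 \<theta>"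
  have altM: "alternating M1" "alternating M2" unfolding M1_def M2_def by (simp_all add: alternating_add_wedge alt)
  have eA: "e k \<in> A" if "k \<in> {1..N+1}" for k unfolding A_def using that by (intro span_base imageI)
  have AD: "A \<subseteq> D" "B \<subseteq> D"
    unfolding A_def B_def using nf_table_mem[OF t] by (intro span_minimal D(1); blast)+
  have \<theta>A: "\<theta> \<bullet> a = 0" if "a \<in> A" for a
  proof -
    have "A \<subseteq> {a. \<theta> \<bullet> a = 0}"
      unfolding A_def by (rule span_minimal) (use \<theta>e in \<open>auto simp: subspace_def inner_add_right\<close>)
    then show ?thesis using that by blast
  qed
  have x1B: "x1 \<bullet> b = 0" and x2B: "x2 \<bullet> b = 0" if "b \<in> B" for b
  proof -
    have "B \<subseteq> {b. x1 \<bullet> b = 0}"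
      unfolding B_def by (rule span_minimal) (use x1(2) in \<open>auto simp: subspace_def inner_add_right\<close>)
    moreover have "B \<subseteq> {b. x2 \<bullet> b = 0}"
      unfolding B_def by (rule span_minimal) (use x2(2) in \<open>auto simp: subspace_def inner_add_right\<close>)
    ultimately show "x1 \<bullet> b = 0" "x2 \<bullet> b = 0" using that by blast+
  qed
  have MA: "M1 a a' = 0" "M2 a a' = 0" if "a \<in> A" "a' \<in> A" for a a'
    using nf_table_e_isotropic[OF alt t that[unfolded A_def]] \<theta>A that by (simp_all add: M1_def M2_def add_wedge_def)
  have Me: "M1 (e k) z = \<omega>1 (e k) z + coeff \<Gamma>1 (k - 1) * (\<theta> \<bullet> z)"
    "M2 (e k) z = \<omega>2 (e k) z + coeff \<Gamma>2 (k - 1) * (\<theta> \<bullet> z)" if "k \<in> {1..N+1}" for k z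
    using x1(1)[OF that] x2(1)[OF that] \<theta>e[OF that] by (simp_all add: M1_def M2_def add_wedge_def)
  have app: "\<omega>2 (e 1) v = 0" "i \<in> {1..N} \<Longrightarrow> \<omega>2 (e (i + 1)) v = \<omega>1 (e i) v" "\<omega>1 (e (N + 1)) v = 0"
    if "v \<in> D" for i v
    using nf_table_apply[OF alt D N t that] N by auto
  define G where "G z1 z2 = (\<Sum>j=1..N. monom (Complex (\<omega>1 (e j) z1) (\<omega>1 (e j) z2)) (j - 1))" for z1 z2
  have cG: "coeff (G z1 z2) i = (if i < N then Complex (\<omega>1 (e (i + 1)) z1) (\<omega>1 (e (i + 1)) z2) else 0)" for z1 z2 i
  proof -
    have "coeff (G z1 z2) i = (\<Sum>j=1..N. if j = i + 1 then Complex (\<omega>1 (e j) z1) (\<omega>1 (e j) z2) else 0)"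
      unfolding G_def coeff_sum by (intro sum.cong) (auto simp: coeff_monom)
    then show ?thesis by auto
  qed
  have dG: "degree (G z1 z2) < N" for z1 z2
  proof -
    have "degree (G z1 z2) \<le> N - 1" by (rule degree_le) (use N in \<open>auto simp: cG\<close>)
    then show ?thesis using N by simp
  qed
  have \<theta>B: "\<theta> \<bullet> z = (\<Sum>j=1..N. (\<theta> \<bullet> f j) * \<omega>1 (e j) z)" if "z \<in> B" for z
    by (subst nf_table_f_expand[OF alt(1) t that[unfolded B_def]]) (simp add: inner_sum_right mult.commute)
  have LG: "L (G z1 z2) = Complex (\<theta> \<bullet> z1) (\<theta> \<bullet> z2)" if "z1 \<in> B" "z2 \<in> B" for z1 z2
  proof -
    have "L (G z1 z2) = (\<Sum>j=1..N. complex_of_real (\<theta> \<bullet> f j) * Complex (\<omega>1 (e j) z1) (\<omega>1 (e j) z2))"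
      unfolding L_def ccoeff_fun_def by (intro sum.cong) (auto simp: cG)
    then show ?thesis using \<theta>B that by (simp add: complex_eq_iff)
  qed
  have G0: "z1 = 0 \<and> z2 = 0" if "G z1 z2 = 0" "z1 \<in> B" "z2 \<in> B" for z1 z2
  proof -
    have "\<omega>1 (e j) z1 = 0 \<and> \<omega>1 (e j) z2 = 0" if j: "j \<in> {1..N}" for j
    proof -
      obtain i where i: "j = Suc i" "i < N" using j by (cases j) auto
      have "coeff (G z1 z2) i = 0" using \<open>G z1 z2 = 0\<close> by simp
      then show ?thesis using i by (simp add: cG complex_eq_iff)
    qed
    then show ?thesis
      using nf_table_f_expand[OF alt(1) t, of z1] nf_table_f_expand[OF alt(1) t, of z2] that
      by (simp add: B_def)
  qed
  have c1: "Complex (\<omega>1 (e (i + 1)) z1) (\<omega>1 (e (i + 1)) z2) = coeff (G z1 z2) i" if "i \<le> N" "z1 \<in> D" "z2 \<in> D" for i z1 z2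
    using that app(3)[of z1] app(3)[of z2] by (cases "i = N") (auto simp: cG complex_eq_iff)
  have c2: "Complex (\<omega>2 (e (i + 1)) z1) (\<omega>2 (e (i + 1)) z2) = coeff ([:0, 1:] * G z1 z2) i" if "i \<le> N" "z1 \<in> D" "z2 \<in> D" for i z1 z2
  proof (cases i)
    case 0
    then show ?thesis using app(1) that by (simp add: complex_eq_iff)
  next
    case (Suc i')
    then show ?thesis using app(2)[of z1 i] app(2)[of z2 i] that by (auto simp: cG complex_eq_iff)
  qed
  have dim: "dim A = N + 1" "dim B = N"
    unfolding A_def B_def using nf_table_spans_dim[OF alt N t] .
  have "\<exists>u. (\<forall>k\<in>{1..N+1}. u k \<in> A) \<and> (\<forall>g\<in>B. M2 (u 1) g = 0) \<and>
    (\<forall>k\<in>{1..N}. \<forall>g\<in>B. M2 (u (k + 1)) g = M1 (u k) g) \<and>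
    (\<forall>c. (\<forall>g\<in>B. (\<Sum>k=1..N. c k * M1 (u k) g) = 0) \<longrightarrow> (\<forall>k\<in>{1..N}. c k = 0))"
  proof (rule injective_pencil_chain)
    show "bilinear M1" "bilinear M2" using altM by (simp_all add: alternating_bilinear)
    show "subspace A" "subspace B" by (simp_all add: A_def B_def)
    show "dim A = N + 1" "dim B = N" by (fact dim)+
    fix g assume g: "g \<in> B" and z: "\<And>a. a \<in> A \<Longrightarrow> M2 a g = 0"
    have gD: "g \<in> D" using g AD by blast
    have zB: "0 \<in> B" and zD: "0 \<in> D" unfolding B_def using D by (simp_all add: span_zero subspace_0)
    have "[:0, 1:] * G g 0 + smult (L (G g 0)) (cpoly \<Gamma>2) = 0"
    proof (rule poly_eqI)
      fix i
      show "coeff ([:0, 1:] * G g 0 + smult (L (G g 0)) (cpoly \<Gamma>2)) i = coeff 0 i"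
      proof (cases "i \<le> N")
        case True
        have "\<omega>2 (e (i + 1)) g + coeff \<Gamma>2 i * (\<theta> \<bullet> g) = 0"
          using z[OF eA[of "i + 1"]] Me(2)[of "i + 1" g] True by simp
        then show ?thesis
          unfolding coeff_add coeff_smult coeff_cpoly c2[OF True gD zD, symmetric] LG[OF g zB]
          by (simp add: complex_eq_iff alternating_add[OF alt(2)] algebra_simps)
      next
        case False
        then show ?thesis using deg by (cases i) (auto simp: cG coeff_eq_0)
      qed
    qed
    then have "G g 0 = 0" by (rule inj2[OF dG])
    then show "g = 0" using G0[OF _ g zB] by blast
  next
    fix r s z1 z2 assume z: "z1 \<in> B" "z2 \<in> B"
      and eq: "\<And>a. a \<in> A \<Longrightarrow> M1 a z1 = r * M2 a z1 - s * M2 a z2 \<and> M1 a z2 = s * M2 a z1 + r * M2 a z2"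
    have zD: "z1 \<in> D" "z2 \<in> D" using z AD by blast+
    define \<mu> where "\<mu> = Complex r s"
    have "[:1, - \<mu>:] * G z1 z2 + smult (L (G z1 z2)) (cpoly \<Gamma>1 - smult \<mu> (cpoly \<Gamma>2)) = 0"
    proof (rule poly_eqI)
      fix i
      have lin: "coeff ([:1, - \<mu>:] * G z1 z2) i = coeff (G z1 z2) i - \<mu> * coeff ([:0, 1:] * G z1 z2) i"
        by (cases i) simp_all
      show "coeff ([:1, - \<mu>:] * G z1 z2 + smult (L (G z1 z2)) (cpoly \<Gamma>1 - smult \<mu> (cpoly \<Gamma>2))) i = coeff 0 i"
      proof (cases "i \<le> N")
        case True
        have "M1 (e (i + 1)) z1 = r * M2 (e (i + 1)) z1 - s * M2 (e (i + 1)) z2"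
          "M1 (e (i + 1)) z2 = s * M2 (e (i + 1)) z1 + r * M2 (e (i + 1)) z2"
          using eq[OF eA[of "i + 1"]] True by auto
        moreover have "i + 1 \<in> {1..N+1}" using True by simp
        ultimately show ?thesis
          unfolding coeff_add coeff_smult coeff_diff coeff_cpoly lin c1[OF True zD, symmetric]
            c2[OF True zD, symmetric] LG[OF z]
          by (simp add: complex_eq_iff \<mu>_def Me algebra_simps)
      next
        case False
        have "coeff ([:0, 1:] * G z1 z2) i = 0" using False by (cases i) (auto simp: cG)
        then show ?thesis unfolding coeff_add lin using False deg by (auto simp: cG coeff_eq_0)
      qed
    qed
    then have "G z1 z2 = 0" by (rule inj[OF dG])
    then show "z1 = 0 \<and> z2 = 0" using G0[OF _ z] by blast
  qed
  then obtain u where u1: "\<forall>k\<in>{1..N+1}. u k \<in> A" and u2: "\<forall>g\<in>B. M2 (u 1) g = 0"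
    and u3: "\<forall>k\<in>{1..N}. \<forall>g\<in>B. M2 (u (k + 1)) g = M1 (u k) g"
    and u4: "\<forall>c. (\<forall>g\<in>B. (\<Sum>k=1..N. c k * M1 (u k) g) = 0) \<longrightarrow> (\<forall>k\<in>{1..N}. c k = 0)"
    by (elim exE conjE)
  have split: "\<exists>a b. v = a + b \<and> a \<in> A \<and> b \<in> B" if v: "v \<in> D" for v
  proof -
    obtain c where c: "v = (\<Sum>i=1..N+1. c i *\<^sub>R e i) + (\<Sum>j=1..N. \<omega>1 (e j) v *\<^sub>R f j)"
      using nf_table_expand[OF alt D N t v] by blast
    have "(\<Sum>i=1..N+1. c i *\<^sub>R e i) \<in> A" "(\<Sum>j=1..N. \<omega>1 (e j) v *\<^sub>R f j) \<in> B"
      unfolding A_def B_def by (intro span_sum span_mul span_base imageI; assumption)+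
    then show ?thesis using c by blast
  qed
  have "kernel_chain (N + 1) D M1 M2 u"
    unfolding kernel_chain_def
  proof (intro conjI ballI)
    show "u i \<in> D" if "i \<in> {1..N+1}" for i using bspec[OF u1 that] AD by blast
    fix v assume "v \<in> D"
    then obtain a b where ab: "v = a + b" "a \<in> A" "b \<in> B" using split by blast
    show "M2 (u 1) v = 0"
      using bspec[OF u2 ab(3)] MA(2)[OF bspec[OF u1] ab(2), of 1] by (simp add: ab(1) alternating_add[OF altM(2)])
    fix i assume i: "i \<in> {1..<N+1}"
    then show "M2 (u (i + 1)) v = M1 (u i) v"
      using bspec[OF bspec[OF u3] ab(3), of i] MA(2)[OF bspec[OF u1] ab(2), of "i + 1"] MA(1)[OF bspec[OF u1] ab(2), of i]
      by (simp add: ab(1) alternating_add[OF altM(2)] alternating_add[OF altM(1)])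
  qed
  moreover have "forms_indep N D M1 u"
    unfolding forms_indep_def
  proof (intro allI impI)
    fix c assume c: "\<forall>v\<in>D. (\<Sum>i=1..N. c i * M1 (u i) v) = 0"
    show "\<forall>i\<in>{1..N}. c i = 0"
      by (rule mp[OF spec[OF u4]]) (use c AD in blast)
  qed
  ultimately show ?thesis
    using nf_table_of_chain[OF altM D N] unfolding M1_def M2_def by blast
qed

section \<open>The slice of pencils in normal form\<close>

lemma nf_pair_transport:
  assumes "nf_pair N D \<omega>1 \<omega>2" and h: "\<And>v. v \<in> D \<Longrightarrow> h v \<in> D"
    and eq: "\<And>u v. u \<in> D \<Longrightarrow> v \<in> D \<Longrightarrow> \<omega>1' (h u) (h v) = \<omega>1 u v \<and> \<omega>2' (h u) (h v) = \<omega>2 u v"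
  shows "nf_pair N D \<omega>1' \<omega>2'"
proof -
  obtain e f where t: "nf_table N D \<omega>1 \<omega>2 e f" using assms(1) by (auto simp: nf_pair_def)
  have "nf_table N D \<omega>1' \<omega>2' (\<lambda>i. h (e i)) (\<lambda>j. h (f j))"
    using t h eq by (simp add: nf_table_def)
  then show ?thesis unfolding nf_pair_def by blast
qed

lemma nf_pair_cong:
  assumes "nf_pair N D \<nu>1 \<nu>2" "\<And>u v. u \<in> D \<Longrightarrow> v \<in> D \<Longrightarrow> \<nu>1' u v = \<nu>1 u v \<and> \<nu>2' u v = \<nu>2 u v"
  shows "nf_pair N D \<nu>1' \<nu>2'"
  by (rule nf_pair_transport[OF assms(1), of id]) (use assms(2) in auto)

text \<open>A principal subspace seen through its two Levi forms: \<open>\<theta>\<close> is normal to the hyperplane along which the jet is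
  prescribed.\<close>

locale pencil_slice =
  fixes N :: nat and D :: "'a::euclidean_space set" and \<omega>1 \<omega>2 :: "'a \<Rightarrow> 'a \<Rightarrow> real"
    and e f :: "nat \<Rightarrow> 'a" and \<theta> :: 'a
  assumes alt: "alternating \<omega>1" "alternating \<omega>2" and D: "subspace D" "dim D = 2 * N + 1"
    and N: "N \<ge> 1" and t: "nf_table N D \<omega>1 \<omega>2 e f" and \<theta>: "\<exists>u\<in>D. \<theta> \<bullet> u \<noteq> 0"
begin

definition slice :: "('a \<times> 'a) set" where
  "slice = {x. nf_pair N D (add_wedge \<omega>1 (fst x) \<theta>) (add_wedge \<omega>2 (snd x) \<theta>)}"

definition zero_component :: "('a \<times> 'a) set" where "zero_component = connected_component_set slice 0"

lemma zero_in_slice: "0 \<in> slice"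
proof -
  have "add_wedge \<omega>1 0 \<theta> = \<omega>1" "add_wedge \<omega>2 0 \<theta> = \<omega>2" by (simp_all add: fun_eq_iff add_wedge_def)
  then show ?thesis using t by (auto simp: slice_def nf_pair_def)
qed

lemma zero_in_component: "0 \<in> zero_component"
  using zero_in_slice by (simp add: zero_component_def)

lemma component_absorbs:
  assumes "x \<in> zero_component" "connected T" "x \<in> T" "T \<subseteq> slice"
  shows "T \<subseteq> zero_component"
proof -
  have "T \<subseteq> connected_component_set slice x" using assms by (intro connected_component_maximal)
  moreover have "connected_component_set slice x = zero_component"
    using assms(1) unfolding zero_component_def by (metis connected_component_eq)
  ultimately show ?thesis by simp
qed

lemma ray_in_component:
  assumes "x \<in> zero_component" "\<And>s. s \<ge> 0 \<Longrightarrow> x + s *\<^sub>R \<eta> \<in> slice" "s \<ge> 0"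
  shows "x + s *\<^sub>R \<eta> \<in> zero_component"
proof -
  have "(\<lambda>s. x + s *\<^sub>R \<eta>) ` {0..} \<subseteq> zero_component"
  proof (rule component_absorbs[OF assms(1)])
    show "connected ((\<lambda>s. x + s *\<^sub>R \<eta>) ` {0..})"
      by (intro connected_continuous_image continuous_intros) simp
    show "x \<in> (\<lambda>s. x + s *\<^sub>R \<eta>) ` {0..}" by (rule image_eqI[of _ _ 0]) auto
  qed (use assms(2) in auto)
  then show ?thesis using assms(3) by auto
qed

lemma ball_in_component: obtains \<delta> where "\<delta> > 0" "ball 0 \<delta> \<subseteq> zero_component"
proof -
  have "\<forall>\<^sub>F x in nhds 0. x \<in> slice" using nf_pair_open[OF alt D N t, of \<theta>] by (simp add: slice_def)
  then obtain \<delta> where d: "\<delta> > 0" "ball 0 \<delta> \<subseteq> slice"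
    unfolding eventually_nhds_metric by (auto simp: dist_commute subset_iff)
  have "ball 0 \<delta> \<subseteq> zero_component" by (rule component_absorbs[OF zero_in_component]) (use d in auto)
  then show ?thesis using that d by blast
qed

text \<open>Pulling back by the transvection that fixes \<open>ker \<theta>\<close> and multiplies \<open>w\<close> by \<open>1 + s\<close> changes \<open>x1\<close> and \<open>x2\<close> affinely
  in \<open>s\<close>.\<close>

lemma scaling_in_slice:
  assumes x: "(x1, x2) \<in> slice" and w: "w \<in> D" "\<theta> \<bullet> w = 1" and s: "s \<ge> 0"
    and b: "\<And>v. b1 \<bullet> v = \<omega>1 v w" "\<And>v. b2 \<bullet> v = \<omega>2 v w"
  shows "(x1 + s *\<^sub>R (b1 + x1 - (x1 \<bullet> w) *\<^sub>R \<theta>), x2 + s *\<^sub>R (b2 + x2 - (x2 \<bullet> w) *\<^sub>R \<theta>)) \<in> slice"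
proof -
  define \<kappa> where "\<kappa> = s / (1 + s)"
  have \<kappa>: "(1 - \<kappa>) * (1 + s) = 1" "(1 - \<kappa>) * s = \<kappa>" using s by (auto simp: \<kappa>_def field_simps)
  define h where "h v = v - (\<kappa> * (\<theta> \<bullet> v)) *\<^sub>R w" for v
  have hD: "h v \<in> D" if "v \<in> D" for v
    unfolding h_def using that w D by (simp add: subspace_diff subspace_mul)
  have \<theta>h: "\<theta> \<bullet> h v = (1 - \<kappa>) * (\<theta> \<bullet> v)" for v
    using w by (simp add: h_def inner_diff_right algebra_simps)
  have key: "add_wedge \<omega> (x + s *\<^sub>R (b + x - (x \<bullet> w) *\<^sub>R \<theta>)) \<theta> (h u) (h v) = add_wedge \<omega> x \<theta> u v"
    if \<omega>: "alternating \<omega>" and b: "\<And>v. b \<bullet> v = \<omega> v w" for \<omega> b x u v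
  proof -
    have 1: "\<omega> (h u) (h v) = \<omega> u v - \<kappa> * (\<theta> \<bullet> v) * \<omega> u w + \<kappa> * (\<theta> \<bullet> u) * \<omega> v w"
      using alternating_commute[OF \<omega>, of w v] \<omega>
      by (simp add: h_def alternating_add[OF \<omega>] algebra_simps)
    have 2: "(x + s *\<^sub>R (b + x - (x \<bullet> w) *\<^sub>R \<theta>)) \<bullet> h u
        = (1 + s) * (x \<bullet> u) + s * \<omega> u w - (\<theta> \<bullet> u) * (x \<bullet> w) * (\<kappa> * (1 + s) + s * (1 - \<kappa>))" for u
    proof -
      have bh: "b \<bullet> h u = \<omega> u w" unfolding b h_def using \<omega> by (simp add: alternating_add[OF \<omega>])
      have xh: "x \<bullet> h u = x \<bullet> u - \<kappa> * (\<theta> \<bullet> u) * (x \<bullet> w)" by (simp add: h_def inner_diff_right)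
      show ?thesis
        unfolding inner_add_left inner_scaleR_left inner_diff_left bh xh \<theta>h by (simp add: algebra_simps)
    qed
    have 3: "((x + s *\<^sub>R (b + x - (x \<bullet> w) *\<^sub>R \<theta>)) \<bullet> h u) * (\<theta> \<bullet> h v)
        = ((1 - \<kappa>) * (1 + s)) * (x \<bullet> u) * (\<theta> \<bullet> v) + ((1 - \<kappa>) * s) * \<omega> u w * (\<theta> \<bullet> v)
          - (1 - \<kappa>) * (\<theta> \<bullet> u) * (\<theta> \<bullet> v) * (x \<bullet> w) * (\<kappa> * (1 + s) + s * (1 - \<kappa>))" for u v
      unfolding 2 \<theta>h by (simp add: algebra_simps)
    show ?thesis unfolding add_wedge_def 1 3 \<kappa> by (simp add: algebra_simps)
  qed
  show ?thesis
    unfolding slice_def using x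
    by (auto simp: slice_def intro!: nf_pair_transport[of N D "add_wedge \<omega>1 x1 \<theta>" "add_wedge \<omega>2 x2 \<theta>" h] hD key alt b)
qed

text \<open>A nilpotent map that is symmetric for both forms, because its coefficients depend on \<open>k + j\<close> only.\<close>

definition hankel :: "(nat \<Rightarrow> real) \<Rightarrow> 'a \<Rightarrow> 'a" where
  "hankel h v = (\<Sum>j=1..N. \<omega>1 (e j) v *\<^sub>R (\<Sum>k=1..N+1. h (k + j) *\<^sub>R e k))"

lemma linear_hankel: "linear (hankel h)"
  unfolding hankel_def
  by (rule linearI) (simp_all add: alternating_add[OF alt(1)] scaleR_add_left sum.distrib scaleR_sum_right)

lemma hankel_mem: "hankel h v \<in> span (e ` {1..N+1})"
  unfolding hankel_def by (intro span_sum span_mul span_base imageI)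

lemma hankel_apply:
  assumes "v \<in> D"
  shows "\<omega>1 (hankel h u) v = (\<Sum>j=1..N. \<Sum>k=1..N. h (k + j) * \<omega>1 (e j) u * \<omega>1 (e k) v)"
    "\<omega>2 (hankel h u) v = (\<Sum>j=1..N. \<Sum>k=1..N. h (k + 1 + j) * \<omega>1 (e j) u * \<omega>1 (e k) v)"
proof -
  note app = nf_table_apply[OF alt D N t assms]
  have a1: "\<omega>1 (\<Sum>k=1..N+1. h (k + j) *\<^sub>R e k) v = (\<Sum>k=1..N. h (k + j) * \<omega>1 (e k) v)" for j
    unfolding alternating_sum(1)[OF alt(1)] using app(3)[of 1] N by simp
  have a2: "\<omega>2 (\<Sum>k=1..N+1. h (k + j) *\<^sub>R e k) v = (\<Sum>k=1..N. h (k + 1 + j) * \<omega>1 (e k) v)" for j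
  proof -
    have "\<omega>2 (\<Sum>k=1..N+1. h (k + j) *\<^sub>R e k) v = (\<Sum>k=1..N+1. h (k + j) * \<omega>2 (e k) v)"
      by (rule alternating_sum(1)[OF alt(2)])
    also have "\<dots> = h (1 + j) * \<omega>2 (e 1) v + (\<Sum>k=1+1..N+1. h (k + j) * \<omega>2 (e k) v)"
      by (subst sum.atLeast_Suc_atMost) auto
    also have "(\<Sum>k=1+1..N+1. h (k + j) * \<omega>2 (e k) v) = (\<Sum>k=1..N. h (k + 1 + j) * \<omega>2 (e (k + 1)) v)"
      by (simp only: sum.shift_bounds_cl_nat_ivl)
    also have "\<dots> = (\<Sum>k=1..N. h (k + 1 + j) * \<omega>1 (e k) v)"
      by (intro sum.cong refl) (simp only: app(2))
    finally show ?thesis using app(1)[of 1] N by simp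
  qed
  show "\<omega>1 (hankel h u) v = (\<Sum>j=1..N. \<Sum>k=1..N. h (k + j) * \<omega>1 (e j) u * \<omega>1 (e k) v)"
    unfolding hankel_def alternating_sum(1)[OF alt(1), of "\<lambda>j. \<omega>1 (e j) u"] a1
    by (simp add: sum_distrib_left mult_ac)
  show "\<omega>2 (hankel h u) v = (\<Sum>j=1..N. \<Sum>k=1..N. h (k + 1 + j) * \<omega>1 (e j) u * \<omega>1 (e k) v)"
    unfolding hankel_def alternating_sum(1)[OF alt(2), of "\<lambda>j. \<omega>1 (e j) u"] a2
    by (simp add: sum_distrib_left mult_ac)
qed

lemma hankel_symmetric:
  assumes "u \<in> D" "v \<in> D"
  shows "\<omega>1 (hankel h u) v = \<omega>1 (hankel h v) u" "\<omega>2 (hankel h u) v = \<omega>2 (hankel h v) u"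
  unfolding hankel_apply[OF assms(2)] hankel_apply[OF assms(1)]
  by (subst sum.swap, intro sum.cong refl, simp add: add_ac mult_ac)+

lemma hankel_isotropic: "\<omega>1 (hankel h u) (hankel h v) = 0" "\<omega>2 (hankel h u) (hankel h v) = 0"
  using nf_table_e_isotropic[OF alt t hankel_mem hankel_mem] by simp_all

lemma span_e_subset_D: "span (e ` {1..N+1}) \<subseteq> D"
  using nf_table_mem[OF t] by (intro span_minimal D(1)) blast

lemma hankel_hankel: "hankel h (hankel h v) = 0"
proof -
  have "\<omega>1 (e j) (hankel h v) = 0" if "j \<in> {1..N}" for j
    by (rule nf_table_e_isotropic(1)[OF alt t span_base hankel_mem]) (use that in auto)
  then show ?thesis unfolding hankel_def[of h "hankel h v"] by (intro sum.neutral ballI) simp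
qed

text \<open>Since \<open>hankel h\<close> is symmetric with isotropic image, \<open>v - s *\<^sub>R hankel h v\<close> preserves \<open>\<omega>1\<close> and \<open>\<omega>2\<close>, and the
  recurrence makes it preserve \<open>\<theta>\<close>. Since \<open>hankel h\<close> has square zero, the orbits are lines.\<close>

lemma hankel_shear_in_slice:
  assumes x: "(x1, x2) \<in> slice"
    and h: "\<And>j. j \<in> {1..N} \<Longrightarrow> (\<Sum>k=1..N+1. (\<theta> \<bullet> e k) * h (k + j)) = 0"
  shows "(x1 + s *\<^sub>R adjoint (hankel h) x1, x2 + s *\<^sub>R adjoint (hankel h) x2) \<in> slice"
proof -
  define g where "g v = v - s *\<^sub>R hankel h v" for v
  have hD: "hankel h v \<in> D" for v using hankel_mem span_e_subset_D by blast
  have gD: "g v \<in> D" if "v \<in> D" for v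
    unfolding g_def using that hD D by (simp add: subspace_diff subspace_mul)
  have \<theta>h: "\<theta> \<bullet> hankel h v = 0" for v
  proof -
    have "\<theta> \<bullet> hankel h v = (\<Sum>j=1..N. \<omega>1 (e j) v * (\<Sum>k=1..N+1. (\<theta> \<bullet> e k) * h (k + j)))"
      unfolding hankel_def by (simp add: inner_sum_right inner_add_right sum_distrib_left mult_ac del: sum.cl_ivl_Suc)
    also have "\<dots> = 0" by (intro sum.neutral ballI) (simp only: h mult_zero_right)
    finally show ?thesis .
  qed
  have adj: "(y + s *\<^sub>R adjoint (hankel h) y) \<bullet> g u = y \<bullet> u" for y u
  proof -
    have "adjoint (hankel h) y \<bullet> g u = y \<bullet> hankel h (g u)"
      using adjoint_works[OF linear_hankel, of "g u" h y] by (simp add: inner_commute)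
    also have "hankel h (g u) = hankel h u"
      unfolding g_def by (simp add: linear_diff[OF linear_hankel] linear_cmul[OF linear_hankel] hankel_hankel)
    finally show ?thesis by (simp add: inner_add_left g_def inner_diff_right)
  qed
  have \<omega>g: "\<omega>1 (g u) (g v) = \<omega>1 u v" "\<omega>2 (g u) (g v) = \<omega>2 u v" if "u \<in> D" "v \<in> D" for u v
    using hankel_symmetric[OF that, of h] alternating_commute[OF alt(1), of u "hankel h v"]
      alternating_commute[OF alt(2), of u "hankel h v"]
    by (simp_all add: g_def alternating_add[OF alt(1)] alternating_add[OF alt(2)] hankel_isotropic)
  have \<theta>g: "\<theta> \<bullet> g v = \<theta> \<bullet> v" for v by (simp add: g_def inner_diff_right \<theta>h)
  show ?thesis
    unfolding slice_def using x
    by (auto simp: slice_def add_wedge_def adj \<theta>g \<omega>g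
        intro!: nf_pair_transport[of N D "add_wedge \<omega>1 x1 \<theta>" "add_wedge \<omega>2 x2 \<theta>" g] gD)
qed

text \<open>On \<open>D\<close>, the coordinates along the \<open>e k\<close> are values of the two forms at the \<open>f j\<close>.\<close>

lemma dual_coordinates:
  "\<exists>E. (\<forall>v\<in>D. \<forall>k\<in>{1..N}. E k \<bullet> v = \<omega>1 v (f k) \<and> E (k + 1) \<bullet> v = \<omega>2 v (f k)) \<and>
    (\<forall>k\<in>{1..N+1}. (\<forall>l\<in>{1..N+1}. E k \<bullet> e l = (if k = l then 1 else 0)) \<and> (\<forall>j\<in>{1..N}. E k \<bullet> f j = 0))"
proof -
  define F where "F k v = (if k \<le> N then \<omega>1 v (f k) else \<omega>2 v (f N))" for k v
  have Flin: "linear (F k)" for k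
    unfolding F_def using alternating_linear(2)[OF alt(1)] alternating_linear(2)[OF alt(2)] by (cases "k \<le> N") simp_all
  define E where "E k = adjoint (F k) 1" for k
  have E: "E k \<bullet> v = F k v" for k v
    using adjoint_works[OF Flin, of v k 1] by (simp add: E_def inner_commute)
  have e: "E k \<bullet> e l = (if k = l then 1 else 0)" if "k \<in> {1..N+1}" "l \<in> {1..N+1}" for k l
    using t that N by (auto simp: E F_def nf_table_def)
  have f: "E k \<bullet> f j = 0" if "k \<in> {1..N+1}" "j \<in> {1..N}" for k j
    using t that N by (auto simp: E F_def nf_table_def)
  have "E (k + 1) \<bullet> v = \<omega>2 v (f k)" if v: "v \<in> D" and k: "k \<in> {1..N}" for v k
  proof -
    obtain c where c: "v = (\<Sum>i=1..N+1. c i *\<^sub>R e i) + (\<Sum>j=1..N. \<omega>1 (e j) v *\<^sub>R f j)"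
      using nf_table_expand[OF alt D N t v] by blast
    have 1: "E (k + 1) \<bullet> (\<Sum>i=1..N+1. c i *\<^sub>R e i) = c (k + 1)"
    proof -
      have "E (k + 1) \<bullet> (\<Sum>i=1..N+1. c i *\<^sub>R e i) = (\<Sum>i=1..N+1. if i = k + 1 then c i else 0)"
        unfolding inner_sum_right inner_scaleR_right by (intro sum.cong refl) (use e[of "k + 1"] k in auto)
      then show ?thesis using k by (simp only: sum.delta finite_atLeastAtMost) simp
    qed
    have 2: "E (k + 1) \<bullet> (\<Sum>j=1..N. \<omega>1 (e j) v *\<^sub>R f j) = 0"
      unfolding inner_sum_right inner_scaleR_right by (intro sum.neutral ballI) (use f[of "k + 1"] k in auto)
    have "\<omega>2 (\<Sum>j=1..N. \<omega>1 (e j) v *\<^sub>R f j) (f k) = 0"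
      by (rule nf_table_f_isotropic(2)[OF alt t]; (intro span_sum span_mul)?; intro span_base imageI) (use k in auto)
    then have "\<omega>2 v (f k) = c (k + 1)"
      by (subst c, subst alternating_add(1)[OF alt(2)]) (simp only: nf_table_e_coeff(2)[OF alt t k] add_0_right)
    then show ?thesis by (subst c, subst inner_add_right) (simp only: 1 2 add_0_right)
  qed
  moreover have "E k \<bullet> v = \<omega>1 v (f k)" if "k \<in> {1..N}" for v k using that by (simp add: E F_def)
  ultimately show ?thesis using e f by (intro exI[of _ E]) blast
qed

text \<open>A point outside the convex hull of the component would yield a nonzero functional with this property.\<close>

context
  fixes y1 y2 :: 'a and bound :: real
  assumes bounded: "\<And>x. x \<in> zero_component \<Longrightarrow> (y1, y2) \<bullet> x \<le> bound"
begin

lemma bounded_ray: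
  assumes "x \<in> zero_component" "\<And>s. s \<ge> 0 \<Longrightarrow> x + s *\<^sub>R \<eta> \<in> slice"
  shows "(y1, y2) \<bullet> \<eta> \<le> 0"
proof (rule ccontr)
  assume pos: "\<not> (y1, y2) \<bullet> \<eta> \<le> 0"
  define s where "s = (bound - (y1, y2) \<bullet> x + 1) / ((y1, y2) \<bullet> \<eta>)"
  have "s \<ge> 0" using bounded[OF assms(1)] pos by (simp add: s_def)
  then have "(y1, y2) \<bullet> (x + s *\<^sub>R \<eta>) \<le> bound" by (intro bounded ray_in_component assms) auto
  moreover have "(y1, y2) \<bullet> (x + s *\<^sub>R \<eta>) = bound + 1"
    unfolding inner_add_right inner_scaleR_right s_def using pos by simp
  ultimately show False by simp
qed

lemma bounded_line:
  assumes x: "x \<in> zero_component" and l: "\<And>s. x + s *\<^sub>R \<eta> \<in> slice"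
  shows "(y1, y2) \<bullet> \<eta> = 0"
proof -
  have "(y1, y2) \<bullet> \<eta> \<le> 0" by (rule bounded_ray[OF x l])
  moreover have "(y1, y2) \<bullet> (- \<eta>) \<le> 0"
    by (rule bounded_ray[OF x]) (use l[of "- s" for s] in simp)
  ultimately show ?thesis by (simp add: inner_minus_right)
qed

text \<open>Adding to \<open>x1\<close> or \<open>x2\<close> a vector orthogonal to \<open>D\<close> does not change the forms on \<open>D\<close>.\<close>

lemma functional_in_D: "y1 \<in> D" "y2 \<in> D"
proof -
  have in_D: "y \<in> D" if "\<And>d. (\<And>u. u \<in> D \<Longrightarrow> d \<bullet> u = 0) \<Longrightarrow> y \<bullet> d = 0" for y :: 'a
  proof -
    obtain a b where ab: "a \<in> span D" "\<And>w. w \<in> span D \<Longrightarrow> orthogonal b w" "y = a + b"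
      using orthogonal_subspace_decomp_exists[of D y] by blast
    have "y \<bullet> b = 0" using that[of b] ab(2) by (simp add: span_base orthogonal_def)
    moreover have "a \<bullet> b = 0" using ab(1,2) by (simp add: orthogonal_def inner_commute)
    ultimately have "b = 0" using ab(3) by (simp add: inner_add_left)
    moreover have "a \<in> D" using ab(1) span_minimal[OF order_refl D(1)] by blast
    ultimately show ?thesis using ab(3) by simp
  qed
  have nf0: "nf_pair N D \<omega>1 \<omega>2" using t by (auto simp: nf_pair_def)
  show "y1 \<in> D"
  proof (rule in_D)
    fix d assume "\<And>u. u \<in> D \<Longrightarrow> d \<bullet> u = 0"
    then have "(y1, y2) \<bullet> (d, 0) = 0"
      by (intro bounded_line[OF zero_in_component]) (auto simp: slice_def add_wedge_def intro!: nf_pair_cong[OF nf0])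
    then show "y1 \<bullet> d = 0" by simp
  qed
  show "y2 \<in> D"
  proof (rule in_D)
    fix d assume "\<And>u. u \<in> D \<Longrightarrow> d \<bullet> u = 0"
    then have "(y1, y2) \<bullet> (0, d) = 0"
      by (intro bounded_line[OF zero_in_component]) (auto simp: slice_def add_wedge_def intro!: nf_pair_cong[OF nf0])
    then show "y2 \<bullet> d = 0" by simp
  qed
qed

text \<open>Adding multiples of \<open>\<theta>\<close> does not change the forms either, as \<open>\<theta> \<and> \<theta> = 0\<close>.\<close>

lemma functional_theta: "y1 \<bullet> \<theta> = 0" "y2 \<bullet> \<theta> = 0"
proof -
  have nf0: "nf_pair N D \<omega>1 \<omega>2" using t by (auto simp: nf_pair_def)
  have "(y1, y2) \<bullet> (\<theta>, 0) = 0" "(y1, y2) \<bullet> (0, \<theta>) = 0"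
    by (rule bounded_line[OF zero_in_component]; auto simp: slice_def add_wedge_def intro!: nf_pair_cong[OF nf0])+
  then show "y1 \<bullet> \<theta> = 0" "y2 \<bullet> \<theta> = 0" by simp_all
qed

text \<open>The rays of \<open>scaling_in_slice\<close> bound the functional by \<open>- (\<omega>1 y1 w + \<omega>2 y2 w)\<close> on the component. If this bound is
  \<open>0\<close>, the functional vanishes, since the component contains a ball around \<open>0\<close>.\<close>

lemma functional_zero_if_base:
  assumes w: "w \<in> D" "\<theta> \<bullet> w = 1" and base: "\<omega>1 y1 w + \<omega>2 y2 w = 0"
  shows "y1 = 0 \<and> y2 = 0"
proof -
  define b1 where "b1 = adjoint (\<lambda>v. \<omega>1 v w) 1"
  define b2 where "b2 = adjoint (\<lambda>v. \<omega>2 v w) 1"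
  have b: "b1 \<bullet> v = \<omega>1 v w" "b2 \<bullet> v = \<omega>2 v w" for v
    using adjoint_works[OF alternating_linear(2)[OF alt(1), of w], of v 1]
      adjoint_works[OF alternating_linear(2)[OF alt(2), of w], of v 1]
    by (simp_all add: b1_def b2_def inner_commute)
  have le: "(y1, y2) \<bullet> x \<le> 0" if x: "x \<in> zero_component" for x
  proof -
    obtain x1 x2 where xx: "x = (x1, x2)" by (cases x)
    have xS: "(x1, x2) \<in> slice" using x connected_component_subset unfolding zero_component_def xx by blast
    define \<eta> where "\<eta> = (b1 + x1 - (x1 \<bullet> w) *\<^sub>R \<theta>, b2 + x2 - (x2 \<bullet> w) *\<^sub>R \<theta>)"
    have "(y1, y2) \<bullet> \<eta> \<le> 0"
    proof (rule bounded_ray[OF x])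
      fix s :: real assume "s \<ge> 0"
      from scaling_in_slice[OF xS w this b] show "x + s *\<^sub>R \<eta> \<in> slice" by (simp add: xx \<eta>_def)
    qed
    moreover have "(y1, y2) \<bullet> \<eta> = (\<omega>1 y1 w + \<omega>2 y2 w) + (y1, y2) \<bullet> x"
      using functional_theta b[of y1] b[of y2]
      by (simp add: \<eta>_def xx inner_add_right inner_diff_right inner_commute)
    ultimately show ?thesis using base by simp
  qed
  obtain \<delta> where \<delta>: "\<delta> > 0" "ball 0 \<delta> \<subseteq> zero_component" using ball_in_component by blast
  have "(y1, y2) = 0"
  proof (rule ccontr)
    assume ne: "(y1, y2) \<noteq> 0"
    define x where "x = (\<delta> / (2 * norm (y1, y2))) *\<^sub>R (y1, y2)"
    have "norm x < \<delta>" using ne \<delta>(1) unfolding x_def norm_scaleR by simp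
    then have "x \<in> zero_component" using \<delta>(2) by auto
    then have "(y1, y2) \<bullet> x \<le> 0" by (rule le)
    then have "\<delta> / (2 * norm (y1, y2)) * ((y1, y2) \<bullet> (y1, y2)) \<le> 0" unfolding x_def inner_scaleR_right .
    moreover have "\<delta> / (2 * norm (y1, y2)) > 0" using ne \<delta>(1) by simp
    moreover have "(y1, y2) \<bullet> (y1, y2) > 0" using ne by (simp only: inner_gt_zero_iff not_False_eq_True)
    ultimately show False by (meson mult_pos_pos not_le)
  qed
  then show ?thesis by (simp add: zero_prod_def)
qed

text \<open>The functional vanishes on the directions \<open>(adjoint (hankel h) x1, adjoint (hankel h) x2)\<close> for all small \<open>x1, x2\<close>, so
  \<open>hankel h\<close> annihilates \<open>y1\<close> and \<open>y2\<close> for every admissible \<open>h\<close>. There are enough of these \<open>h\<close> to push \<open>y1\<close> and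
  \<open>y2\<close> into the span of \<open>e\<close>, which is isotropic and contains \<open>w\<close>.\<close>

lemma functional_zero_regular:
  assumes k0: "k0 \<in> {1..N+1}" "\<theta> \<bullet> e k0 \<noteq> 0"
  shows "y1 = 0 \<and> y2 = 0"
proof -
  obtain \<delta> where \<delta>: "\<delta> > 0" "ball 0 \<delta> \<subseteq> zero_component" using ball_in_component by blast
  have zero: "hankel h y1 = 0 \<and> hankel h y2 = 0"
    if h: "\<And>j. j \<in> {1..N} \<Longrightarrow> (\<Sum>k=1..N+1. (\<theta> \<bullet> e k) * h (k + j)) = 0" for h
  proof -
    have orth: "hankel h y1 \<bullet> x1 + hankel h y2 \<bullet> x2 = 0" if x: "norm (x1, x2) < \<delta>" for x1 x2
    proof -
      have xC: "(x1, x2) \<in> zero_component" using x \<delta>(2) by auto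
      then have xS: "(x1, x2) \<in> slice" using connected_component_subset unfolding zero_component_def by blast
      have "(y1, y2) \<bullet> (adjoint (hankel h) x1, adjoint (hankel h) x2) = 0"
        by (rule bounded_line[OF xC]) (use hankel_shear_in_slice[OF xS h] in simp)
      then show ?thesis
        using adjoint_works[OF linear_hankel, of y1 h x1] adjoint_works[OF linear_hankel, of y2 h x2]
        by (simp add: inner_commute)
    qed
    have small: "\<exists>r>0. norm (r *\<^sub>R z) < \<delta>" for z :: "'a \<times> 'a"
    proof -
      have "norm ((\<delta> / (norm z + 1)) *\<^sub>R z) < \<delta>"
      proof -
        have "norm z / (norm z + 1) < 1" by (simp add: divide_less_eq add_nonneg_pos)
        then have "\<delta> * (norm z / (norm z + 1)) < \<delta> * 1" using \<delta>(1) by (intro mult_strict_left_mono) auto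
        moreover have "norm ((\<delta> / (norm z + 1)) *\<^sub>R z) = \<delta> * (norm z / (norm z + 1))"
        proof -
          have "\<bar>\<delta> / (norm z + 1)\<bar> = \<delta> / (norm z + 1)" using \<delta>(1) by (intro abs_of_nonneg) simp
          then show ?thesis by (simp only: norm_scaleR times_divide_eq_right times_divide_eq_left)
        qed
        ultimately show ?thesis by linarith
      qed
      moreover have "\<delta> / (norm z + 1) > 0" using \<delta>(1) by (simp add: add_nonneg_pos)
      ultimately show ?thesis by blast
    qed
    obtain r where r: "r > 0" "norm (r *\<^sub>R (hankel h y1, hankel h y2)) < \<delta>" using small by blast
    have "r * (hankel h y1 \<bullet> hankel h y1 + hankel h y2 \<bullet> hankel h y2) = 0"
      using orth[of "r *\<^sub>R hankel h y1" "r *\<^sub>R hankel h y2"] r(2) by (simp add: algebra_simps)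
    then have "hankel h y1 \<bullet> hankel h y1 + hankel h y2 \<bullet> hankel h y2 = 0" using r(1) by simp
    then have "hankel h y1 \<bullet> hankel h y1 = 0" "hankel h y2 \<bullet> hankel h y2 = 0"
      by (smt (verit) inner_ge_zero)+
    then show ?thesis by simp
  qed
  have in_span: "y \<in> span (e ` {1..N+1})"
    if y: "y \<in> D" and hy: "\<And>h. (\<And>j. j \<in> {1..N} \<Longrightarrow> (\<Sum>k=1..N+1. (\<theta> \<bullet> e k) * h (k + j)) = 0) \<Longrightarrow> hankel h y = 0" for y
  proof -
    have c0: "\<omega>1 (e j) y = 0" if j: "j \<in> {1..N}" for j
    proof (rule hankel_annihilator_separates[of k0 N "\<lambda>k. \<theta> \<bullet> e k" "\<lambda>j. \<omega>1 (e j) y", OF k0 _ j])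
      fix h k assume h: "\<And>j. j \<in> {1..N} \<Longrightarrow> (\<Sum>k=1..N+1. (\<theta> \<bullet> e k) * h (k + j)) = 0" and k: "k \<in> {1..N+1}"
      have "(\<Sum>k=1..N+1. (\<Sum>j=1..N. h (k + j) * \<omega>1 (e j) y) *\<^sub>R e k) = hankel h y"
        unfolding hankel_def scaleR_sum_right scaleR_sum_left
        by (subst sum.swap) (simp only: scaleR_scaleR mult.commute)
      also have "\<dots> = 0" by (rule hy[OF h])
      finally have "(\<Sum>k=1..N+1. (\<Sum>j=1..N. h (k + j) * \<omega>1 (e j) y) *\<^sub>R e k) = 0" .
      from mp[OF spec[OF nf_table_e_indep[OF alt N t, unfolded independent_family_def]] this]
      show "(\<Sum>j=1..N. h (k + j) * \<omega>1 (e j) y) = 0" using k by blast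
    qed
    obtain c where c: "y = (\<Sum>i=1..N+1. c i *\<^sub>R e i) + (\<Sum>j=1..N. \<omega>1 (e j) y *\<^sub>R f j)"
      using nf_table_expand[OF alt D N t y] by blast
    have "(\<Sum>j=1..N. \<omega>1 (e j) y *\<^sub>R f j) = 0" by (intro sum.neutral ballI) (simp add: c0)
    then have "y = (\<Sum>i=1..N+1. c i *\<^sub>R e i)" using c by simp
    moreover have "(\<Sum>i=1..N+1. c i *\<^sub>R e i) \<in> span (e ` {1..N+1})"
      by (intro span_sum span_mul span_base imageI)
    ultimately show ?thesis by simp
  qed
  define w where "w = (1 / (\<theta> \<bullet> e k0)) *\<^sub>R e k0"
  have w: "w \<in> span (e ` {1..N+1})" unfolding w_def using k0 by (intro span_mul span_base imageI)
  have "\<omega>1 y1 w + \<omega>2 y2 w = 0"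
    using nf_table_e_isotropic[OF alt t in_span[OF functional_in_D(1)] w] nf_table_e_isotropic[OF alt t in_span[OF functional_in_D(2)] w]
      zero by simp
  then show ?thesis
    using functional_zero_if_base[of w] w span_e_subset_D k0(2) by (auto simp: w_def)
qed

text \<open>With \<open>w\<close> a multiple of \<open>f j0\<close>, the quantity to be shown zero is \<open>v1 j0 + v2 (j0 + 1)\<close> up to a factor, where \<open>v1, v2\<close> are
  the coordinates of \<open>y1, y2\<close>. For odd \<open>N\<close> the line from \<open>odd_pencil_injective\<close> in the direction \<open>\<sigma>\<close> gives this
  directly. For even \<open>N\<close> the lines from \<open>even_pencil_injective\<close> pass through \<open>0\<close> and even show that all \<open>v1 k, v2 k\<close>
  vanish.\<close>

lemma functional_zero_singular:
  assumes \<theta>e: "\<And>k. k \<in> {1..N+1} \<Longrightarrow> \<theta> \<bullet> e k = 0"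
  shows "y1 = 0 \<and> y2 = 0"
proof -
  define q where "q j = \<theta> \<bullet> f j" for j
  obtain j0 where j0: "j0 \<in> {1..N}" "q j0 \<noteq> 0"
  proof (rule ccontr)
    assume "\<not> thesis"
    then have q0: "\<theta> \<bullet> f j = 0" if "j \<in> {1..N}" for j using that \<open>\<And>j0. j0 \<in> {1..N} \<Longrightarrow> q j0 \<noteq> 0 \<Longrightarrow> thesis\<close> by (auto simp: q_def)
    obtain v where v: "v \<in> D" "\<theta> \<bullet> v \<noteq> 0" using \<theta> by blast
    obtain c where c: "v = (\<Sum>i=1..N+1. c i *\<^sub>R e i) + (\<Sum>j=1..N. \<omega>1 (e j) v *\<^sub>R f j)"
      using nf_table_expand[OF alt D N t v(1)] by blast
    have "\<theta> \<bullet> (\<Sum>i=1..N+1. c i *\<^sub>R e i) = 0" "\<theta> \<bullet> (\<Sum>j=1..N. \<omega>1 (e j) v *\<^sub>R f j) = 0"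
      unfolding inner_sum_right inner_scaleR_right by (intro sum.neutral ballI; simp only: \<theta>e q0 mult_zero_right)+
    then show False using v(2) c by (metis add_0 inner_add_right)
  qed
  define w where "w = (1 / q j0) *\<^sub>R f j0"
  have w: "w \<in> D" "\<theta> \<bullet> w = 1"
    using nf_table_mem(2)[OF t j0(1)] j0(2) D by (simp_all add: w_def q_def subspace_mul)
  obtain E where E: "\<forall>v\<in>D. \<forall>k\<in>{1..N}. E k \<bullet> v = \<omega>1 v (f k) \<and> E (k + 1) \<bullet> v = \<omega>2 v (f k)"
    "\<forall>k\<in>{1..N+1}. (\<forall>l\<in>{1..N+1}. E k \<bullet> e l = (if k = l then 1 else 0)) \<and> (\<forall>j\<in>{1..N}. E k \<bullet> f j = 0)"
    using dual_coordinates by (elim exE conjE)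
  have E1: "E k \<bullet> v = \<omega>1 v (f k)" and E2: "E (k + 1) \<bullet> v = \<omega>2 v (f k)" if "v \<in> D" "k \<in> {1..N}" for v k
    using E(1) that by blast+
  have Ee: "E k \<bullet> e l = (if k = l then 1 else 0)" if "k \<in> {1..N+1}" "l \<in> {1..N+1}" for k l
    using E(2) that by blast
  have Ef: "E k \<bullet> f j = 0" if "k \<in> {1..N+1}" "j \<in> {1..N}" for k j
    using E(2) that by blast
  define X where "X \<Gamma> = (\<Sum>k=1..N+1. coeff \<Gamma> (k - 1) *\<^sub>R E k)" for \<Gamma> :: "real poly"
  have Xe: "X \<Gamma> \<bullet> e l = coeff \<Gamma> (l - 1)" if "l \<in> {1..N+1}" for \<Gamma> l
  proof -
    have "X \<Gamma> \<bullet> e l = (\<Sum>k=1..N+1. if k = l then coeff \<Gamma> (k - 1) else 0)"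
      unfolding X_def inner_sum_left inner_scaleR_left by (intro sum.cong refl) (use Ee that in auto)
    then show ?thesis using that by (simp only: sum.delta finite_atLeastAtMost if_True)
  qed
  have Xf: "X \<Gamma> \<bullet> f j = 0" if "j \<in> {1..N}" for \<Gamma> j
    unfolding X_def inner_sum_left inner_scaleR_left by (intro sum.neutral ballI) (use Ef that in auto)
  have Xlin: "X (\<Gamma> + \<Gamma>') = X \<Gamma> + X \<Gamma>'" "X (smult r \<Gamma>) = r *\<^sub>R X \<Gamma>" for \<Gamma> \<Gamma>' r
    unfolding X_def by (simp_all add: scaleR_add_left sum.distrib scaleR_sum_right del: sum.cl_ivl_Suc)
  define v1 where "v1 k = y1 \<bullet> E k" for k
  define v2 where "v2 k = y2 \<bullet> E k" for k
  have yX: "y1 \<bullet> X \<Gamma> = coeff_fun (N + 1) v1 \<Gamma>" "y2 \<bullet> X \<Gamma> = coeff_fun (N + 1) v2 \<Gamma>" for \<Gamma>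
    unfolding X_def coeff_fun_def v1_def v2_def inner_sum_right inner_scaleR_right
    by (intro sum.cong refl; rule mult.commute)+
  have base: "\<omega>1 y1 w + \<omega>2 y2 w = (v1 j0 + v2 (j0 + 1)) / q j0"
    unfolding v1_def v2_def using E1[OF functional_in_D(1) j0(1)] E2[OF functional_in_D(2) j0(1)]
    by (simp add: w_def alternating_add[OF alt(1)] alternating_add[OF alt(2)] inner_commute add_divide_distrib)
  have XS: "(X \<Gamma>1, X \<Gamma>2) \<in> slice"
    if "degree \<Gamma>1 \<le> N" "degree \<Gamma>2 \<le> N"
      "\<And>g \<mu>. degree g < N \<Longrightarrow> [:1, - \<mu>:] * g + smult (ccoeff_fun N q g) (cpoly \<Gamma>1 - smult \<mu> (cpoly \<Gamma>2)) = 0 \<Longrightarrow> g = 0"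
      "\<And>g. degree g < N \<Longrightarrow> [:0, 1:] * g + smult (ccoeff_fun N q g) (cpoly \<Gamma>2) = 0 \<Longrightarrow> g = 0" for \<Gamma>1 \<Gamma>2
    unfolding slice_def using nf_pair_of_injective_pencil[OF alt D N t \<theta>e Xe Xf Xe Xf, of \<Gamma>1 \<Gamma>2] that
    unfolding q_def by simp
  have "v1 j0 + v2 (j0 + 1) = 0"
  proof (cases "odd N")
    case True
    then obtain n where n: "N = 2 * n + 1" by (rule oddE)
    obtain c d where cd: "d \<noteq> 0" "coeff_fun (2 * n + 1) q (quad c d ^ n) \<noteq> 0"
      using exists_quad_power_odd[of j0 n q] j0 n by metis
    define H where "H = quad c d ^ n"
    define b0 where "b0 = monom (1 / q j0) (j0 - 1)"
    have b0: "coeff_fun (2 * n + 1) q b0 = 1" "degree b0 < 2 * n + 1"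
    proof -
      have "coeff_fun (2 * n + 1) q b0 = (\<Sum>j=1..2*n+1. if j = j0 then 1 else 0)"
        unfolding coeff_fun_def b0_def by (intro sum.cong refl) (use j0 in \<open>auto simp: coeff_monom\<close>)
      also have "\<dots> = 1" using j0(1) n by (simp only: sum.delta finite_atLeastAtMost if_True)
      finally show "coeff_fun (2 * n + 1) q b0 = 1" .
      show "degree b0 < 2 * n + 1"
        unfolding b0_def using j0(1) n by (intro le_less_trans[OF degree_monom_le]) auto
    qed
    define P1 where "P1 = [:c, -1:] * H"
    define P2 where "P2 = [:c\<^sup>2 + d\<^sup>2, - c:] * H"
    have deg: "degree P1 \<le> N" "degree P2 \<le> N" "degree b0 \<le> N" "degree ([:0, 1:] * b0) \<le> N"
      using degree_mult_le[of "[:c, -1:]" H] degree_mult_le[of "[:c\<^sup>2 + d\<^sup>2, - c:]" H]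
        degree_mult_le[of "[:0, 1:]" b0] b0(2) n quad_power_monic(1)[of c d n]
        degree_pCons_le[of "c\<^sup>2 + d\<^sup>2" "[:- c:]"]
      unfolding P1_def P2_def H_def by (simp_all del: mult_pCons_left)
    have mem: "(X (smult \<tau> P1 + smult \<sigma> b0), X (smult \<tau> P2 + smult \<sigma> ([:0, 1:] * b0))) \<in> slice" if \<tau>: "\<tau> \<noteq> 0" for \<tau> \<sigma>
    proof (rule XS)
      show "degree (smult \<tau> P1 + smult \<sigma> b0) \<le> N" "degree (smult \<tau> P2 + smult \<sigma> ([:0, 1:] * b0)) \<le> N"
        by (intro degree_add_le order_trans[OF degree_smult_le] deg)+
      show "g = 0" if "degree g < N" "[:1, - \<mu>:] * g + smult (ccoeff_fun N q g) (cpoly (smult \<tau> P1 + smult \<sigma> b0) -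
          smult \<mu> (cpoly (smult \<tau> P2 + smult \<sigma> ([:0, 1:] * b0)))) = 0" for g \<mu>
        using odd_pencil_injective(1)[OF cd(1) \<tau> cd(2) b0, where g = g and \<sigma> = \<sigma> and \<mu> = \<mu>] that unfolding P1_def P2_def H_def n by blast
      show "g = 0" if "degree g < N" "[:0, 1:] * g + smult (ccoeff_fun N q g)
          (cpoly (smult \<tau> P2 + smult \<sigma> ([:0, 1:] * b0))) = 0" for g
        using odd_pencil_injective(2)[OF cd(1) \<tau> cd(2) b0, where g = g and \<sigma> = \<sigma>] that unfolding P1_def P2_def H_def n by blast
    qed
    have "(X P1, X P2) \<in> zero_component"
    proof -
      have "0 + 1 *\<^sub>R (X P1, X P2) \<in> zero_component"
      proof (rule ray_in_component[OF zero_in_component])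
        fix s :: real
        show "0 + s *\<^sub>R (X P1, X P2) \<in> slice"
          using mem[of s 0] zero_in_slice by (cases "s = 0") (simp_all add: Xlin flip: zero_prod_def)
      qed simp
      then show ?thesis by simp
    qed
    then have "(y1, y2) \<bullet> (X b0, X ([:0, 1:] * b0)) = 0"
    proof (rule bounded_line)
      fix s :: real
      show "(X P1, X P2) + s *\<^sub>R (X b0, X ([:0, 1:] * b0)) \<in> slice"
        using mem[of 1 s] by (simp add: Xlin del: mult_pCons_left)
    qed
    moreover have "coeff_fun (N + 1) v1 b0 = v1 j0 / q j0"
    proof -
      have "coeff_fun (N + 1) v1 b0 = (\<Sum>j=1..N+1. if j = j0 then v1 j0 / q j0 else 0)"
        unfolding coeff_fun_def b0_def by (intro sum.cong refl) (use j0 in \<open>auto simp: coeff_monom\<close>)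
      then show ?thesis using j0(1) by (simp only: sum.delta finite_atLeastAtMost) simp
    qed
    moreover have "coeff_fun (N + 1) v2 ([:0, 1:] * b0) = v2 (j0 + 1) / q j0"
    proof -
      have "[:0, 1:] * b0 = monom (1 / q j0) j0"
        unfolding b0_def using j0(1) by (cases j0) (simp_all add: monom_Suc)
      then have "coeff_fun (N + 1) v2 ([:0, 1:] * b0) = (\<Sum>j=1..N+1. if j = j0 + 1 then v2 (j0 + 1) / q j0 else 0)"
        unfolding coeff_fun_def by (intro sum.cong) (auto simp: coeff_monom)
      then show ?thesis using j0(1) by (simp only: sum.delta finite_atLeastAtMost) simp
    qed
    ultimately have "(v1 j0 + v2 (j0 + 1)) / q j0 = 0" by (simp add: yX add_divide_distrib)
    then show ?thesis using j0(2) by simp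
  next
    case False
    then obtain n where n: "N = 2 * n" by (metis evenE)
    have n1: "n \<ge> 1" using N n by simp
    have "v1 k = 0 \<and> v2 k = 0" if k: "k \<in> {1..2 * n + 1}" for k
    proof (rule quad_powers_separate_even[where q = q and n = n and ?k0.0 = j0 and ?v1.0 = v1 and ?v2.0 = v2])
      show "1 \<le> n" "q j0 \<noteq> 0" "k \<in> {1..2 * n + 1}" by (fact n1 j0(2) k)+
      show "j0 \<in> {1..2 * n}" using j0 n by simp
      fix c d c1 c2 :: real
      assume d: "d \<noteq> 0" and ne: "c1 * coeff_fun (2 * n) q (pCons 0 (quad c d ^ (n - 1))) \<noteq> c2 * coeff_fun (2 * n) q (quad c d ^ (n - 1))"
      define H where "H = quad c d ^ n"
      have degH: "degree H = N" by (simp add: H_def quad_power_monic n)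
      have "(y1, y2) \<bullet> (c1 *\<^sub>R X H, c2 *\<^sub>R X H) = 0"
      proof (rule bounded_line[OF zero_in_component])
        fix s :: real
        have "(X (smult (s * c1) H), X (smult (s * c2) H)) \<in> slice"
        proof (rule XS)
          show "degree (smult (s * c1) H) \<le> N" "degree (smult (s * c2) H) \<le> N"
            using degree_smult_le[of _ H] degH by metis+
          show "g = 0" if "degree g < N" "[:1, - \<mu>:] * g + smult (ccoeff_fun N q g) (cpoly (smult (s * c1) H) -
              smult \<mu> (cpoly (smult (s * c2) H))) = 0" for g \<mu>
            using even_pencil_injective(1)[OF n1 d _ ne, where g = g and \<mu> = \<mu> and \<tau> = s] that unfolding H_def n by blast
          show "g = 0" if "degree g < N" "[:0, 1:] * g + smult (ccoeff_fun N q g) (cpoly (smult (s * c2) H)) = 0" for g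
            using even_pencil_injective(2)[OF n1 d _ ne, where g = g and \<tau> = s] that unfolding H_def n by blast
        qed
        then show "0 + s *\<^sub>R (c1 *\<^sub>R X H, c2 *\<^sub>R X H) \<in> slice" by (simp add: Xlin)
      qed
      then show "c1 * coeff_fun (2 * n + 1) v1 (quad c d ^ n) + c2 * coeff_fun (2 * n + 1) v2 (quad c d ^ n) = 0"
        by (simp add: yX H_def n)
    qed
    then show ?thesis using j0(1) n by simp
  qed
  then show ?thesis using functional_zero_if_base[OF w] base by simp
qed

lemma functional_eq_0: "y1 = 0 \<and> y2 = 0"
  using functional_zero_regular functional_zero_singular by blast

end

theorem convex_hull_component: "convex hull zero_component = UNIV"
proof (rule ccontr)
  assume "convex hull zero_component \<noteq> UNIV"
  then obtain z where z: "z \<notin> convex hull zero_component" by blast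
  define T where "T = (\<lambda>x. z - x) ` (convex hull zero_component)"
  have "convex T" unfolding T_def
    using convex_affinity[OF convex_convex_hull[of zero_component], of z "-1"] by simp
  moreover have "0 \<notin> T" using z by (auto simp: T_def)
  ultimately obtain a where a: "a \<noteq> 0" "\<forall>x\<in>T. 0 \<le> inner a x"
    using separating_hyperplane_set_0 by blast
  obtain y1 y2 where y: "a = (y1, y2)" by (cases a)
  have "(y1, y2) \<bullet> x \<le> a \<bullet> z" if "x \<in> zero_component" for x
  proof -
    have "z - x \<in> T" unfolding T_def using hull_inc[OF that] by blast
    then have "0 \<le> a \<bullet> (z - x)" using a(2) by blast
    then show ?thesis using y by (simp add: inner_diff_right)
  qed
  from functional_eq_0[OF this] show False using a(1) y by (simp add: zero_prod_def)
qed

end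

section \<open>Smooth maps\<close>

lemma frechet_derivative_cong:
  assumes "open S" "x \<in> S" "\<And>y. y \<in> S \<Longrightarrow> f y = g y"
  shows "(f has_derivative F) (at x) \<longleftrightarrow> (g has_derivative F) (at x)"
    "frechet_derivative f (at x) = frechet_derivative g (at x)"
proof -
  show 1: "(f has_derivative F) (at x) \<longleftrightarrow> (g has_derivative F) (at x)" for F
    using has_derivative_transform_within_open[OF _ assms(1,2), of f F UNIV g]
      has_derivative_transform_within_open[OF _ assms(1,2), of g F UNIV f] assms(3) by auto
  show "frechet_derivative f (at x) = frechet_derivative g (at x)"
    unfolding frechet_derivative_def 1 ..
qed

lemma Ck_on_cong:
  assumes "open S" "\<And>y. y \<in> S \<Longrightarrow> f y = g y" "Ck_on k S f"
  shows "Ck_on k S g"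
  using assms(2,3)
proof (induction k arbitrary: f g)
  case 0
  then show ?case by (simp add: continuous_on_cong[of S S f g])
next
  case (Suc k)
  have "g differentiable (at x)" if x: "x \<in> S" for x
  proof -
    obtain F where "(f has_derivative F) (at x)" using Suc.prems(2) x by (auto simp: differentiable_def)
    then have "(g has_derivative F) (at x)"
      using frechet_derivative_cong(1)[OF assms(1) that, of f g F] Suc.prems(1) by simp
    then show ?thesis by (rule differentiableI)
  qed
  moreover have "Ck_on k S (\<lambda>x. frechet_derivative g (at x) v)" for v
  proof (rule Suc.IH)
    show "Ck_on k S (\<lambda>x. frechet_derivative f (at x) v)" using Suc.prems by simp
    show "frechet_derivative f (at x) v = frechet_derivative g (at x) v" if "x \<in> S" for x
      using frechet_derivative_cong(2)[OF assms(1) that, of f g] Suc.prems(1) by simp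
  qed
  ultimately show ?case by simp
qed

lemma Ck_on_affine_compose:
  assumes "open S" "bounded_linear T" "Ck_on k S f"
  shows "Ck_on k S (\<lambda>x. c + T (f x))"
  using assms(3)
proof (induction k arbitrary: f c)
  case 0
  then show ?case
    by (auto intro!: continuous_intros bounded_linear.continuous_on[OF assms(2)])
next
  case (Suc k)
  have d: "((\<lambda>x. c + T (f x)) has_derivative (\<lambda>v. T (frechet_derivative f (at x) v))) (at x)" if "x \<in> S" for x
  proof -
    have "(f has_derivative frechet_derivative f (at x)) (at x)"
      using Suc.prems that by (simp add: frechet_derivative_works)
    then have "((\<lambda>x. T (f x)) has_derivative (\<lambda>v. T (frechet_derivative f (at x) v))) (at x)"
      by (rule bounded_linear.has_derivative[OF assms(2)])
    from has_derivative_add[OF has_derivative_const this, of c] show ?thesis by simp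
  qed
  have "Ck_on k S (\<lambda>x. frechet_derivative (\<lambda>x. c + T (f x)) (at x) v)" for v
  proof (rule Ck_on_cong[OF assms(1)])
    show "Ck_on k S (\<lambda>x. 0 + T (frechet_derivative f (at x) v))" using Suc.prems by (intro Suc.IH) simp
    show "0 + T (frechet_derivative f (at x) v) = frechet_derivative (\<lambda>x. c + T (f x)) (at x) v" if "x \<in> S" for x
      using frechet_derivative_at[OF d[OF that]] by (simp add: fun_eq_iff)
  qed
  moreover have "(\<lambda>x. c + T (f x)) differentiable (at x)" if "x \<in> S" for x
    using d[OF that] by (auto simp: differentiable_def)
  ultimately show ?case by simp
qed

lemma Ck_on_const: "Ck_on k S (\<lambda>_. c)"
  by (induction k arbitrary: c) (simp_all add: frechet_derivative_const)

lemma Ck_on_ident: "Ck_on k S (\<lambda>x. x)"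
proof (cases k)
  case (Suc k')
  have "frechet_derivative (\<lambda>x. x) (at x) = (\<lambda>v. v)" for x :: 'a
    using frechet_derivative_at[OF has_derivative_ident, of x] by simp
  then show ?thesis by (simp add: Suc Ck_on_const)
qed simp

lemma smooth_on_affine:
  assumes "open S" "bounded_linear T"
  shows "smooth_on S (\<lambda>x. c + T x)"
  unfolding smooth_on_def using Ck_on_affine_compose[OF assms Ck_on_ident] by blast

lemma smooth_on_affine_compose:
  assumes "open S" "bounded_linear T" "smooth_on S f"
  shows "smooth_on S (\<lambda>x. c + T (f x))"
  using Ck_on_affine_compose[OF assms(1,2)] assms(3) unfolding smooth_on_def by blast

lemma smooth_on_cong:
  assumes "open S" "\<And>y. y \<in> S \<Longrightarrow> f y = g y" "smooth_on S f"
  shows "smooth_on S g"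
  using Ck_on_cong[OF assms(1), of f g] assms(2,3) unfolding smooth_on_def by blast

lemma smooth_on_has_derivative:
  assumes "smooth_on S f" "x \<in> S"
  shows "(f has_derivative frechet_derivative f (at x)) (at x)"
proof -
  have "Ck_on (Suc 0) S f" using assms(1) unfolding smooth_on_def by blast
  then show ?thesis using assms(2) by (simp add: frechet_derivative_works)
qed

section \<open>Charts\<close>

locale atlas =
  fixes \<A> :: "('m::{t2_space,second_countable_topology}, 'e::euclidean_space) chart set"
  assumes smooth: "smooth_atlas \<A>"
begin

lemma chart_at_mem: "chart_at \<A> q \<in> \<A>" "q \<in> fst (chart_at \<A> q)"
proof -
  have "\<exists>c. c \<in> \<A> \<and> q \<in> fst c" using smooth unfolding smooth_atlas_def by blast
  then have "chart_at \<A> q \<in> \<A> \<and> q \<in> fst (chart_at \<A> q)" unfolding chart_at_def by (rule someI_ex)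
  then show "chart_at \<A> q \<in> \<A>" "q \<in> fst (chart_at \<A> q)" by auto
qed

lemma chart_homeomorphism:
  assumes "c \<in> \<A>"
  shows "\<exists>\<psi>. homeomorphism (fst c) (snd c ` fst c) (snd c) \<psi>"
proof -
  have "case c of (U, \<phi>) \<Rightarrow> open U \<and> open (\<phi> ` U) \<and> (\<exists>\<psi>. homeomorphism U (\<phi> ` U) \<phi> \<psi>)"
    using smooth assms unfolding smooth_atlas_def by blast
  then show ?thesis by (simp add: case_prod_beta)
qed

lemma chart_open:
  assumes "c \<in> \<A>"
  shows "open (fst c)" "open (snd c ` fst c)"
proof -
  have "case c of (U, \<phi>) \<Rightarrow> open U \<and> open (\<phi> ` U) \<and> (\<exists>\<psi>. homeomorphism U (\<phi> ` U) \<phi> \<psi>)"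
    using smooth assms unfolding smooth_atlas_def by blast
  then show "open (fst c)" "open (snd c ` fst c)" by (simp_all add: case_prod_beta)
qed

lemma chart_inj: "c \<in> \<A> \<Longrightarrow> inj_on (snd c) (fst c)"
  using chart_homeomorphism[of c] by (auto simp: homeomorphism_def intro: inj_on_inverseI)

lemma chart_inv_apply: "c \<in> \<A> \<Longrightarrow> p \<in> fst c \<Longrightarrow> chart_inv c (snd c p) = p"
  by (simp add: chart_inj inv_into_f_f)

lemma chart_image_open:
  assumes "c \<in> \<A>" "open W" "W \<subseteq> fst c"
  shows "open (snd c ` W)"
proof -
  obtain \<psi> where h: "homeomorphism (fst c) (snd c ` fst c) (snd c) \<psi>" using chart_homeomorphism[OF assms(1)] by (elim exE)
  have "openin (top_of_set (fst c)) W" using assms(2,3) by (simp add: open_subset)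
  then have "openin (top_of_set (snd c ` fst c)) (snd c ` W)" by (rule homeomorphism_imp_open_map[OF h])
  then show ?thesis using chart_open(2)[OF assms(1)] by (simp add: openin_open_eq)
qed

lemma transition_has_derivative:
  assumes "c \<in> \<A>" "d \<in> \<A>" "p \<in> fst c" "p \<in> fst d"
  shows "(snd d \<circ> chart_inv c has_derivative frechet_derivative (snd d \<circ> chart_inv c) (at (snd c p))) (at (snd c p))"
proof (rule smooth_on_has_derivative)
  show "smooth_on (snd c ` (fst c \<inter> fst d)) (snd d \<circ> chart_inv c)"
    using smooth assms unfolding smooth_atlas_def by blast
qed (use assms in auto)

lemma transition_inverse:
  assumes c: "c \<in> \<A>" and d: "d \<in> \<A>" and p: "p \<in> fst c" "p \<in> fst d"
  shows "frechet_derivative (snd d \<circ> chart_inv c) (at (snd c p)) (frechet_derivative (snd c \<circ> chart_inv d) (at (snd d p)) v) = v"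
proof -
  let ?F = "frechet_derivative (snd d \<circ> chart_inv c) (at (snd c p))"
  let ?G = "frechet_derivative (snd c \<circ> chart_inv d) (at (snd d p))"
  have G: "(snd c \<circ> chart_inv d has_derivative ?G) (at (snd d p))"
    by (rule transition_has_derivative[OF d c p(2,1)])
  have "(snd d \<circ> chart_inv c has_derivative ?F) (at ((snd c \<circ> chart_inv d) (snd d p)))"
    using transition_has_derivative[OF c d p] by (simp add: chart_inv_apply d p)
  from diff_chain_at[OF G this]
  have 1: "((snd d \<circ> chart_inv c) \<circ> (snd c \<circ> chart_inv d) has_derivative ?F \<circ> ?G) (at (snd d p))" .
  have op: "open (snd d ` (fst c \<inter> fst d))"
    by (rule chart_image_open[OF d]) (auto simp: chart_open c d)
  have "((\<lambda>y. y) has_derivative ?F \<circ> ?G) (at (snd d p))"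
    by (rule has_derivative_transform_within_open[OF 1 op]) (auto simp: p chart_inv_apply c d)
  then have "?F \<circ> ?G = (\<lambda>v. v)" by (rule has_derivative_unique[OF _ has_derivative_ident])
  then show ?thesis by (simp add: fun_eq_iff)
qed

lemma chart_diff_apply:
  assumes "c \<in> \<A>" "p \<in> fst c"
  shows "blinfun_apply (chart_diff \<A> c p) = frechet_derivative (snd c \<circ> chart_inv (chart_at \<A> p)) (at (coord_at \<A> p))"
    "blinfun_apply (chart_diff_inv \<A> c p) = frechet_derivative (snd (chart_at \<A> p) \<circ> chart_inv c) (at (snd c p))"
  unfolding chart_diff_def chart_diff_inv_def coord_at_def
  using transition_has_derivative[OF chart_at_mem(1) assms(1) chart_at_mem(2) assms(2)]
    transition_has_derivative[OF assms(1) chart_at_mem(1) assms(2) chart_at_mem(2)]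
  by (auto simp: bounded_linear_Blinfun_apply has_derivative_bounded_linear)

lemma chart_diff_inverse:
  assumes "c \<in> \<A>" "p \<in> fst c"
  shows "blinfun_apply (chart_diff \<A> c p) (blinfun_apply (chart_diff_inv \<A> c p) v) = v"
    "blinfun_apply (chart_diff_inv \<A> c p) (blinfun_apply (chart_diff \<A> c p) v) = v"
  unfolding chart_diff_apply[OF assms] coord_at_def
  using transition_inverse[OF chart_at_mem(1) assms(1) chart_at_mem(2) assms(2)]
    transition_inverse[OF assms(1) chart_at_mem(1) assms(2) chart_at_mem(2)] by auto

lemma chart_diff_self:
  "blinfun_apply (chart_diff \<A> (chart_at \<A> q) q) v = v"
  "blinfun_apply (chart_diff_inv \<A> (chart_at \<A> q) q) v = v"
proof -
  let ?c = "chart_at \<A> q"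
  have op: "open (snd ?c ` fst ?c)" by (rule chart_open(2)[OF chart_at_mem(1)])
  have "((\<lambda>y. y) has_derivative frechet_derivative (snd ?c \<circ> chart_inv ?c) (at (snd ?c q))) (at (snd ?c q))"
    by (rule has_derivative_transform_within_open[OF
          transition_has_derivative[OF chart_at_mem(1) chart_at_mem(1) chart_at_mem(2) chart_at_mem(2)] op])
      (auto simp: chart_at_mem chart_inv_apply)
  then have "frechet_derivative (snd ?c \<circ> chart_inv ?c) (at (snd ?c q)) = (\<lambda>v. v)"
    by (rule has_derivative_unique[OF _ has_derivative_ident])
  then show "blinfun_apply (chart_diff \<A> ?c q) v = v" "blinfun_apply (chart_diff_inv \<A> ?c q) v = v"
    by (simp_all add: chart_diff_apply chart_at_mem coord_at_def)
qed

end

section \<open>The Grassmannian chart\<close>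

lemma orthogonal_comp_iff: "w \<in> D\<^sup>\<bottom> \<longleftrightarrow> (\<forall>u\<in>D. u \<bullet> w = 0)"
  by (simp add: orthogonal_comp_def orthogonal_def)

lemma orthogonal_splitting:
  fixes D :: "'a::euclidean_space set"
  assumes "subspace D"
  shows "\<exists>P. linear P \<and> (\<forall>u. P u \<in> D) \<and> (\<forall>u. u - P u \<in> D\<^sup>\<bottom>) \<and> (\<forall>u\<in>D. P u = u) \<and> (\<forall>u\<in>D\<^sup>\<bottom>. P u = 0)"
proof -
  obtain B where B: "finite B" "B \<subseteq> D"
    and rep: "\<And>g v. linear (g :: 'a \<Rightarrow> real) \<Longrightarrow> v \<in> D \<Longrightarrow> (\<Sum>b\<in>B. g b *\<^sub>R b) \<bullet> v = g v"
    using orthonormal_rep[OF assms] by metis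
  define P where "P u = (\<Sum>b\<in>B. (u \<bullet> b) *\<^sub>R b)" for u
  have lin: "linear P" unfolding P_def
    by (rule linearI) (simp_all add: inner_add_left scaleR_add_left sum.distrib scaleR_sum_right)
  have PD: "P u \<in> D" for u
    unfolding P_def by (intro subspace_sum subspace_mul assms) (use B in auto)
  have Pv: "P u \<bullet> v = u \<bullet> v" if "v \<in> D" for u v
    unfolding P_def by (rule rep[OF _ that]) (simp add: linear_iff inner_add_right)
  have perp: "u - P u \<in> D\<^sup>\<bottom>" for u
    using Pv by (auto simp: orthogonal_comp_iff inner_diff_right inner_commute)
  have "P u = u" if "u \<in> D" for u
  proof -
    have "u - P u \<in> D" using PD that assms by (simp add: subspace_diff)
    then have "(u - P u) \<bullet> (u - P u) = 0" using perp[of u] by (auto simp: orthogonal_comp_iff)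
    then show ?thesis by simp
  qed
  moreover have "P u = 0" if "u \<in> D\<^sup>\<bottom>" for u
    using Pv[OF PD[of u], of u] that PD[of u] by (auto simp: orthogonal_comp_iff inner_commute)
  ultimately show ?thesis using lin PD perp by (intro exI[of _ P]) simp
qed

lemma subspace_Int_perp:
  assumes "u \<in> D" "u \<in> D\<^sup>\<bottom>" shows "u = 0"
  using assms by (auto simp: orthogonal_comp_iff)

lemma subspace_perp: "subspace (D\<^sup>\<bottom>)"
  by (auto simp: subspace_def orthogonal_comp_iff inner_add_right)

lemma graph_over_inj:
  fixes D :: "'a::euclidean_space set"
  assumes D: "subspace D" and B: "B \<in> Hom_perp D" "B' \<in> Hom_perp D" and g: "graph_over D B = graph_over D B'"
  shows "B = B'"
proof (rule blinfun_eqI)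
  fix v
  have on_D: "blinfun_apply B u = blinfun_apply B' u" if u: "u \<in> D" for u
  proof -
    have "u + blinfun_apply B u \<in> graph_over D B'" using g u by (auto simp: graph_over_def)
    then obtain u' where u': "u' \<in> D" "u + blinfun_apply B u = u' + blinfun_apply B' u'"
      by (auto simp: graph_over_def)
    have "u - u' = blinfun_apply B' u' - blinfun_apply B u" using u'(2) by (simp add: algebra_simps)
    moreover have "blinfun_apply B' u' - blinfun_apply B u \<in> D\<^sup>\<bottom>"
      using B by (intro subspace_diff subspace_perp) (auto simp: Hom_perp_def)
    moreover have "u - u' \<in> D" using u u' D by (simp add: subspace_diff)
    ultimately have "u - u' = 0" using subspace_Int_perp by metis
    then show ?thesis using u'(2) by simp
  qed
  obtain P where P: "\<forall>u. P u \<in> D" "\<forall>u. u - P u \<in> D\<^sup>\<bottom>"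
    using orthogonal_splitting[OF D] by (elim exE conjE)
  have "blinfun_apply B (v - P v) = 0" "blinfun_apply B' (v - P v) = 0"
    using B P(2) by (auto simp: Hom_perp_def)
  then show "blinfun_apply B v = blinfun_apply B' v"
    using on_D[of "P v"] P(1) by (simp add: blinfun.diff_right)
qed

lemma graph_over_zero: "graph_over D 0 = D"
  by (simp add: graph_over_def)

lemma zero_in_Hom_perp: "0 \<in> Hom_perp D"
  by (simp add: Hom_perp_def orthogonal_comp_iff)

lemma subspace_Hom_perp: "subspace (Hom_perp D)"
  using subspace_perp[of D]
  by (auto simp: subspace_def Hom_perp_def blinfun.add_left blinfun.scaleR_left)

lemma graph_over_subspace:
  assumes "subspace D"
  shows "subspace (graph_over D B)" "B \<in> Hom_perp D \<Longrightarrow> dim (graph_over D B) = dim D"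
proof -
  have lin: "linear (\<lambda>u. u + blinfun_apply B u)"
    by (rule linearI) (simp_all add: blinfun.add_right blinfun.scaleR_right scaleR_add_right)
  have eq: "graph_over D B = (\<lambda>u. u + blinfun_apply B u) ` D" by (auto simp: graph_over_def)
  show "subspace (graph_over D B)" unfolding eq by (rule linear_subspace_image[OF lin assms])
  assume B: "B \<in> Hom_perp D"
  have "inj_on (\<lambda>u. u + blinfun_apply B u) (span D)"
  proof (rule inj_onI)
    fix u v assume "u \<in> span D" "v \<in> span D" and uv: "u + blinfun_apply B u = v + blinfun_apply B v"
    then have D': "u - v \<in> D" using assms by (metis span_eq_iff subspace_diff)
    have "u - v = blinfun_apply B v - blinfun_apply B u" using uv by (simp add: algebra_simps)
    moreover have "blinfun_apply B v - blinfun_apply B u \<in> D\<^sup>\<bottom>"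
      using B by (intro subspace_diff subspace_perp) (auto simp: Hom_perp_def)
    ultimately have "u - v = 0" using D' subspace_Int_perp by metis
    then show "u = v" by simp
  qed
  then show "dim (graph_over D B) = dim D" unfolding eq by (rule dim_image_eq[OF lin])
qed

lemma bilinear_Blinfun_apply:
  fixes g :: "'a::euclidean_space \<Rightarrow> 'a \<Rightarrow> real"
  assumes "bilinear g"
  shows "blinfun_apply (blinfun_apply (Blinfun (\<lambda>u. Blinfun (g u))) u) v = g u v"
proof -
  have 1: "blinfun_apply (Blinfun (g u)) = g u" for u
    using assms by (intro bounded_linear_Blinfun_apply) (simp add: bilinear_def linear_conv_bounded_linear)
  have "linear (\<lambda>u. Blinfun (g u))"
    by (rule linearI; rule blinfun_eqI)
      (simp_all add: 1 blinfun.add_left blinfun.scaleR_left bilinear_ladd[OF assms] bilinear_lmul[OF assms])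
  then show ?thesis
    by (simp add: bounded_linear_Blinfun_apply linear_conv_bounded_linear 1)
qed

lemma blinfun_bilinear: "bilinear (\<lambda>u v. blinfun_apply (blinfun_apply \<omega> u) v)"
  unfolding bilinear_def
  by (intro conjI allI linearI)
    (simp_all add: blinfun.add_left blinfun.add_right blinfun.scaleR_left blinfun.scaleR_right)

section \<open>Alternating forms on a subspace\<close>

lemma alt_forms_eqI:
  fixes D :: "'e::euclidean_space set"
  assumes D: "subspace D" and alt: "\<eta> \<in> alt_forms D" "\<eta>' \<in> alt_forms D"
    and eq: "\<And>u v. u \<in> D \<Longrightarrow> v \<in> D \<Longrightarrow> blinfun_apply (blinfun_apply \<eta> u) v = blinfun_apply (blinfun_apply \<eta>' u) v"
  shows "\<eta> = \<eta>'"
proof -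
  obtain P where P: "\<forall>u. P u \<in> D" "\<forall>u. u - P u \<in> D\<^sup>\<bottom>"
    using orthogonal_splitting[OF D] by (elim exE conjE)
  have red: "blinfun_apply (blinfun_apply \<nu> u) v = blinfun_apply (blinfun_apply \<nu> (P u)) (P v)"
    if \<nu>: "\<nu> \<in> alt_forms D" for \<nu> u v
  proof -
    have z: "blinfun_apply \<nu> (w - P w) = 0" for w using \<nu> P(2) by (simp add: alt_forms_def)
    have anti: "blinfun_apply (blinfun_apply \<nu> x) y = - blinfun_apply (blinfun_apply \<nu> y) x" for x y
    proof -
      have "blinfun_apply (blinfun_apply \<nu> (x + y)) (x + y) = 0" "blinfun_apply (blinfun_apply \<nu> x) x = 0"
        "blinfun_apply (blinfun_apply \<nu> y) y = 0" using \<nu> by (auto simp: alt_forms_def)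
      then show ?thesis by (simp add: blinfun.add_left blinfun.add_right)
    qed
    have "blinfun_apply \<nu> u = blinfun_apply \<nu> (P u)" using z[of u] by (simp add: blinfun.diff_right)
    moreover have "blinfun_apply (blinfun_apply \<nu> (P u)) (v - P v) = 0"
      using anti[of "P u" "v - P v"] z[of v] by simp
    ultimately show ?thesis by (simp add: blinfun.diff_right)
  qed
  show ?thesis
  proof (intro blinfun_eqI)
    fix u v
    have "blinfun_apply (blinfun_apply \<eta> u) v = blinfun_apply (blinfun_apply \<eta> (P u)) (P v)"
      by (rule red[OF alt(1)])
    also have "\<dots> = blinfun_apply (blinfun_apply \<eta>' (P u)) (P v)" by (rule eq) (use P(1) in auto)
    also have "\<dots> = blinfun_apply (blinfun_apply \<eta>' u) v" by (rule red[OF alt(2), symmetric])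
    finally show "blinfun_apply (blinfun_apply \<eta> u) v = blinfun_apply (blinfun_apply \<eta>' u) v" .
  qed
qed

lemma restrict_form_eqI:
  fixes D :: "'e::euclidean_space set"
  assumes "subspace D" "\<eta> \<in> alt_forms D"
    "\<And>u v. u \<in> D \<Longrightarrow> v \<in> D \<Longrightarrow> blinfun_apply (blinfun_apply \<eta> u) v = blinfun_apply (blinfun_apply \<omega> u) v"
  shows "restrict_form D \<omega> = \<eta>"
  unfolding restrict_form_def
proof (rule the_equality)
  show "\<eta> \<in> alt_forms D \<and> (\<forall>u\<in>D. \<forall>v\<in>D. blinfun_apply (blinfun_apply \<eta> u) v = blinfun_apply (blinfun_apply \<omega> u) v)"
    using assms by blast
  fix \<nu> assume "\<nu> \<in> alt_forms D \<and> (\<forall>u\<in>D. \<forall>v\<in>D. blinfun_apply (blinfun_apply \<nu> u) v = blinfun_apply (blinfun_apply \<omega> u) v)"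
  then show "\<nu> = \<eta>" by (intro alt_forms_eqI[OF assms(1)]) (use assms in auto)
qed

lemma restrict_form:
  fixes D :: "'e::euclidean_space set"
  assumes D: "subspace D" and alt: "\<And>u. u \<in> D \<Longrightarrow> blinfun_apply (blinfun_apply \<omega> u) u = 0"
  shows "restrict_form D \<omega> \<in> alt_forms D"
    "u \<in> D \<Longrightarrow> v \<in> D \<Longrightarrow> blinfun_apply (blinfun_apply (restrict_form D \<omega>) u) v = blinfun_apply (blinfun_apply \<omega> u) v"
proof -
  obtain P where P: "linear P" "\<forall>u. P u \<in> D" "\<forall>u\<in>D. P u = u" "\<forall>u\<in>D\<^sup>\<bottom>. P u = 0"
    using orthogonal_splitting[OF D] by (elim exE conjE)
  define \<eta> where "\<eta> = Blinfun (\<lambda>u. Blinfun (\<lambda>v. blinfun_apply (blinfun_apply \<omega> (P u)) (P v)))"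
  have "bilinear (\<lambda>u v. blinfun_apply (blinfun_apply \<omega> (P u)) (P v))"
    unfolding bilinear_def
    by (intro conjI allI linearI)
      (simp_all add: linear_add[OF P(1)] linear_cmul[OF P(1)] blinfun.add_left blinfun.add_right
        blinfun.scaleR_left blinfun.scaleR_right)
  then have \<eta>: "blinfun_apply (blinfun_apply \<eta> u) v = blinfun_apply (blinfun_apply \<omega> (P u)) (P v)" for u v
    unfolding \<eta>_def by (rule bilinear_Blinfun_apply)
  have "\<eta> \<in> alt_forms D"
    unfolding alt_forms_def using alt P by (auto simp: \<eta> intro!: blinfun_eqI)
  then have "restrict_form D \<omega> = \<eta>" by (rule restrict_form_eqI[OF D]) (simp add: \<eta> P)
  then show "restrict_form D \<omega> \<in> alt_forms D"
    "u \<in> D \<Longrightarrow> v \<in> D \<Longrightarrow> blinfun_apply (blinfun_apply (restrict_form D \<omega>) u) v = blinfun_apply (blinfun_apply \<omega> u) v"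
    using \<open>\<eta> \<in> alt_forms D\<close> by (simp_all add: \<eta> P)
qed

section \<open>The dual Levi map of a jet\<close>

text \<open>If \<open>y \<mapsto> \<alpha>\<^sub>y\<close> annihilates the graphs of \<open>B\<^sub>y\<close> and \<open>B\<close> vanishes at \<open>q\<close>, then the derivative of \<open>\<alpha>\<^sub>y v\<close> in the
  direction \<open>u\<close> is \<open>- \<alpha>\<close> applied to the derivative of \<open>B\<^sub>y v\<close>. Antisymmetrising gives this formula.\<close>

definition jet_Levi :: "'e::euclidean_space set \<Rightarrow> ('e \<Rightarrow>\<^sub>L ('e \<times> ('e \<Rightarrow>\<^sub>L 'e))) \<Rightarrow> ('e \<Rightarrow>\<^sub>L real) \<Rightarrow> 'e \<Rightarrow>\<^sub>L 'e \<Rightarrow>\<^sub>L real" where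
  "jet_Levi D j \<alpha> = restrict_form D (Blinfun (\<lambda>u. Blinfun (\<lambda>v. blinfun_apply \<alpha>
     (blinfun_apply (snd (blinfun_apply j v)) u - blinfun_apply (snd (blinfun_apply j u)) v))))"

lemma jet_Levi_apply_aux:
  fixes j :: "'e::euclidean_space \<Rightarrow>\<^sub>L ('e \<times> ('e \<Rightarrow>\<^sub>L 'e))" and \<alpha> :: "'e \<Rightarrow>\<^sub>L real"
  shows "blinfun_apply (blinfun_apply (Blinfun (\<lambda>u. Blinfun (\<lambda>v. blinfun_apply \<alpha>
     (blinfun_apply (snd (blinfun_apply j v)) u - blinfun_apply (snd (blinfun_apply j u)) v)))) u) v =
    blinfun_apply \<alpha> (blinfun_apply (snd (blinfun_apply j v)) u - blinfun_apply (snd (blinfun_apply j u)) v)"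
proof -
  have "bilinear (\<lambda>u v. blinfun_apply \<alpha> (blinfun_apply (snd (blinfun_apply j v)) u - blinfun_apply (snd (blinfun_apply j u)) v))"
    unfolding bilinear_def
    by (intro conjI allI linearI)
      (simp_all add: blinfun.add_left blinfun.add_right blinfun.diff_right blinfun.scaleR_left
        blinfun.scaleR_right algebra_simps)
  from bilinear_Blinfun_apply[OF this, of u v] show ?thesis .
qed

lemma jet_Levi:
  assumes "subspace D"
  shows "jet_Levi D j \<alpha> \<in> alt_forms D"
    "u \<in> D \<Longrightarrow> v \<in> D \<Longrightarrow> blinfun_apply (blinfun_apply (jet_Levi D j \<alpha>) u) v =
      blinfun_apply \<alpha> (blinfun_apply (snd (blinfun_apply j v)) u - blinfun_apply (snd (blinfun_apply j u)) v)"
  unfolding jet_Levi_def using restrict_form[OF assms, of "Blinfun (\<lambda>u. Blinfun (\<lambda>v. blinfun_apply \<alpha>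
     (blinfun_apply (snd (blinfun_apply j v)) u - blinfun_apply (snd (blinfun_apply j u)) v)))"]
  by (auto simp: jet_Levi_apply_aux)

definition admissible :: "'e::euclidean_space set \<Rightarrow> ('e \<Rightarrow>\<^sub>L ('e \<times> ('e \<Rightarrow>\<^sub>L 'e))) \<Rightarrow> bool" where
  "admissible D j \<longleftrightarrow> (\<forall>v. fst (blinfun_apply j v) = v \<and> snd (blinfun_apply j v) \<in> Hom_perp D)"

context atlas
begin

lemma Gr_chart_eq:
  assumes "subspace D0" "B \<in> Hom_perp D0"
    "blinfun_apply (chart_diff \<A> (chart_at \<A> q) p) ` K = graph_over D0 B"
  shows "Gr_chart \<A> (q, D0) (p, K) = (snd (chart_at \<A> q) p, B)"
proof -
  have "(THE B. B \<in> Hom_perp D0 \<and> blinfun_apply (chart_diff \<A> (chart_at \<A> q) p) ` K = graph_over D0 B) = B"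
  proof (rule the_equality)
    fix B' assume B': "B' \<in> Hom_perp D0 \<and> blinfun_apply (chart_diff \<A> (chart_at \<A> q) p) ` K = graph_over D0 B'"
    have "graph_over D0 B' = graph_over D0 B" by (rule trans[OF conjunct2[OF B', symmetric] assms(3)])
    then show "B' = B" by (rule graph_over_inj[OF assms(1) conjunct1[OF B'] assms(2)])
  qed (intro conjI assms)
  then show ?thesis by (simp add: Gr_chart_def)
qed

definition graph_chart :: "'m \<Rightarrow> ('m \<Rightarrow> 'e set) \<Rightarrow> 'e set \<Rightarrow> bool" where
  "graph_chart q D' Y \<longleftrightarrow> open Y \<and> coord_at \<A> q \<in> Y \<and> Y \<subseteq> snd (chart_at \<A> q) ` fst (chart_at \<A> q) \<and>
    smooth_on Y (section_rep \<A> q D') \<and>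
    (\<forall>y\<in>Y. fst (section_rep \<A> q D' y) = y \<and> snd (section_rep \<A> q D' y) \<in> Hom_perp (D' q) \<and>
      blinfun_apply (chart_diff \<A> (chart_at \<A> q) (chart_inv (chart_at \<A> q) y)) ` D' (chart_inv (chart_at \<A> q) y)
        = graph_over (D' q) (snd (section_rep \<A> q D' y)))"

lemma local_distribution_rep:
  assumes ld: "local_distribution \<A> k q D'"
  shows "\<exists>Y. graph_chart q D' Y"
    "subspace (D' q)" "dim (D' q) = k" "snd (section_rep \<A> q D' (coord_at \<A> q)) = 0"
proof -
  let ?c = "chart_at \<A> q"
  obtain W where W0: "open W" "q \<in> W" "W \<subseteq> fst ?c"
    "\<forall>p\<in>W. (p, D' p) \<in> Gr_bundle k \<inter> Gr_chart_domain \<A> (q, D' q)"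
    "smooth_on (snd ?c ` W) (section_rep \<A> q D')"
    using ld unfolding local_distribution_def by (elim exE conjE)
  note W = W0(1-3) bspec[OF W0(4)] W0(5)
  show D: "subspace (D' q)" "dim (D' q) = k" using W(4)[OF W(2)] by (auto simp: Gr_bundle_def)
  have rep: "fst (section_rep \<A> q D' y) = y \<and> snd (section_rep \<A> q D' y) \<in> Hom_perp (D' q) \<and>
      blinfun_apply (chart_diff \<A> ?c (chart_inv ?c y)) ` D' (chart_inv ?c y)
        = graph_over (D' q) (snd (section_rep \<A> q D' y))" if y: "y \<in> snd ?c ` W" for y
  proof -
    obtain p where p: "p \<in> W" "y = snd ?c p" using y by blast
    have pc: "p \<in> fst ?c" using W(3) p by blast
    have inv: "chart_inv ?c y = p" using chart_inv_apply[OF chart_at_mem(1) pc] p(2) by simp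
    obtain B where B: "B \<in> Hom_perp (D' q)" "blinfun_apply (chart_diff \<A> ?c p) ` D' p = graph_over (D' q) B"
      using W(4)[OF p(1)] by (auto simp: Gr_chart_domain_def)
    have "section_rep \<A> q D' y = (y, B)"
      using Gr_chart_eq[OF D(1) B] by (simp add: section_rep_def inv p(2)[symmetric] Let_def)
    then show ?thesis using B by (simp add: inv)
  qed
  have y0: "coord_at \<A> q \<in> snd ?c ` W" using W(2) by (simp add: coord_at_def)
  show "\<exists>Y. graph_chart q D' Y"
    unfolding graph_chart_def
    by (rule exI[of _ "snd ?c ` W"], intro conjI ballI chart_image_open chart_at_mem W y0 image_mono)
      (use rep in auto)
  have "chart_inv ?c (coord_at \<A> q) = q"
    by (simp add: coord_at_def chart_inv_apply chart_at_mem)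
  then have "D' q = graph_over (D' q) (snd (section_rep \<A> q D' (coord_at \<A> q)))"
    using rep[OF y0] chart_diff_self(1)[of q] by simp
  then have "graph_over (D' q) (snd (section_rep \<A> q D' (coord_at \<A> q))) = graph_over (D' q) 0"
    by (simp add: graph_over_zero)
  then show "snd (section_rep \<A> q D' (coord_at \<A> q)) = 0"
    using graph_over_inj[OF D(1) _ zero_in_Hom_perp] rep[OF y0] by blast
qed

lemma section_diff:
  assumes ld: "local_distribution \<A> k q D'"
  shows "(section_rep \<A> q D' has_derivative blinfun_apply (section_diff \<A> q D')) (at (coord_at \<A> q))"
    "admissible (D' q) (section_diff \<A> q D')"
proof -
  let ?y0 = "coord_at \<A> q" and ?s = "section_rep \<A> q D'" and ?J = "blinfun_apply (section_diff \<A> q D')"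
  obtain Y where Y0: "graph_chart q D' Y" using local_distribution_rep(1)[OF ld] ..
  have Y: "open Y" "?y0 \<in> Y" "smooth_on Y ?s"
    "\<And>y. y \<in> Y \<Longrightarrow> fst (?s y) = y" "\<And>y. y \<in> Y \<Longrightarrow> snd (?s y) \<in> Hom_perp (D' q)"
    using Y0 by (simp_all add: graph_chart_def)
  have "(?s has_derivative frechet_derivative ?s (at ?y0)) (at ?y0)"
    by (rule smooth_on_has_derivative[OF Y(3,2)])
  then show J: "(?s has_derivative ?J) (at ?y0)"
    unfolding section_diff_def by (simp add: bounded_linear_Blinfun_apply has_derivative_bounded_linear)
  have const: "T (?J v) = 0" if T: "bounded_linear T" and z: "\<And>y. y \<in> Y \<Longrightarrow> T (?s y) = 0"
    for T :: "'e \<times> ('e \<Rightarrow>\<^sub>L 'e) \<Rightarrow> 'b::real_normed_vector" and v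
  proof -
    have "((\<lambda>y. T (?s y)) has_derivative (\<lambda>v. T (?J v))) (at ?y0)"
      by (rule bounded_linear.has_derivative[OF T J])
    then have "((\<lambda>y. 0) has_derivative (\<lambda>v. T (?J v))) (at ?y0)"
      by (rule has_derivative_transform_within_open[OF _ Y(1,2)]) (rule z)
    then have "(\<lambda>v. T (?J v)) = (\<lambda>v. 0)" by (rule has_derivative_unique[OF _ has_derivative_const])
    then show ?thesis by (simp add: fun_eq_iff)
  qed
  have "fst (?J v) = v" for v
  proof -
    have "((\<lambda>y. fst (?s y)) has_derivative (\<lambda>v. fst (?J v))) (at ?y0)" by (rule has_derivative_fst[OF J])
    then have "((\<lambda>y. y) has_derivative (\<lambda>v. fst (?J v))) (at ?y0)"
      by (rule has_derivative_transform_within_open[OF _ Y(1,2)]) (rule Y(4))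
    then have "(\<lambda>v. fst (?J v)) = (\<lambda>v. v)" by (rule has_derivative_unique[OF _ has_derivative_ident])
    then show ?thesis by (simp add: fun_eq_iff)
  qed
  moreover have "snd (?J v) \<in> Hom_perp (D' q)" for v
  proof -
    have "blinfun_apply (snd (?J v)) w = 0" if w: "w \<in> (D' q)\<^sup>\<bottom>" for w
    proof (rule const[of "\<lambda>z. blinfun_apply (snd z) w"])
      show "bounded_linear (\<lambda>z :: 'e \<times> ('e \<Rightarrow>\<^sub>L 'e). blinfun_apply (snd z) w)"
        by (rule bounded_linear_compose[OF blinfun.bounded_linear_left bounded_linear_snd])
    qed (use Y(5) w in \<open>auto simp: Hom_perp_def\<close>)
    moreover have "u \<bullet> blinfun_apply (snd (?J v)) w = 0" if u: "u \<in> D' q" for u w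
    proof (rule const[of "\<lambda>z. u \<bullet> blinfun_apply (snd z) w"])
      show "bounded_linear (\<lambda>z :: 'e \<times> ('e \<Rightarrow>\<^sub>L 'e). u \<bullet> blinfun_apply (snd z) w)"
        by (rule bounded_linear_compose[OF bounded_linear_inner_right
              bounded_linear_compose[OF blinfun.bounded_linear_left bounded_linear_snd]])
    qed (use Y(5) u in \<open>auto simp: Hom_perp_def orthogonal_comp_iff\<close>)
    ultimately show ?thesis by (auto simp: Hom_perp_def orthogonal_comp_iff)
  qed
  ultimately show "admissible (D' q) (section_diff \<A> q D')" by (simp add: admissible_def)
qed

lemma ext_deriv_apply:
  assumes "(form_rep \<A> q a has_derivative a') (at (coord_at \<A> q))"
  shows "blinfun_apply (blinfun_apply (ext_deriv \<A> q a) u) v = blinfun_apply (a' u) v - blinfun_apply (a' v) u"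
proof -
  have a': "frechet_derivative (form_rep \<A> q a) (at (coord_at \<A> q)) = a'"
    by (rule frechet_derivative_at[OF assms, symmetric])
  have bl: "bounded_linear a'" by (rule has_derivative_bounded_linear[OF assms])
  define c where "c u = Blinfun (\<lambda>v. blinfun_apply (a' v) u)" for u
  have c: "blinfun_apply (c u) v = blinfun_apply (a' v) u" for u v
    unfolding c_def
    by (subst bounded_linear_Blinfun_apply) (rule bounded_linear_compose[OF blinfun.bounded_linear_left bl], rule refl)
  have "linear (\<lambda>u. a' u - c u)"
    by (rule linearI; rule blinfun_eqI)
      (simp_all add: c bounded_linear.linear[OF bl, THEN linear_add] bounded_linear.linear[OF bl, THEN linear_cmul]
        blinfun.add_left blinfun.diff_left blinfun.scaleR_left blinfun.add_right blinfun.scaleR_right algebra_simps)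
  then have "blinfun_apply (Blinfun (\<lambda>u. a' u - c u)) = (\<lambda>u. a' u - c u)"
    by (simp add: bounded_linear_Blinfun_apply linear_conv_bounded_linear)
  then show ?thesis by (simp add: ext_deriv_def a' Let_def blinfun.diff_left c flip: c_def)
qed

text \<open>In the chart, the form annihilates \<open>u + B\<^sub>y u\<close> for \<open>u\<close> in \<open>D' q\<close>, where \<open>D'\<close> is the graph of \<open>B\<close>. Differentiate this
  identity at \<open>q\<close>.\<close>

lemma ext_deriv_annihilating:
  assumes ld: "local_distribution \<A> k q D'" and a: "local_annihilating_form \<A> q D' a"
  shows "restrict_form (D' q) (ext_deriv \<A> q a) = jet_Levi (D' q) (section_diff \<A> q D') (a q)"
proof -
  let ?c = "chart_at \<A> q" and ?y0 = "coord_at \<A> q"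
  let ?s = "section_rep \<A> q D'" and ?J = "blinfun_apply (section_diff \<A> q D')" and ?F = "form_rep \<A> q a"
  note D = local_distribution_rep(2)[OF ld] and s0 = local_distribution_rep(4)[OF ld]
  obtain Y where Y0: "graph_chart q D' Y" using local_distribution_rep(1)[OF ld] ..
  have Y: "open Y" "?y0 \<in> Y" "Y \<subseteq> snd ?c ` fst ?c"
    "\<And>y. y \<in> Y \<Longrightarrow> blinfun_apply (chart_diff \<A> ?c (chart_inv ?c y)) ` D' (chart_inv ?c y) = graph_over (D' q) (snd (?s y))"
    using Y0 by (simp_all add: graph_chart_def)
  obtain W where W: "open W" "q \<in> W" "W \<subseteq> fst ?c" "smooth_on (snd ?c ` W) ?F"
    "\<forall>p\<in>W. \<forall>u\<in>D' p. blinfun_apply (a p) u = 0"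
    using a unfolding local_annihilating_form_def by (elim exE conjE)
  have y0W: "?y0 \<in> snd ?c ` W" using W(2) by (simp add: coord_at_def)
  define a' where "a' = frechet_derivative ?F (at ?y0)"
  have Fd: "(?F has_derivative a') (at ?y0)"
    unfolding a'_def by (rule smooth_on_has_derivative[OF W(4) y0W])
  have inv0: "chart_inv ?c ?y0 = q" by (simp add: coord_at_def chart_inv_apply chart_at_mem)
  have F0: "?F ?y0 = a q"
    by (rule blinfun_eqI) (simp add: form_rep_def Let_def inv0 chart_diff_self)
  define Z where "Z = Y \<inter> snd ?c ` W"
  have Z: "open Z" "?y0 \<in> Z"
    using Y y0W chart_image_open[OF chart_at_mem(1) W(1,3)] by (auto simp: Z_def)
  have vanish: "blinfun_apply (?F y) (u + blinfun_apply (snd (?s y)) u) = 0" if y: "y \<in> Z" and u: "u \<in> D' q" for y u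
  proof -
    obtain p where p: "p \<in> W" "y = snd ?c p" using y by (auto simp: Z_def)
    have pc: "p \<in> fst ?c" using W(3) p by blast
    have inv: "chart_inv ?c y = p" using chart_inv_apply[OF chart_at_mem(1) pc] p(2) by simp
    have "u + blinfun_apply (snd (?s y)) u \<in> blinfun_apply (chart_diff \<A> ?c p) ` D' p"
      using Y(4)[of y] y u by (auto simp: Z_def inv graph_over_def)
    then obtain v where v: "v \<in> D' p" "u + blinfun_apply (snd (?s y)) u = blinfun_apply (chart_diff \<A> ?c p) v"
      by blast
    show ?thesis
      unfolding v(2) using bspec[OF bspec[OF W(5) p(1)] v(1)]
      by (simp add: form_rep_def Let_def inv chart_diff_inverse(2)[OF chart_at_mem(1) pc])
  qed
  have key: "blinfun_apply (a' v) u = - blinfun_apply (a q) (blinfun_apply (snd (?J v)) u)" if u: "u \<in> D' q" for u v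
  proof -
    have sd: "((\<lambda>y. snd (?s y)) has_derivative (\<lambda>v. snd (?J v))) (at ?y0)"
      by (rule has_derivative_snd[OF section_diff(1)[OF ld]])
    have "((\<lambda>y. u + blinfun_apply (snd (?s y)) u) has_derivative (\<lambda>v. 0 + blinfun_apply (snd (?J v)) u)) (at ?y0)"
      by (intro has_derivative_add has_derivative_const
          bounded_linear.has_derivative[OF blinfun.bounded_linear_left sd])
    from bounded_bilinear.FDERIV[OF bounded_bilinear_blinfun_apply Fd this]
    have "((\<lambda>y. blinfun_apply (?F y) (u + blinfun_apply (snd (?s y)) u)) has_derivative
        (\<lambda>v. blinfun_apply (?F ?y0) (0 + blinfun_apply (snd (?J v)) u) +
          blinfun_apply (a' v) (u + blinfun_apply (snd (?s ?y0)) u))) (at ?y0)" .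
    then have "((\<lambda>y. 0) has_derivative
        (\<lambda>v. blinfun_apply (?F ?y0) (0 + blinfun_apply (snd (?J v)) u) +
          blinfun_apply (a' v) (u + blinfun_apply (snd (?s ?y0)) u))) (at ?y0)"
      by (rule has_derivative_transform_within_open[OF _ Z]) (rule vanish[OF _ u])
    from has_derivative_unique[OF this has_derivative_const]
    have "blinfun_apply (?F ?y0) (0 + blinfun_apply (snd (?J v)) u) +
          blinfun_apply (a' v) (u + blinfun_apply (snd (?s ?y0)) u) = 0" by (rule fun_cong)
    then show ?thesis by (simp add: F0 s0 eq_neg_iff_add_eq_0 add.commute)
  qed
  show ?thesis
    by (rule restrict_form_eqI[OF D jet_Levi(1)[OF D]])
      (simp add: jet_Levi(2)[OF D] ext_deriv_apply[OF Fd] key blinfun.diff_right)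
qed

text \<open>In the chart take \<open>y \<mapsto> \<alpha> \<circ> (1 - B\<^sub>y)\<close>, where \<open>D'\<close> is the graph of \<open>B\<close>. It annihilates \<open>u + B\<^sub>y u\<close> because \<open>\<alpha>\<close>
  annihilates \<open>u\<close> and \<open>B\<^sub>y (B\<^sub>y u) = 0\<close>, and it is smooth as an affine function of \<open>B\<^sub>y\<close>.\<close>

lemma annihilating_form_exists:
  assumes ld: "local_distribution \<A> k q D'" and \<alpha>: "\<alpha> \<in> annihilator (D' q)"
  shows "\<exists>a. local_annihilating_form \<A> q D' a \<and> a q = \<alpha>"
proof -
  let ?c = "chart_at \<A> q" and ?y0 = "coord_at \<A> q" and ?s = "section_rep \<A> q D'"
  note s0 = local_distribution_rep(4)[OF ld]
  obtain Y where Y0: "graph_chart q D' Y" using local_distribution_rep(1)[OF ld] ..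
  have Y: "open Y" "?y0 \<in> Y" "Y \<subseteq> snd ?c ` fst ?c" "smooth_on Y ?s"
    "\<And>y. y \<in> Y \<Longrightarrow> snd (?s y) \<in> Hom_perp (D' q) \<and>
      blinfun_apply (chart_diff \<A> ?c (chart_inv ?c y)) ` D' (chart_inv ?c y) = graph_over (D' q) (snd (?s y))"
    using Y0 by (simp_all add: graph_chart_def)
  define a where "a p = (\<alpha> o\<^sub>L (id_blinfun - snd (?s (snd ?c p)))) o\<^sub>L chart_diff \<A> ?c p" for p
  have aq: "a q = \<alpha>"
    by (rule blinfun_eqI) (simp add: a_def chart_diff_self s0 flip: coord_at_def)
  obtain \<psi> where \<psi>: "homeomorphism (fst ?c) (snd ?c ` fst ?c) (snd ?c) \<psi>"
    using chart_homeomorphism[OF chart_at_mem(1)[of q]] by (elim exE)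
  define W where "W = fst ?c \<inter> snd ?c -` Y"
  have W: "open W" "q \<in> W" "W \<subseteq> fst ?c" "snd ?c ` W = Y"
  proof -
    show "open W"
      unfolding W_def using \<psi> Y(1) chart_open(1)[OF chart_at_mem(1)]
      by (intro continuous_open_preimage) (auto simp: homeomorphism_def)
    show "q \<in> W" "W \<subseteq> fst ?c" using Y(2) chart_at_mem(2) by (auto simp: W_def coord_at_def)
    show "snd ?c ` W = Y" using Y(3) by (auto simp: W_def)
  qed
  have "local_annihilating_form \<A> q D' a"
    unfolding local_annihilating_form_def
  proof (intro exI[of _ W] conjI W ballI)
    have op: "open (snd ?c ` W)" using W(4) Y(1) by simp
    show "smooth_on (snd ?c ` W) (form_rep \<A> q a)"
    proof (rule smooth_on_cong[OF op])
      have bl: "bounded_linear (\<lambda>z :: 'e \<times> ('e \<Rightarrow>\<^sub>L 'e). - (\<alpha> o\<^sub>L snd z))"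
        by (intro bounded_linear_minus bounded_linear_compose[OF _ bounded_linear_snd]
            bounded_bilinear.bounded_linear_right[OF bounded_bilinear_blinfun_compose])
      show "smooth_on (snd ?c ` W) (\<lambda>y. \<alpha> + - (\<alpha> o\<^sub>L snd (?s y)))"
        using smooth_on_affine_compose[OF op bl, of ?s \<alpha>] Y(4) W(4) by simp
      fix y assume "y \<in> snd ?c ` W"
      then obtain p where p: "p \<in> W" "y = snd ?c p" by blast
      have pc: "p \<in> fst ?c" using W(3) p by blast
      have inv: "chart_inv ?c y = p" using chart_inv_apply[OF chart_at_mem(1) pc] p(2) by simp
      show "\<alpha> + - (\<alpha> o\<^sub>L snd (?s y)) = form_rep \<A> q a y"
        by (rule blinfun_eqI)
          (simp add: form_rep_def Let_def inv a_def chart_diff_inverse[OF chart_at_mem(1) pc] p(2)[symmetric]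
            blinfun.diff_left blinfun.diff_right blinfun.minus_left)
    qed
    fix p v assume p: "p \<in> W" and v: "v \<in> D' p"
    have pc: "p \<in> fst ?c" using W(3) p by blast
    have inv: "chart_inv ?c (snd ?c p) = p" using chart_inv_apply[OF chart_at_mem(1) pc] .
    have yY: "snd ?c p \<in> Y" using W(4) p by blast
    define B where "B = snd (?s (snd ?c p))"
    have B: "B \<in> Hom_perp (D' q)" "blinfun_apply (chart_diff \<A> ?c p) ` D' p = graph_over (D' q) B"
      using Y(5)[OF yY] by (simp_all add: inv B_def)
    then obtain u where u: "u \<in> D' q" "blinfun_apply (chart_diff \<A> ?c p) v = u + blinfun_apply B u"
      using v by (auto simp: graph_over_def)
    have "blinfun_apply B (blinfun_apply B u) = 0" using B(1) by (auto simp: Hom_perp_def)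
    then show "blinfun_apply (a p) v = 0"
      using u \<alpha> by (simp add: a_def B_def[symmetric] blinfun.diff_left blinfun.diff_right blinfun.add_right annihilator_def)
  qed
  then show ?thesis using aq by blast
qed

lemma dual_Levi_eq:
  assumes ld: "local_distribution \<A> k q D'" and \<alpha>: "\<alpha> \<in> annihilator (D' q)"
  shows "dual_Levi \<A> q D' \<alpha> = jet_Levi (D' q) (section_diff \<A> q D') \<alpha>"
  unfolding dual_Levi_def
proof (rule the_equality)
  show "\<exists>a. local_annihilating_form \<A> q D' a \<and> a q = \<alpha> \<and>
      jet_Levi (D' q) (section_diff \<A> q D') \<alpha> = restrict_form (D' q) (ext_deriv \<A> q a)"
    using annihilating_form_exists[OF ld \<alpha>] ext_deriv_annihilating[OF ld] by metis
qed (use ext_deriv_annihilating[OF ld] in blast)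

text \<open>In the chart at \<open>q\<close>, the realising distribution is the affine section with derivative \<open>j\<close>.\<close>

lemma realize_jet:
  assumes D: "subspace D" "dim D = k" and j: "admissible D j"
  shows "\<exists>D'. local_distribution \<A> k q D' \<and> D' q = D \<and> section_diff \<A> q D' = j"
proof -
  let ?c = "chart_at \<A> q" and ?y0 = "coord_at \<A> q"
  define B where "B p = snd (blinfun_apply j (snd ?c p - ?y0))" for p
  define D' where "D' p = blinfun_apply (chart_diff_inv \<A> ?c p) ` graph_over D (B p)" for p
  have Bp: "B p \<in> Hom_perp D" for p using j by (simp add: B_def admissible_def)
  have Bq: "B q = 0" by (simp add: B_def coord_at_def)
  have D'q: "D' q = D" by (simp add: D'_def Bq graph_over_zero chart_diff_self)
  have im: "blinfun_apply (chart_diff \<A> ?c p) ` D' p = graph_over D (B p)" if "p \<in> fst ?c" for p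
    unfolding D'_def image_image by (simp add: chart_diff_inverse[OF chart_at_mem(1) that])
  have inj: "inj (blinfun_apply (chart_diff_inv \<A> ?c p))" if "p \<in> fst ?c" for p
    by (rule inj_on_inverseI) (rule chart_diff_inverse(1)[OF chart_at_mem(1) that])
  have lin: "linear (blinfun_apply b)" for b :: "'e \<Rightarrow>\<^sub>L 'e"
    by (rule bounded_linear.linear) (rule blinfun.bounded_linear_right)
  have rep: "section_rep \<A> q D' y = (0, - snd (blinfun_apply j ?y0)) + blinfun_apply j y" if y: "y \<in> snd ?c ` fst ?c" for y
  proof -
    obtain p where p: "p \<in> fst ?c" "y = snd ?c p" using y by blast
    have inv: "chart_inv ?c y = p" using chart_inv_apply[OF chart_at_mem(1) p(1)] p(2) by simp
    have "section_rep \<A> q D' y = (y, B p)"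
      using Gr_chart_eq[OF D(1) Bp im[OF p(1)]]
      by (simp add: section_rep_def Let_def p(2) chart_inv_apply[OF chart_at_mem(1) p(1)] D'q)
    moreover have "fst (blinfun_apply j y) = y" using j by (simp add: admissible_def)
    ultimately show ?thesis
      by (simp add: prod_eq_iff B_def p(2)[symmetric] blinfun.diff_right)
  qed
  have op: "open (snd ?c ` fst ?c)" by (rule chart_open(2)[OF chart_at_mem(1)])
  have y0: "?y0 \<in> snd ?c ` fst ?c" using chart_at_mem(2)[of q] by (simp add: coord_at_def)
  have ld: "local_distribution \<A> k q D'"
    unfolding local_distribution_def
  proof (intro exI[of _ "fst ?c"] conjI ballI)
    show "open (fst ?c)" by (rule chart_open(1)[OF chart_at_mem(1)])
    show "smooth_on (snd ?c ` fst ?c) (section_rep \<A> q D')"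
      by (rule smooth_on_cong[OF op rep[symmetric] smooth_on_affine[OF op blinfun.bounded_linear_right]])
    fix p assume p: "p \<in> fst ?c"
    have "subspace (D' p)" unfolding D'_def by (intro linear_subspace_image lin graph_over_subspace(1) D)
    moreover have "dim (D' p) = k"
      unfolding D'_def using dim_image_eq[OF lin inj_on_subset[OF inj[OF p] subset_UNIV]]
        graph_over_subspace(2)[OF D(1) Bp] D(2) by metis
    ultimately show "(p, D' p) \<in> Gr_bundle k \<inter> Gr_chart_domain \<A> (q, D' q)"
      using im[OF p] Bp p by (auto simp: Gr_bundle_def Gr_chart_domain_def D'q)
  qed (simp_all add: chart_at_mem)
  have "((\<lambda>y. (0, - snd (blinfun_apply j ?y0)) + blinfun_apply j y) has_derivative (\<lambda>v. 0 + blinfun_apply j v)) (at ?y0)"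
    by (intro has_derivative_add has_derivative_const bounded_linear_imp_has_derivative blinfun.bounded_linear_right)
  then have "(section_rep \<A> q D' has_derivative (\<lambda>v. 0 + blinfun_apply j v)) (at ?y0)"
    by (rule has_derivative_transform_within_open[OF _ op y0]) (rule rep[symmetric])
  then have "frechet_derivative (section_rep \<A> q D') (at ?y0) = blinfun_apply j"
    using frechet_derivative_at[of "section_rep \<A> q D'" "\<lambda>v. 0 + blinfun_apply j v" ?y0] by simp
  then have "section_diff \<A> q D' = j" by (simp add: section_diff_def blinfun_apply_inverse)
  then show ?thesis using ld D'q by blast
qed

lemma generic_relation_iff:
  assumes D: "subspace D" "dim D = 2 * N + 1"
  shows "((q, D), j) \<in> generic_relation \<A> N \<longleftrightarrow> admissible D j \<and>
    dim (jet_Levi D j ` annihilator D) = 2 \<and> jet_Levi D j ` annihilator D \<in> generic_orbit N D"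
proof
  assume "((q, D), j) \<in> generic_relation \<A> N"
  then obtain D' where D': "local_distribution \<A> (2 * N + 1) q D'" "D' q = D" "section_diff \<A> q D' = j"
    "dim (dual_Levi \<A> q D' ` annihilator (D' q)) = 2"
    "dual_Levi \<A> q D' ` annihilator (D' q) \<in> generic_orbit N (D' q)"
    unfolding generic_relation_def jet1_def by blast
  have "dual_Levi \<A> q D' ` annihilator (D' q) = jet_Levi D j ` annihilator D"
    using dual_Levi_eq[OF D'(1)] D'(2,3) by (intro image_cong) auto
  then show "admissible D j \<and> dim (jet_Levi D j ` annihilator D) = 2 \<and> jet_Levi D j ` annihilator D \<in> generic_orbit N D"
    using section_diff(2)[OF D'(1)] D' by simp
next
  assume R: "admissible D j \<and> dim (jet_Levi D j ` annihilator D) = 2 \<and> jet_Levi D j ` annihilator D \<in> generic_orbit N D"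
  then obtain D' where D': "local_distribution \<A> (2 * N + 1) q D'" "D' q = D" "section_diff \<A> q D' = j"
    using realize_jet[OF D] by blast
  have "dual_Levi \<A> q D' ` annihilator (D' q) = jet_Levi D j ` annihilator D"
    using dual_Levi_eq[OF D'(1)] D'(2,3) by (intro image_cong) auto
  then show "((q, D), j) \<in> generic_relation \<A> N"
    using R D' unfolding generic_relation_def jet1_def by force
qed

end

section \<open>The generic orbit and the normal form\<close>

abbreviation form :: "('a::euclidean_space \<Rightarrow>\<^sub>L 'a \<Rightarrow>\<^sub>L real) \<Rightarrow> 'a \<Rightarrow> 'a \<Rightarrow> real" where
  "form W \<equiv> (\<lambda>u v. blinfun_apply (blinfun_apply W u) v)"

lemma alternating_form: "W \<in> alt_forms D \<Longrightarrow> alternating (form W)"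
  by (simp add: alternating_def blinfun_bilinear alt_forms_def)

lemma subspace_alt_forms: "subspace (alt_forms D)"
  by (simp add: subspace_def alt_forms_def blinfun.add_left blinfun.scaleR_left)

lemma wedge_apply: "form (wedge \<epsilon> \<eta>) u v = blinfun_apply \<epsilon> u * blinfun_apply \<eta> v - blinfun_apply \<eta> u * blinfun_apply \<epsilon> v"
proof -
  have "linear (\<lambda>u. blinfun_apply \<epsilon> u *\<^sub>R \<eta> - blinfun_apply \<eta> u *\<^sub>R \<epsilon>)"
    by (rule linearI) (simp_all add: blinfun.add_right blinfun.scaleR_right scaleR_add_left scaleR_diff_right)
  then have "blinfun_apply (wedge \<epsilon> \<eta>) = (\<lambda>u. blinfun_apply \<epsilon> u *\<^sub>R \<eta> - blinfun_apply \<eta> u *\<^sub>R \<epsilon>)"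
    unfolding wedge_def by (simp add: bounded_linear_Blinfun_apply linear_conv_bounded_linear)
  then show ?thesis by (simp add: blinfun.diff_left blinfun.scaleR_left)
qed

lemma wedge_alt_forms:
  assumes "\<epsilon> \<in> dual_space D" "\<eta> \<in> dual_space D"
  shows "wedge \<epsilon> \<eta> \<in> alt_forms D"
  using assms unfolding alt_forms_def dual_space_def
  by (auto intro!: blinfun_eqI simp: wedge_apply)

text \<open>For \<open>i = 0\<close> and \<open>i = 1\<close> these are the generators of the plane in the definition of the generic orbit.\<close>

definition normal_form :: "nat \<Rightarrow> nat \<Rightarrow> (nat \<Rightarrow> 'a::euclidean_space \<Rightarrow>\<^sub>L real) \<Rightarrow> 'a \<Rightarrow>\<^sub>L 'a \<Rightarrow>\<^sub>L real" where
  "normal_form N i \<epsilon> = (\<Sum>k=1..N. wedge (\<epsilon> (k + i)) (\<epsilon> (2 * N + 2 - k)))"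

lemma normal_form_pencil:
  "(\<Sum>k=1..N. wedge (s *\<^sub>R \<epsilon> k + t *\<^sub>R \<epsilon> (k + 1)) (\<epsilon> (2 * N + 2 - k))) =
    s *\<^sub>R normal_form N 0 \<epsilon> + t *\<^sub>R normal_form N 1 \<epsilon>"
proof -
  have "wedge (s *\<^sub>R a + t *\<^sub>R b) c = s *\<^sub>R wedge a c + t *\<^sub>R wedge b c" for a b c :: "'a \<Rightarrow>\<^sub>L real"
    by (intro blinfun_eqI) (simp add: wedge_apply blinfun.add_left blinfun.scaleR_left algebra_simps)
  then show ?thesis by (simp add: normal_form_def sum.distrib scaleR_sum_right)
qed

lemma normal_form_table:
  assumes z: "\<And>i. i \<in> {1..2*N+1} \<Longrightarrow> z i \<in> D"
    and \<epsilon>: "\<And>i j. i \<in> {1..2*N+1} \<Longrightarrow> j \<in> {1..2*N+1} \<Longrightarrow> blinfun_apply (\<epsilon> i) (z j) = (if i = j then 1 else 0)"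
  shows "nf_table N D (form (normal_form N 0 \<epsilon>)) (form (normal_form N 1 \<epsilon>)) z (\<lambda>j. z (2 * N + 2 - j))"
proof -
  have val: "form (normal_form N i \<epsilon>) u v =
      (\<Sum>k=1..N. blinfun_apply (\<epsilon> (k + i)) u * blinfun_apply (\<epsilon> (2 * N + 2 - k)) v -
        blinfun_apply (\<epsilon> (2 * N + 2 - k)) u * blinfun_apply (\<epsilon> (k + i)) v)" for i u v
    unfolding normal_form_def by (simp add: blinfun.sum_left wedge_apply)
  have lo: "k + i \<in> {1..2*N+1}" "a \<in> {1..2*N+1}" "b \<in> {1..N} \<Longrightarrow> 2*N+2-b \<in> {1..2*N+1}"
      "b \<in> {1..N} \<Longrightarrow> a \<noteq> 2*N+2-b" "b \<in> {1..N} \<Longrightarrow> k + i \<noteq> 2*N+2-b"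
    if "i \<le> 1" "k \<in> {1..N}" "a \<in> {1..N+1}" for i k a b :: nat
    using that by auto
  have ee: "form (normal_form N i \<epsilon>) (z a) (z b) = 0" if ab: "i \<le> 1" "a \<in> {1..N+1}" "b \<in> {1..N+1}" for i a b
    unfolding val
  proof (intro sum.neutral ballI)
    fix k assume k: "k \<in> {1..N}"
    have "blinfun_apply (\<epsilon> (2*N+2-k)) (z c) = 0" if "c \<in> {1..N+1}" for c
      using \<epsilon>[OF lo(3)[OF ab(1) k that k] lo(2)[OF ab(1) k that]] lo(4)[OF ab(1) k that k] by simp
    then show "blinfun_apply (\<epsilon> (k + i)) (z a) * blinfun_apply (\<epsilon> (2 * N + 2 - k)) (z b) -
        blinfun_apply (\<epsilon> (2 * N + 2 - k)) (z a) * blinfun_apply (\<epsilon> (k + i)) (z b) = 0"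
      using ab by simp
  qed
  have ff: "form (normal_form N i \<epsilon>) (z (2*N+2-a)) (z (2*N+2-b)) = 0" if ab: "i \<le> 1" "a \<in> {1..N}" "b \<in> {1..N}" for i a b
    unfolding val
  proof (intro sum.neutral ballI)
    fix k assume k: "k \<in> {1..N}"
    have "blinfun_apply (\<epsilon> (k + i)) (z (2*N+2-c)) = 0" if c: "c \<in> {1..N}" for c
    proof -
      have "k \<in> {1..N+1}" using k by simp
      note l = lo[OF ab(1) k this]
      show ?thesis using \<epsilon>[OF l(1) l(3)[OF c]] l(5)[OF c] by simp
    qed
    then show "blinfun_apply (\<epsilon> (k + i)) (z (2*N+2-a)) * blinfun_apply (\<epsilon> (2 * N + 2 - k)) (z (2*N+2-b)) -
        blinfun_apply (\<epsilon> (2 * N + 2 - k)) (z (2*N+2-a)) * blinfun_apply (\<epsilon> (k + i)) (z (2*N+2-b)) = 0"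
      using ab by simp
  qed
  have ef: "form (normal_form N i \<epsilon>) (z a) (z (2*N+2-b)) = (if a = b + i then 1 else 0)"
    if ab: "i \<le> 1" "a \<in> {1..N+1}" "b \<in> {1..N}" for i a b
  proof -
    have "form (normal_form N i \<epsilon>) (z a) (z (2*N+2-b)) = (\<Sum>k=1..N. if k = b then (if a = b + i then 1 else 0) else 0)"
      unfolding val
    proof (intro sum.cong refl)
      fix k assume k: "k \<in> {1..N}"
      note l = lo[OF ab(1) k ab(2)]
      have ne: "2*N+2-k = 2*N+2-b \<longleftrightarrow> k = b" using k ab(3) by auto
      have "blinfun_apply (\<epsilon> (k + i)) (z a) = (if k + i = a then 1 else 0)" by (rule \<epsilon>[OF l(1,2)])
      moreover have "blinfun_apply (\<epsilon> (2*N+2-k)) (z (2*N+2-b)) = (if k = b then 1 else 0)"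
        using \<epsilon>[OF l(3)[OF k] l(3)[OF ab(3)]] unfolding ne .
      moreover have "blinfun_apply (\<epsilon> (2*N+2-k)) (z a) = 0"
        using \<epsilon>[OF l(3)[OF k] l(2)] l(4)[OF k] by simp
      ultimately show "blinfun_apply (\<epsilon> (k + i)) (z a) * blinfun_apply (\<epsilon> (2 * N + 2 - k)) (z (2*N+2-b)) -
        blinfun_apply (\<epsilon> (2 * N + 2 - k)) (z a) * blinfun_apply (\<epsilon> (k + i)) (z (2*N+2-b)) =
        (if k = b then (if a = b + i then 1 else 0) else 0)"
        by auto
    qed
    then show ?thesis using ab by simp
  qed
  have zf: "z (2*N+2-j) \<in> D" if "j \<in> {1..N}" for j
    by (rule z) (use that in auto)
  have ze: "z j \<in> D" if "j \<in> {1..N+1}" for j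
    by (rule z) (use that in auto)
  show ?thesis
    unfolding nf_table_def using ee[of 0] ee[of 1] ff[of 0] ff[of 1] ef[of 0] ef[of 1] ze zf by simp
qed

text \<open>The vectors of the table span \<open>D\<close>.\<close>

lemma nf_table_determines:
  assumes alt: "alternating \<omega>1" "alternating \<omega>2" "alternating \<nu>1" "alternating \<nu>2"
    and D: "subspace D" "dim D = 2 * N + 1" and N: "N \<ge> 1"
    and t: "nf_table N D \<omega>1 \<omega>2 e f" and t': "nf_table N D \<nu>1 \<nu>2 e f"
    and uv: "u \<in> D" "v \<in> D"
  shows "\<omega>1 u v = \<nu>1 u v" "\<omega>2 u v = \<nu>2 u v"
proof -
  have fe: "\<omega> (f j) (e i) = - \<omega> (e i) (f j)" if "alternating \<omega>" for \<omega> i j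
    by (rule alternating_commute[OF that])
  have ends: "\<omega>1 x v = \<nu>1 x v \<and> \<omega>2 x v = \<nu>2 x v" if x: "x \<in> e ` {1..N+1} \<union> f ` {1..N}" and v: "v \<in> D" for x v
  proof -
    obtain c where c: "v = (\<Sum>i=1..N+1. c i *\<^sub>R e i) + (\<Sum>j=1..N. \<omega>1 (e j) v *\<^sub>R f j)"
      using nf_table_expand[OF alt(1,2) D N t v] by blast
    define d where "d j = \<omega>1 (e j) v" for j
    note d = c[folded d_def]
    have "\<omega>1 x (e i) = \<nu>1 x (e i) \<and> \<omega>2 x (e i) = \<nu>2 x (e i)" if "i \<in> {1..N+1}" for i
      using x that t t' unfolding nf_table_def by (auto simp: fe alt simp del: atLeastAtMost_iff)
    moreover have "\<omega>1 x (f j) = \<nu>1 x (f j) \<and> \<omega>2 x (f j) = \<nu>2 x (f j)" if "j \<in> {1..N}" for j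
      using x that t t' unfolding nf_table_def by (auto simp del: atLeastAtMost_iff)
    ultimately show ?thesis
      unfolding d alternating_add(2)[OF alt(1)] alternating_add(2)[OF alt(2)] alternating_add(2)[OF alt(3)]
        alternating_add(2)[OF alt(4)] alternating_sum(2)[OF alt(1)] alternating_sum(2)[OF alt(2)]
        alternating_sum(2)[OF alt(3)] alternating_sum(2)[OF alt(4)]
      by (intro conjI arg_cong2[where f = "(+)"] sum.cong refl) simp_all
  qed
  obtain c where c: "u = (\<Sum>i=1..N+1. c i *\<^sub>R e i) + (\<Sum>j=1..N. \<omega>1 (e j) u *\<^sub>R f j)"
    using nf_table_expand[OF alt(1,2) D N t uv(1)] by blast
  define d where "d j = \<omega>1 (e j) u" for j
    note d = c[folded d_def]
  have "\<omega>1 (e i) v = \<nu>1 (e i) v \<and> \<omega>2 (e i) v = \<nu>2 (e i) v" if "i \<in> {1..N+1}" for i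
    using ends uv(2) that by blast
  moreover have "\<omega>1 (f i) v = \<nu>1 (f i) v \<and> \<omega>2 (f i) v = \<nu>2 (f i) v" if "i \<in> {1..N}" for i
    using ends uv(2) that by blast
  ultimately show "\<omega>1 u v = \<nu>1 u v" "\<omega>2 u v = \<nu>2 u v"
    unfolding d alternating_add(1)[OF alt(1)] alternating_add(1)[OF alt(2)] alternating_add(1)[OF alt(3)]
      alternating_add(1)[OF alt(4)] alternating_sum(1)[OF alt(1)] alternating_sum(1)[OF alt(2)]
      alternating_sum(1)[OF alt(3)] alternating_sum(1)[OF alt(4)]
    by (intro arg_cong2[where f = "(+)"] sum.cong refl; simp)+
qed

lemma independent_image_sum:
  assumes "independent (z ` I)" "inj_on z I" "finite I" "(\<Sum>i\<in>I. c i *\<^sub>R z i) = 0" "i \<in> I"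
  shows "c i = 0"
proof -
  have "(\<Sum>v\<in>z ` I. c (inv_into I z v) *\<^sub>R v) = 0"
    using assms(2,4) by (simp add: sum.reindex)
  then have "c (inv_into I z (z i)) = 0"
    using assms(1,3,5) by (intro independentD[of "z ` I" "z ` I"]) auto
  then show ?thesis using assms(2,5) by simp
qed

lemma generic_orbit_imp_table:
  assumes D: "subspace D" "dim D = 2 * N + 1" and P: "P \<in> generic_orbit N D"
  shows "\<exists>W1 W2 e f. W1 \<in> P \<and> W2 \<in> P \<and> nf_table N D (form W1) (form W2) e f"
proof -
  obtain \<epsilon> where \<epsilon>: "inj_on \<epsilon> {1..2*N+1}" "independent (\<epsilon> ` {1..2*N+1})" "span (\<epsilon> ` {1..2*N+1}) = dual_space D"
    "P = {\<Sum>k = 1..N. wedge (s *\<^sub>R \<epsilon> k + t *\<^sub>R \<epsilon> (k + 1)) (\<epsilon> (2 * N + 2 - k)) | s t. True}"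
    using P unfolding generic_orbit_def by blast
  have mem: "\<epsilon> i \<in> dual_space D" if "i \<in> {1..2*N+1}" for i
    using \<epsilon>(3) span_base[of "\<epsilon> i" "\<epsilon> ` {1..2*N+1}"] that by blast
  obtain Pr where Pr: "linear Pr" "\<forall>u. Pr u \<in> D" "\<forall>u. u - Pr u \<in> D\<^sup>\<bottom>" "\<forall>u\<in>D. Pr u = u" "\<forall>u\<in>D\<^sup>\<bottom>. Pr u = 0"
    using orthogonal_splitting[OF D(1)] by (elim exE conjE)
  have "\<exists>z. \<forall>j\<in>{1..2*N+1}. z j \<in> D \<and> (\<forall>i\<in>{1..2*N+1}. blinfun_apply (\<epsilon> i) (z j) = (if i = j then 1 else 0))"
  proof (rule dual_family_on[of "{1..2*N+1}" D "\<lambda>i. blinfun_apply (\<epsilon> i)"])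
    show "linear (blinfun_apply (\<epsilon> i))" for i
      by (rule bounded_linear.linear) (rule blinfun.bounded_linear_right)
    fix c assume c: "\<And>v. v \<in> D \<Longrightarrow> (\<Sum>i\<in>{1..2*N+1}. c i * blinfun_apply (\<epsilon> i) v) = 0"
    have "(\<Sum>i\<in>{1..2*N+1}. c i *\<^sub>R \<epsilon> i) = 0"
    proof (rule blinfun_eqI)
      fix v
      have ap: "blinfun_apply (\<epsilon> i) v = blinfun_apply (\<epsilon> i) (Pr v)" if "i \<in> {1..2*N+1}" for i
      proof -
        have "blinfun_apply (\<epsilon> i) (v - Pr v) = 0" using mem[OF that] Pr(3) by (auto simp: dual_space_def)
        then show ?thesis by (simp add: blinfun.diff_right)
      qed
      have "blinfun_apply (\<Sum>i\<in>{1..2*N+1}. c i *\<^sub>R \<epsilon> i) v = (\<Sum>i\<in>{1..2*N+1}. c i * blinfun_apply (\<epsilon> i) (Pr v))"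
        unfolding blinfun.sum_left blinfun.scaleR_left real_scaleR_def by (intro sum.cong refl) (simp only: ap)
      then show "blinfun_apply (\<Sum>i\<in>{1..2*N+1}. c i *\<^sub>R \<epsilon> i) v = blinfun_apply 0 v"
        using c[of "Pr v"] Pr(2) by simp
    qed
    then show "\<forall>i\<in>{1..2*N+1}. c i = 0"
      using independent_image_sum[OF \<epsilon>(2,1)] by blast
  next
    fix g assume "\<And>i. i \<in> {1..2*N+1} \<Longrightarrow> g i \<in> D"
      "\<And>i j. i \<in> {1..2*N+1} \<Longrightarrow> j \<in> {1..2*N+1} \<Longrightarrow> blinfun_apply (\<epsilon> i) (g j) = (if i = j then 1 else 0)"
    then show ?thesis by (intro exI[of _ g] ballI conjI) simp_all
  qed (use D in auto)
  then obtain z where z: "\<forall>j\<in>{1..2*N+1}. z j \<in> D \<and> (\<forall>i\<in>{1..2*N+1}. blinfun_apply (\<epsilon> i) (z j) = (if i = j then 1 else 0))"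
    by (elim exE)
  have "nf_table N D (form (normal_form N 0 \<epsilon>)) (form (normal_form N 1 \<epsilon>)) z (\<lambda>j. z (2 * N + 2 - j))"
    by (rule normal_form_table) (use z in blast)+
  moreover have "1 *\<^sub>R normal_form N 0 \<epsilon> + 0 *\<^sub>R normal_form N 1 \<epsilon> \<in> P"
    "0 *\<^sub>R normal_form N 0 \<epsilon> + 1 *\<^sub>R normal_form N 1 \<epsilon> \<in> P"
    unfolding \<epsilon>(4) normal_form_pencil by blast+
  ultimately show ?thesis by auto
qed

lemma generic_orbit_of_table:
  fixes D :: "'a::euclidean_space set"
  assumes D: "subspace D" "dim D = 2 * N + 1" and N: "N \<ge> 1" and W: "W1 \<in> alt_forms D" "W2 \<in> alt_forms D"
    and t: "nf_table N D (form W1) (form W2) e f"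
  shows "{s *\<^sub>R W1 + t *\<^sub>R W2 | s t. True} \<in> generic_orbit N D" "dim {s *\<^sub>R W1 + t *\<^sub>R W2 | s t. True} = 2"
proof -
  note alt = alternating_form[OF W(1)] alternating_form[OF W(2)]
  let ?I = "{1..2*N+1}"
  define z where "z i = (if i \<le> N + 1 then e i else f (2 * N + 2 - i))" for i
  have zD: "z i \<in> D" if "i \<in> ?I" for i
  proof (cases "i \<le> N + 1")
    case True
    then have "i \<in> {1..N+1}" using that by simp
    then show ?thesis using nf_table_mem(1)[OF t] True by (simp add: z_def)
  next
    case False
    then have "2*N+2-i \<in> {1..N}" using that by auto
    then show ?thesis using nf_table_mem(2)[OF t] False by (simp add: z_def)
  qed
  have ez: "e i = z i" if "i \<in> {1..N+1}" for i using that by (simp add: z_def)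
  have fz: "f j = z (2 * N + 2 - j)" if "j \<in> {1..N}" for j using that by (auto simp: z_def)
  have zind: "independent_family ?I z"
    unfolding independent_family_def
  proof (intro allI impI ballI)
    fix c i assume c: "(\<Sum>i\<in>?I. c i *\<^sub>R z i) = 0" and i: "i \<in> ?I"
    have eqs: "(\<Sum>i\<in>?I. c i * form W1 (z i) x) = 0" "(\<Sum>i\<in>?I. c i * form W2 (z i) x) = 0" for x
      using alternating_sum(1)[OF alt(1), of c z ?I x] alternating_sum(1)[OF alt(2), of c z ?I x] unfolding c
      by simp_all
    consider "i \<le> N" | "i = N + 1" | "i > N + 1" by linarith
    then show "c i = 0"
    proof cases
      case 1
      have "(\<Sum>k\<in>?I. c k * form W1 (z k) (f i)) = (\<Sum>k\<in>?I. if k = i then c k else 0)"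
      proof (intro sum.cong refl)
        fix k assume k: "k \<in> ?I"
        show "c k * form W1 (z k) (f i) = (if k = i then c k else 0)"
        proof (cases "k \<le> N + 1")
          case True
          then show ?thesis using t k i 1 by (simp add: nf_table_def z_def)
        next
          case False
          then have "2*N+2-k \<in> {1..N}" "i \<in> {1..N}" using k i 1 by auto
          then have "form W1 (f (2*N+2-k)) (f i) = 0" using t unfolding nf_table_def by blast
          then show ?thesis using False 1 by (simp add: z_def)
        qed
      qed
      then show ?thesis using eqs(1)[of "f i"] i by (simp del: sum.cl_ivl_Suc atLeastAtMost_iff split: if_splits)
    next
      case 2
      have "(\<Sum>k\<in>?I. c k * form W2 (z k) (f N)) = (\<Sum>k\<in>?I. if k = i then c k else 0)"
      proof (intro sum.cong refl)
        fix k assume k: "k \<in> ?I"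
        show "c k * form W2 (z k) (f N) = (if k = i then c k else 0)"
        proof (cases "k \<le> N + 1")
          case True
          then show ?thesis using t k i 2 N by (simp add: nf_table_def z_def)
        next
          case False
          then have "2*N+2-k \<in> {1..N}" "N \<in> {1..N}" using k N by auto
          then have "form W2 (f (2*N+2-k)) (f N) = 0" using t unfolding nf_table_def by blast
          then show ?thesis using False 2 by (simp add: z_def)
        qed
      qed
      then show ?thesis using eqs(2)[of "f N"] i by (simp del: sum.cl_ivl_Suc atLeastAtMost_iff split: if_splits)
    next
      case 3
      have "(\<Sum>k\<in>?I. c k * form W1 (z k) (e (2*N+2-i))) = (\<Sum>k\<in>?I. if k = i then - c k else 0)"
      proof (intro sum.cong refl)
        fix k assume k: "k \<in> ?I"
        show "c k * form W1 (z k) (e (2*N+2-i)) = (if k = i then - c k else 0)"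
        proof (cases "k \<le> N + 1")
          case True
          then have "2*N+2-i \<in> {1..N+1}" "k \<in> {1..N+1}" using k i 3 by auto
          then have "form W1 (e k) (e (2*N+2-i)) = 0" using t unfolding nf_table_def by blast
          then show ?thesis using True 3 by (simp add: z_def)
        next
          case False
          then have "form W1 (z k) (e (2*N+2-i)) = - form W1 (e (2*N+2-i)) (f (2*N+2-k))"
            using alternating_commute[OF alt(1), of "f (2*N+2-k)" "e (2*N+2-i)"] by (simp add: z_def)
          also have "form W1 (e (2*N+2-i)) (f (2*N+2-k)) = (if 2*N+2-i = 2*N+2-k then 1 else 0)"
          proof -
            have "2*N+2-i \<in> {1..N+1}" "2*N+2-k \<in> {1..N}" using k i 3 False by auto
            then show ?thesis using t unfolding nf_table_def by blast
          qed
          finally show ?thesis using k i by auto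
        qed
      qed
      then show ?thesis using eqs(1)[of "e (2*N+2-i)"] i by (simp del: sum.cl_ivl_Suc atLeastAtMost_iff split: if_splits)
    qed
  qed
  have zspan: "span (z ` ?I) = D"
    by (rule independent_family_spans(3)[OF _ zind zD D(1)]) (use D in auto)
  obtain g where g: "\<And>i. i \<in> ?I \<Longrightarrow> g i \<in> span (z ` ?I)"
    "\<And>i j. i \<in> ?I \<Longrightarrow> j \<in> ?I \<Longrightarrow> z i \<bullet> g j = (if i = j then 1 else 0)"
    using dual_family[OF finite_atLeastAtMost zind] by metis
  define \<epsilon> where "\<epsilon> i = blinfun_inner_left (g i)" for i
  have \<epsilon>a: "blinfun_apply (\<epsilon> i) v = v \<bullet> g i" for i v by (simp add: \<epsilon>_def)
  have \<epsilon>z: "blinfun_apply (\<epsilon> i) (z j) = (if i = j then 1 else 0)" if "i \<in> ?I" "j \<in> ?I" for i j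
    using g(2)[OF that(2,1)] by (auto simp: \<epsilon>a)
  have \<epsilon>d: "\<epsilon> i \<in> dual_space D" if "i \<in> ?I" for i
    using g(1)[OF that] unfolding zspan by (auto simp: dual_space_def \<epsilon>a orthogonal_comp_iff inner_commute)
  have lin: "linear (\<lambda>\<phi>. blinfun_apply \<phi> (z i) :: real)" for i
    by (rule linearI) (simp_all add: blinfun.add_left blinfun.scaleR_left)
  have \<epsilon>z': "blinfun_apply (\<epsilon> j) (z i) = (if i = j then 1 else 0)" if "i \<in> ?I" "j \<in> ?I" for i j
    using \<epsilon>z[OF that(2,1)] by auto
  note ind = dual_system_independent[of ?I "\<lambda>i \<phi>. blinfun_apply \<phi> (z i)" \<epsilon>, OF lin \<epsilon>z']
  have sub_dual: "subspace (dual_space D)"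
    by (simp add: subspace_def dual_space_def blinfun.add_left blinfun.scaleR_left)
  obtain Pr where Pr: "linear Pr" "\<forall>u. Pr u \<in> D" "\<forall>u. u - Pr u \<in> D\<^sup>\<bottom>" "\<forall>u\<in>D. Pr u = u" "\<forall>u\<in>D\<^sup>\<bottom>. Pr u = 0"
    using orthogonal_splitting[OF D(1)] by (elim exE conjE)
  have "span (\<epsilon> ` ?I) = dual_space D"
  proof (rule antisym)
    show "span (\<epsilon> ` ?I) \<subseteq> dual_space D" by (rule span_minimal[OF _ sub_dual]) (use \<epsilon>d in blast)
    show "dual_space D \<subseteq> span (\<epsilon> ` ?I)"
    proof
      fix \<phi> assume \<phi>: "\<phi> \<in> dual_space D"
      have "\<phi> = (\<Sum>i\<in>?I. blinfun_apply \<phi> (z i) *\<^sub>R \<epsilon> i)"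
      proof (rule blinfun_eqI)
        fix v
        have red: "blinfun_apply \<psi> v = blinfun_apply \<psi> (Pr v)" if "\<psi> \<in> dual_space D" for \<psi>
        proof -
          have "blinfun_apply \<psi> (v - Pr v) = 0" using that Pr(3) by (auto simp: dual_space_def)
          then show ?thesis by (simp add: blinfun.diff_right)
        qed
        have "Pr v \<in> span (z ` ?I)" using Pr(2) zspan by blast
        then obtain c where c: "Pr v = (\<Sum>i\<in>?I. c i *\<^sub>R z i)"
          using span_family_sum[OF finite_atLeastAtMost] by blast
        have cv: "blinfun_apply (\<epsilon> j) (Pr v) = c j" if "j \<in> ?I" for j
        proof -
          have "blinfun_apply (\<epsilon> j) (Pr v) = (\<Sum>i\<in>?I. if i = j then c i else 0)"
            unfolding c blinfun.sum_right blinfun.scaleR_right real_scaleR_def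
            by (intro sum.cong refl) (use \<epsilon>z that in auto)
          then show ?thesis using that by (simp only: sum.delta finite_atLeastAtMost if_True)
        qed
        have "blinfun_apply \<phi> v = (\<Sum>i\<in>?I. c i * blinfun_apply \<phi> (z i))"
          unfolding red[OF \<phi>] c blinfun.sum_right blinfun.scaleR_right real_scaleR_def ..
        also have "\<dots> = (\<Sum>i\<in>?I. blinfun_apply \<phi> (z i) * blinfun_apply (\<epsilon> i) v)"
          by (intro sum.cong refl) (simp only: red[OF \<epsilon>d] cv mult.commute)
        finally show "blinfun_apply \<phi> v = blinfun_apply (\<Sum>i\<in>?I. blinfun_apply \<phi> (z i) *\<^sub>R \<epsilon> i) v"
          unfolding blinfun.sum_left blinfun.scaleR_left real_scaleR_def .
      qed
      also have "\<dots> \<in> span (\<epsilon> ` ?I)" by (intro span_sum span_mul span_base imageI)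
      finally show "\<phi> \<in> span (\<epsilon> ` ?I)" .
    qed
  qed
  note span\<epsilon> = this
  have nfm: "normal_form N i \<epsilon> \<in> alt_forms D" if "i \<le> 1" for i
    unfolding normal_form_def
    by (intro subspace_sum subspace_alt_forms wedge_alt_forms \<epsilon>d) (use that in auto)
  have "nf_table N D (form (normal_form N 0 \<epsilon>)) (form (normal_form N 1 \<epsilon>)) z (\<lambda>j. z (2 * N + 2 - j))"
    by (rule normal_form_table[OF zD \<epsilon>z])
  then have t': "nf_table N D (form (normal_form N 0 \<epsilon>)) (form (normal_form N 1 \<epsilon>)) e f"
    unfolding nf_table_def by (simp only: ez fz cong: ball_cong) simp
  have alt': "alternating (form (normal_form N 0 \<epsilon>))" "alternating (form (normal_form N 1 \<epsilon>))"
    using alternating_form nfm by auto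
  have WN: "W1 = normal_form N 0 \<epsilon>" "W2 = normal_form N 1 \<epsilon>"
    using nf_table_determines[OF alt alt' D N t t'] W nfm by (auto intro!: alt_forms_eqI[OF D(1)])
  show "{s *\<^sub>R W1 + t *\<^sub>R W2 | s t. True} \<in> generic_orbit N D"
    unfolding generic_orbit_def mem_Collect_eq normal_form_pencil WN
    by (intro exI[of _ \<epsilon>] conjI ind span\<epsilon> refl)
  have st: "s = 0 \<and> t = 0" if "s *\<^sub>R W1 + t *\<^sub>R W2 = 0" for s t
  proof -
    have "s * form W1 u v + t * form W2 u v = 0" for u v
      using arg_cong[OF that, of "\<lambda>W. form W u v"] by (simp add: blinfun.add_left blinfun.scaleR_left)
    from this[of "e 1" "f 1"] this[of "e 2" "f 1"] show ?thesis using t N by (simp add: nf_table_def)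
  qed
  have ne: "W1 \<noteq> W2" using st[of 1 "-1"] by auto
  have indW: "independent {W1, W2}"
  proof -
    have "W1 \<notin> span {W2}"
    proof
      assume "W1 \<in> span {W2}"
      then obtain r where "W1 = r *\<^sub>R W2" by (auto simp: span_singleton)
      then show False using st[of 1 "- r"] by simp
    qed
    moreover have "W2 \<noteq> 0" using st[of 0 1] by auto
    ultimately show ?thesis by (simp add: independent_insert)
  qed
  have "{s *\<^sub>R W1 + t *\<^sub>R W2 | s t. True} = span {W1, W2}"
  proof (intro antisym subsetI)
    fix W assume "W \<in> {s *\<^sub>R W1 + t *\<^sub>R W2 | s t. True}"
    then obtain s t where W: "W = s *\<^sub>R W1 + t *\<^sub>R W2" by blast
    show "W \<in> span {W1, W2}" unfolding W by (intro span_add span_mul span_base) simp_all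
  next
    fix W assume "W \<in> span {W1, W2}"
    then obtain s where "W - s *\<^sub>R W1 \<in> span {W2}" by (auto simp: span_insert)
    then obtain r where "W - s *\<^sub>R W1 = r *\<^sub>R W2" by (auto simp: span_singleton)
    then have "W = s *\<^sub>R W1 + r *\<^sub>R W2" by (simp add: algebra_simps)
    then show "W \<in> {s *\<^sub>R W1 + t *\<^sub>R W2 | s t. True}" by blast
  qed
  then show "dim {s *\<^sub>R W1 + t *\<^sub>R W2 | s t. True} = 2"
    using indW ne by (simp add: dim_eq_card_independent)
qed

section \<open>Principal subspaces\<close>

lemma jet_Levi_combination:
  assumes D: "subspace D"
  shows "jet_Levi D j (s *\<^sub>R \<alpha> + t *\<^sub>R \<beta>) = s *\<^sub>R jet_Levi D j \<alpha> + t *\<^sub>R jet_Levi D j \<beta>"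
proof (rule alt_forms_eqI[OF D jet_Levi(1)[OF D]])
  show "s *\<^sub>R jet_Levi D j \<alpha> + t *\<^sub>R jet_Levi D j \<beta> \<in> alt_forms D"
    by (intro subspace_add subspace_mul subspace_alt_forms jet_Levi(1) D)
qed (simp add: jet_Levi(2)[OF D] blinfun.add_left blinfun.scaleR_left)

lemma annihilator_vanishes_on_perp:
  fixes D :: "'a::euclidean_space set"
  assumes D: "subspace D" and \<alpha>: "\<alpha> \<in> annihilator D" and z: "\<And>w. w \<in> D\<^sup>\<bottom> \<Longrightarrow> blinfun_apply \<alpha> w = 0"
  shows "\<alpha> = 0"
proof (rule blinfun_eqI)
  fix v
  obtain P where P: "\<forall>u. P u \<in> D" "\<forall>u. u - P u \<in> D\<^sup>\<bottom>"
    using orthogonal_splitting[OF D] by (elim exE conjE)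
  have "blinfun_apply \<alpha> (v - P v) = 0" "blinfun_apply \<alpha> (P v) = 0"
    using z P \<alpha> by (auto simp: annihilator_def)
  then show "blinfun_apply \<alpha> v = blinfun_apply 0 v" by (simp add: blinfun.diff_right)
qed

lemma subspace_annihilator: "subspace (annihilator D)"
  by (simp add: subspace_def annihilator_def blinfun.add_left blinfun.scaleR_left)

lemma dim_perp:
  fixes D :: "'a::euclidean_space set"
  assumes "subspace D"
  shows "dim (D\<^sup>\<bottom>) + dim D = DIM('a)"
proof -
  have "D\<^sup>\<bottom> = {y \<in> UNIV. \<forall>x\<in>D. orthogonal x y}" by (auto simp: orthogonal_comp_def)
  then show ?thesis using dim_subspace_orthogonal_to_vectors[OF assms subspace_UNIV] by simp
qed

lemma annihilator_dual_basis:
  fixes D :: "'a::euclidean_space set"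
  assumes D: "subspace D" "dim D + 2 = DIM('a)" and \<alpha>: "\<alpha>1 \<in> annihilator D" "\<alpha>2 \<in> annihilator D"
    and ind: "\<forall>s t. s *\<^sub>R \<alpha>1 + t *\<^sub>R \<alpha>2 = 0 \<longrightarrow> s = 0 \<and> t = 0"
  shows "\<exists>n1\<in>D\<^sup>\<bottom>. \<exists>n2\<in>D\<^sup>\<bottom>. blinfun_apply \<alpha>1 n1 = 1 \<and> blinfun_apply \<alpha>1 n2 = 0 \<and>
      blinfun_apply \<alpha>2 n1 = 0 \<and> blinfun_apply \<alpha>2 n2 = 1 \<and>
      (\<forall>w\<in>D\<^sup>\<bottom>. w = blinfun_apply \<alpha>1 w *\<^sub>R n1 + blinfun_apply \<alpha>2 w *\<^sub>R n2)"
    "annihilator D = {s *\<^sub>R \<alpha>1 + t *\<^sub>R \<alpha>2 | s t. True}"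
proof -
  define h where "h i = (if i = (1::nat) then \<alpha>1 else \<alpha>2)" for i
  have h: "h 1 = \<alpha>1" "h 2 = \<alpha>2" by (simp_all add: h_def)
  have "\<exists>g. g 1 \<in> D\<^sup>\<bottom> \<and> g 2 \<in> D\<^sup>\<bottom> \<and> blinfun_apply \<alpha>1 (g 1) = 1 \<and> blinfun_apply \<alpha>1 (g 2) = 0 \<and>
      blinfun_apply \<alpha>2 (g 1) = 0 \<and> blinfun_apply \<alpha>2 (g (2::nat)) = 1"
  proof (rule dual_family_on[of "{1,2::nat}" "D\<^sup>\<bottom>" "\<lambda>i. blinfun_apply (h i)"])
    show "linear (blinfun_apply (h i))" for i
      by (rule bounded_linear.linear) (rule blinfun.bounded_linear_right)
    fix c assume c: "\<And>w. w \<in> D\<^sup>\<bottom> \<Longrightarrow> (\<Sum>i\<in>{1,2::nat}. c i * blinfun_apply (h i) w) = 0"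
    have "c 1 *\<^sub>R \<alpha>1 + c 2 *\<^sub>R \<alpha>2 = 0"
    proof (rule annihilator_vanishes_on_perp[OF D(1)])
      show "c 1 *\<^sub>R \<alpha>1 + c 2 *\<^sub>R \<alpha>2 \<in> annihilator D"
        by (intro subspace_add subspace_mul subspace_annihilator \<alpha>)
      show "blinfun_apply (c 1 *\<^sub>R \<alpha>1 + c 2 *\<^sub>R \<alpha>2) w = 0" if "w \<in> D\<^sup>\<bottom>" for w
        using c[OF that] by (simp add: h_def blinfun.add_left blinfun.scaleR_left)
    qed
    from mp[OF spec[OF spec[OF ind]] this] show "\<forall>i\<in>{1,2::nat}. c i = 0" by simp
  next
    fix g assume g: "\<And>i. i \<in> {1,2::nat} \<Longrightarrow> g i \<in> D\<^sup>\<bottom>"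
      "\<And>i j. i \<in> {1,2::nat} \<Longrightarrow> j \<in> {1,2::nat} \<Longrightarrow> blinfun_apply (h i) (g j) = (if i = j then 1 else 0)"
    show ?thesis
      using g(1)[of 1] g(1)[of 2] g(2)[of 1 1] g(2)[of 1 2] g(2)[of 2 1] g(2)[of 2 2]
      by (intro exI[of _ g]) (simp add: h_def)
  qed (simp_all add: subspace_perp)
  then obtain g :: "nat \<Rightarrow> 'a" where g0: "g 1 \<in> D\<^sup>\<bottom>" "g 2 \<in> D\<^sup>\<bottom>" "blinfun_apply \<alpha>1 (g 1) = 1" "blinfun_apply \<alpha>1 (g 2) = 0"
      "blinfun_apply \<alpha>2 (g 1) = 0" "blinfun_apply \<alpha>2 (g 2) = 1" by (elim exE conjE)
  note g = g0 g0[unfolded One_nat_def]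
  have fi: "independent_family {1,2::nat} g"
    unfolding independent_family_def
  proof (intro allI impI)
    fix c assume "(\<Sum>i\<in>{1,2::nat}. c i *\<^sub>R g i) = 0"
    then have "blinfun_apply \<alpha>1 (c 1 *\<^sub>R g 1 + c 2 *\<^sub>R g 2) = 0" "blinfun_apply \<alpha>2 (c 1 *\<^sub>R g 1 + c 2 *\<^sub>R g 2) = 0"
      by simp_all
    then show "\<forall>i\<in>{1,2::nat}. c i = 0"
      by (simp add: blinfun.add_right blinfun.scaleR_right g)
  qed
  have sp: "span (g ` {1,2::nat}) = D\<^sup>\<bottom>"
    by (rule independent_family_spans(3)[OF _ fi _ subspace_perp]) (use g D dim_perp[OF D(1)] in auto)
  have expand: "w = blinfun_apply \<alpha>1 w *\<^sub>R g 1 + blinfun_apply \<alpha>2 w *\<^sub>R g 2" if "w \<in> D\<^sup>\<bottom>" for w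
  proof -
    have "w \<in> span (g ` {1,2::nat})" using that sp by simp
    then obtain c where "w = (\<Sum>i\<in>{1,2::nat}. c i *\<^sub>R g i)"
      using span_family_sum[of "{1,2::nat}" w g] by auto
    then have c: "w = c 1 *\<^sub>R g 1 + c 2 *\<^sub>R g 2" by simp
    show ?thesis unfolding c by (simp add: blinfun.add_right blinfun.scaleR_right g)
  qed
  then show "\<exists>n1\<in>D\<^sup>\<bottom>. \<exists>n2\<in>D\<^sup>\<bottom>. blinfun_apply \<alpha>1 n1 = 1 \<and> blinfun_apply \<alpha>1 n2 = 0 \<and>
      blinfun_apply \<alpha>2 n1 = 0 \<and> blinfun_apply \<alpha>2 n2 = 1 \<and>
      (\<forall>w\<in>D\<^sup>\<bottom>. w = blinfun_apply \<alpha>1 w *\<^sub>R n1 + blinfun_apply \<alpha>2 w *\<^sub>R n2)"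
    using g by (intro bexI[of _ "g 1"] bexI[of _ "g 2"] conjI ballI)
  show "annihilator D = {s *\<^sub>R \<alpha>1 + t *\<^sub>R \<alpha>2 | s t. True}"
  proof (intro antisym subsetI)
    fix \<alpha> assume \<alpha>': "\<alpha> \<in> annihilator D"
    let ?\<beta> = "blinfun_apply \<alpha> (g 1) *\<^sub>R \<alpha>1 + blinfun_apply \<alpha> (g 2) *\<^sub>R \<alpha>2"
    have "\<alpha> - ?\<beta> = 0"
    proof (rule annihilator_vanishes_on_perp[OF D(1)])
      show "\<alpha> - ?\<beta> \<in> annihilator D"
        by (intro subspace_diff subspace_add subspace_mul subspace_annihilator \<alpha> \<alpha>')
      fix w assume "w \<in> D\<^sup>\<bottom>"
      note e = expand[OF this]
      have "blinfun_apply \<alpha> w = blinfun_apply \<alpha>1 w * blinfun_apply \<alpha> (g 1) + blinfun_apply \<alpha>2 w * blinfun_apply \<alpha> (g 2)"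
        using arg_cong[OF e, of "blinfun_apply \<alpha>"] by (simp add: blinfun.add_right blinfun.scaleR_right)
      then show "blinfun_apply (\<alpha> - ?\<beta>) w = 0"
        by (simp add: blinfun.add_left blinfun.scaleR_left blinfun.diff_left mult.commute)
    qed
    then have "\<alpha> = ?\<beta>" by simp
    then show "\<alpha> \<in> {s *\<^sub>R \<alpha>1 + t *\<^sub>R \<alpha>2 | s t. True}" by blast
  next
    fix \<beta> assume "\<beta> \<in> {s *\<^sub>R \<alpha>1 + t *\<^sub>R \<alpha>2 | s t. True}"
    then obtain s t where \<beta>: "\<beta> = s *\<^sub>R \<alpha>1 + t *\<^sub>R \<alpha>2" by blast
    show "\<beta> \<in> annihilator D" unfolding \<beta> by (intro subspace_add subspace_mul subspace_annihilator \<alpha>)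
  qed
qed

definition generic_jet :: "nat \<Rightarrow> 'e::euclidean_space set \<Rightarrow> ('e \<Rightarrow>\<^sub>L ('e \<times> ('e \<Rightarrow>\<^sub>L 'e))) \<Rightarrow> bool" where
  "generic_jet N D j \<longleftrightarrow> dim (jet_Levi D j ` annihilator D) = 2 \<and> jet_Levi D j ` annihilator D \<in> generic_orbit N D"

lemma generic_jet_imp_table:
  assumes D: "subspace D" "dim D = 2 * N + 1" and N: "N \<ge> 1" and j: "generic_jet N D j"
  shows "\<exists>\<alpha>1\<in>annihilator D. \<exists>\<alpha>2\<in>annihilator D. \<exists>e f. nf_table N D (form (jet_Levi D j \<alpha>1)) (form (jet_Levi D j \<alpha>2)) e f \<and>
    (\<forall>s t. s *\<^sub>R \<alpha>1 + t *\<^sub>R \<alpha>2 = 0 \<longrightarrow> s = 0 \<and> t = 0)"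
proof -
  obtain W1 W2 e f where W: "W1 \<in> jet_Levi D j ` annihilator D" "W2 \<in> jet_Levi D j ` annihilator D"
    and t: "nf_table N D (form W1) (form W2) e f"
    using generic_orbit_imp_table[OF D conjunct2[OF j[unfolded generic_jet_def]]] by (elim exE conjE)
  obtain \<alpha>1 where \<alpha>1: "\<alpha>1 \<in> annihilator D" "W1 = jet_Levi D j \<alpha>1" using W(1) by (rule imageE)
  obtain \<alpha>2 where \<alpha>2: "\<alpha>2 \<in> annihilator D" "W2 = jet_Levi D j \<alpha>2" using W(2) by (rule imageE)
  have "s = 0 \<and> r = 0" if z: "s *\<^sub>R \<alpha>1 + r *\<^sub>R \<alpha>2 = 0" for s r
  proof -
    have "s *\<^sub>R W1 + r *\<^sub>R W2 = jet_Levi D j (0 *\<^sub>R \<alpha>1 + 0 *\<^sub>R \<alpha>2)"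
      unfolding \<alpha>1(2) \<alpha>2(2) jet_Levi_combination[OF D(1), symmetric] z by simp
    also have "\<dots> = 0" unfolding jet_Levi_combination[OF D(1)] by simp
    finally have W0: "s *\<^sub>R W1 + r *\<^sub>R W2 = 0" .
    have "s * form W1 u v + r * form W2 u v = 0" for u v
      using arg_cong[OF W0, of "\<lambda>W. form W u v"] by (simp add: blinfun.add_left blinfun.scaleR_left)
    from this[of "e 1" "f 1"] this[of "e 2" "f 1"] show ?thesis using t N by (simp add: nf_table_def)
  qed
  then have ind: "\<forall>s t. s *\<^sub>R \<alpha>1 + t *\<^sub>R \<alpha>2 = 0 \<longrightarrow> s = 0 \<and> t = 0" by blast
  show ?thesis
    by (rule bexI[OF _ \<alpha>1(1)], rule bexI[OF _ \<alpha>2(1)], rule exI[of _ e], rule exI[of _ f])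
      (rule conjI[OF t[unfolded \<alpha>1(2) \<alpha>2(2)] ind])
qed

lemma generic_jet_of_table:
  assumes D: "subspace D" "dim D = 2 * N + 1" and N: "N \<ge> 1"
    and ann: "annihilator D = {s *\<^sub>R \<alpha>1 + t *\<^sub>R \<alpha>2 | s t. True}"
    and t: "nf_table N D (form (jet_Levi D j \<alpha>1)) (form (jet_Levi D j \<alpha>2)) e f"
  shows "generic_jet N D j"
proof -
  have "jet_Levi D j ` annihilator D = {s *\<^sub>R jet_Levi D j \<alpha>1 + t *\<^sub>R jet_Levi D j \<alpha>2 | s t. True}"
  proof -
    have "jet_Levi D j ` annihilator D = {jet_Levi D j (s *\<^sub>R \<alpha>1 + t *\<^sub>R \<alpha>2) | s t. True}" unfolding ann by blast
    then show ?thesis unfolding jet_Levi_combination[OF D(1)] .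
  qed
  then show ?thesis
    unfolding generic_jet_def using generic_orbit_of_table[OF D N jet_Levi(1)[OF D(1)] jet_Levi(1)[OF D(1)] t] by simp
qed

text \<open>The differential of a section whose vertical part is \<open>K\<close>.\<close>

definition graph_jet :: "('e::euclidean_space \<Rightarrow>\<^sub>L ('e \<times> ('e \<Rightarrow>\<^sub>L 'e))) \<Rightarrow> 'e \<Rightarrow>\<^sub>L ('e \<times> ('e \<Rightarrow>\<^sub>L 'e))" where
  "graph_jet K = Blinfun (\<lambda>v. (v, snd (blinfun_apply K v)))"

lemma graph_jet_apply: "blinfun_apply (graph_jet K) v = (v, snd (blinfun_apply K v))"
  unfolding graph_jet_def
  by (simp add: bounded_linear_Blinfun_apply bounded_linear_Pair bounded_linear_ident
      bounded_linear_compose[OF bounded_linear_snd blinfun.bounded_linear_right])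

lemma hyperplane_normal:
  fixes \<tau> :: "'a::euclidean_space set"
  assumes "subspace \<tau>" "dim \<tau> = DIM('a) - 1"
  shows "\<exists>\<theta>. \<theta> \<noteq> 0 \<and> \<tau> = {v. \<theta> \<bullet> v = 0}"
proof -
  have "dim \<tau> < DIM('a)" using assms(2) DIM_positive[where 'a='a] by simp
  from orthogonal_to_subspace_exists[OF this] obtain \<theta> where \<theta>: "\<theta> \<noteq> 0" "\<And>y. y \<in> span \<tau> \<Longrightarrow> orthogonal \<theta> y"
    by blast
  have "\<tau> = {v. \<theta> \<bullet> v = 0}"
  proof (rule subspace_dim_equal[OF assms(1) subspace_hyperplane])
    show "\<tau> \<subseteq> {v. \<theta> \<bullet> v = 0}" using \<theta>(2) by (auto simp: span_base orthogonal_def)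
    show "dim {v. \<theta> \<bullet> v = 0} \<le> dim \<tau>" using dim_hyperplane[OF \<theta>(1)] assms(2) by simp
  qed
  then show ?thesis using \<theta>(1) by blast
qed

lemma convex_principal_subspace:
  assumes "subspace V"
  shows "convex (principal_subspace V \<tau> l)"
  unfolding convex_def principal_subspace_def
  using subspace_add[OF assms] subspace_mul[OF assms]
  by (auto simp: blinfun.add_left blinfun.scaleR_left simp flip: scaleR_add_left)

text \<open>In terms of \<open>n1, n2\<close>, dual to \<open>\<alpha>1, \<alpha>2\<close>, the vertical tangent vectors are \<open>u \<mapsto> (x1 \<bullet> u) n1 + (x2 \<bullet> u) n2\<close> on \<open>D\<close>.
  Multiplying by \<open>\<theta>\<close> gives an affine parametrisation \<open>\<Psi>\<close> of the principal subspace by pairs \<open>(x1, x2)\<close>, and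
  \<open>x1, x2\<close> are exactly the perturbations of the two Levi forms by wedges with \<open>\<theta>\<close>.\<close>

lemma ample_slice:
  fixes l and D :: "'e::euclidean_space set" and G :: "'e \<Rightarrow>\<^sub>L ('e \<times> ('e \<Rightarrow>\<^sub>L 'e))"
  assumes D: "subspace D" "dim D = 2 * N + 1" and N: "N \<ge> 1" and dim: "DIM('e) = 2 * N + 3"
    and \<tau>: "subspace \<tau>" "dim \<tau> = DIM('e) - 1"
  defines "P \<equiv> principal_subspace ({0} \<times> Hom_perp D) \<tau> l"
  shows "ample_in P {L \<in> P. generic_jet N D (graph_jet (L - G))}"
  unfolding ample_in_def
proof (intro disjI2 ballI)
  let ?S = "{L \<in> P. generic_jet N D (graph_jet (L - G))}"
  fix C assume C: "C \<in> components ?S"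
  have subV: "subspace ({0} \<times> Hom_perp D)"
    by (rule subspace_Times) (simp_all add: subspace_Hom_perp subspace_0)
  have convP: "convex P" unfolding P_def by (rule convex_principal_subspace[OF subV])
  have CP: "C \<subseteq> P" using in_components_subset[OF C] by blast
  have le: "convex hull C \<subseteq> P" by (intro hull_minimal CP convP)
  obtain L1 where L1: "L1 \<in> C" using in_components_nonempty[OF C] by blast
  then have L1P: "L1 \<in> P" and L1g: "generic_jet N D (graph_jet (L1 - G))" using in_components_subset[OF C] by auto
  have absorb: "T \<subseteq> C" if "connected T" "T \<subseteq> ?S" "L1 \<in> T" for T
    by (rule components_maximal[OF C that(1,2)]) (use L1 that(3) in blast)
  obtain \<theta> where \<theta>: "\<theta> \<noteq> 0" "\<tau> = {v. \<theta> \<bullet> v = 0}" using hyperplane_normal[OF \<tau>] by blast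
  have "P \<subseteq> convex hull C"
  proof (cases "\<exists>u\<in>D. \<theta> \<bullet> u \<noteq> 0")
    case False
    have "P \<subseteq> ?S"
    proof
      fix L assume L: "L \<in> P"
      have "blinfun_apply L u = blinfun_apply L1 u" if "u \<in> D" for u
        using L L1P False that by (auto simp: P_def principal_subspace_def \<theta>(2))
      then have "jet_Levi D (graph_jet (L - G)) \<alpha> = jet_Levi D (graph_jet (L1 - G)) \<alpha>" for \<alpha>
        by (intro alt_forms_eqI[OF D(1)] jet_Levi(1) D(1)) (simp add: jet_Levi(2)[OF D(1)] graph_jet_apply blinfun.diff_left)
      then show "L \<in> ?S" using L L1g unfolding generic_jet_def by simp
    qed
    then have "P \<subseteq> C" by (rule absorb[OF convex_connected[OF convP] _ L1P])
    then show ?thesis by (rule order_trans[OF _ hull_subset])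
  next
    case True
    define j1 where "j1 = graph_jet (L1 - G)"
    obtain \<alpha>1 \<alpha>2 e f where \<alpha>: "\<alpha>1 \<in> annihilator D" "\<alpha>2 \<in> annihilator D"
      and t: "nf_table N D (form (jet_Levi D j1 \<alpha>1)) (form (jet_Levi D j1 \<alpha>2)) e f"
      and ind: "\<forall>s t. s *\<^sub>R \<alpha>1 + t *\<^sub>R \<alpha>2 = 0 \<longrightarrow> s = 0 \<and> t = 0"
      using generic_jet_imp_table[OF D N L1g] unfolding j1_def by (elim bexE exE conjE)
    have dim2: "dim D + 2 = DIM('e)" using D(2) dim by simp
    obtain n1 n2 where n: "n1 \<in> D\<^sup>\<bottom>" "n2 \<in> D\<^sup>\<bottom>" "blinfun_apply \<alpha>1 n1 = 1" "blinfun_apply \<alpha>1 n2 = 0"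
      "blinfun_apply \<alpha>2 n1 = 0" "blinfun_apply \<alpha>2 n2 = 1"
      and expand: "\<forall>w\<in>D\<^sup>\<bottom>. w = blinfun_apply \<alpha>1 w *\<^sub>R n1 + blinfun_apply \<alpha>2 w *\<^sub>R n2"
      using annihilator_dual_basis(1)[OF D(1) dim2 \<alpha> ind] by (elim bexE conjE)
    note ann = annihilator_dual_basis(2)[OF D(1) dim2 \<alpha> ind]
    interpret ps: pencil_slice N D "form (jet_Levi D j1 \<alpha>1)" "form (jet_Levi D j1 \<alpha>2)" e f \<theta>
      by unfold_locales (rule alternating_form[OF jet_Levi(1)[OF D(1)]] D N t True)+
    obtain Pr where Pr: "linear Pr" "\<forall>u. Pr u \<in> D" "\<forall>u. u - Pr u \<in> D\<^sup>\<bottom>" "\<forall>u\<in>D. Pr u = u" "\<forall>u\<in>D\<^sup>\<bottom>. Pr u = 0"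
      using orthogonal_splitting[OF D(1)] by (elim exE conjE)
    define B where "B x = Blinfun (\<lambda>u. (fst x \<bullet> Pr u) *\<^sub>R n1 + (snd x \<bullet> Pr u) *\<^sub>R n2)" for x
    have B: "blinfun_apply (B x) u = (fst x \<bullet> Pr u) *\<^sub>R n1 + (snd x \<bullet> Pr u) *\<^sub>R n2" for x u
    proof -
      have "linear (\<lambda>u. (fst x \<bullet> Pr u) *\<^sub>R n1 + (snd x \<bullet> Pr u) *\<^sub>R n2)"
        by (rule linearI) (simp_all add: linear_add[OF Pr(1)] linear_cmul[OF Pr(1)] inner_add_right algebra_simps)
      then show ?thesis unfolding B_def by (simp add: bounded_linear_Blinfun_apply linear_conv_bounded_linear)
    qed
    have B_perp: "B x \<in> Hom_perp D" for x
      using n(1,2) Pr(5) subspace_perp[of D] by (auto simp: Hom_perp_def B intro!: subspace_add subspace_mul)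
    define T where "T x = Blinfun (\<lambda>v. (\<theta> \<bullet> v) *\<^sub>R (0 :: 'e, B x))" for x
    have T: "blinfun_apply (T x) v = (\<theta> \<bullet> v) *\<^sub>R (0, B x)" for x v
    proof -
      have "linear (\<lambda>v. (\<theta> \<bullet> v) *\<^sub>R (0 :: 'e, B x))"
        by (rule linearI) (simp_all add: inner_add_right scaleR_add_left)
      then show ?thesis unfolding T_def by (simp add: bounded_linear_Blinfun_apply linear_conv_bounded_linear)
    qed
    have linT: "linear T"
      by (rule linearI) (auto intro!: blinfun_eqI simp: T B blinfun.add_left blinfun.scaleR_left inner_add_left algebra_simps)
    define \<Psi> where "\<Psi> x = L1 + T x" for x
    have \<Psi>P: "\<Psi> x \<in> P" for x
      using L1P subspace_add[OF subV] subspace_mul[OF subV] B_perp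
      by (auto simp: zero_prod_def P_def principal_subspace_def \<Psi>_def T blinfun.add_left \<theta>(2) subspace_add subspace_mul subspace_Hom_perp mem_Times_iff)
    have \<Psi>S: "\<Psi> x \<in> ?S" if x: "x \<in> ps.slice" for x
    proof -
      let ?j = "graph_jet (\<Psi> x - G)"
      have "form (jet_Levi D ?j \<alpha>1) u v = add_wedge (form (jet_Levi D j1 \<alpha>1)) (fst x) \<theta> u v \<and>
          form (jet_Levi D ?j \<alpha>2) u v = add_wedge (form (jet_Levi D j1 \<alpha>2)) (snd x) \<theta> u v" if uv: "u \<in> D" "v \<in> D" for u v
        using uv Pr(4) n
        by (simp add: jet_Levi(2)[OF D(1)] j1_def graph_jet_apply \<Psi>_def T B blinfun.diff_left blinfun.diff_right
            blinfun.add_left blinfun.add_right blinfun.scaleR_left blinfun.scaleR_right add_wedge_def algebra_simps)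
      then have "nf_pair N D (form (jet_Levi D ?j \<alpha>1)) (form (jet_Levi D ?j \<alpha>2))"
        by (intro nf_pair_transport[OF x[unfolded ps.slice_def mem_Collect_eq], where h = "\<lambda>v. v"]) simp_all
      then obtain e' f' where "nf_table N D (form (jet_Levi D ?j \<alpha>1)) (form (jet_Levi D ?j \<alpha>2)) e' f'"
        unfolding nf_pair_def by (elim exE)
      then have "generic_jet N D ?j" by (rule generic_jet_of_table[OF D N ann])
      then show ?thesis using \<Psi>P by blast
    qed
    have "\<Psi> ` ps.zero_component \<subseteq> C"
    proof (rule absorb)
      let ?C = "ps.zero_component"
      have "continuous_on ?C \<Psi>" unfolding \<Psi>_def
        by (intro continuous_intros linear_continuous_on) (use linT in \<open>simp add: linear_conv_bounded_linear\<close>)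
      moreover have "connected ?C" unfolding ps.zero_component_def by simp
      ultimately show "connected (\<Psi> ` ?C)" by (rule connected_continuous_image)
      have "?C \<subseteq> ps.slice" unfolding ps.zero_component_def by (rule connected_component_subset)
      then show "\<Psi> ` ?C \<subseteq> ?S" using \<Psi>S by blast
      have "\<Psi> 0 = L1" using linear_0[OF linT] by (simp add: \<Psi>_def)
      then show "L1 \<in> \<Psi> ` ?C" using ps.zero_in_component by (metis imageI)
    qed
    then have "convex hull (\<Psi> ` ps.zero_component) \<subseteq> convex hull C"
      by (rule hull_mono)
    moreover have "convex hull (\<Psi> ` X) = \<Psi> ` (convex hull X)" for X
    proof -
      have "\<Psi> ` Y = (\<lambda>y. L1 + y) ` T ` Y" for Y by (simp add: \<Psi>_def image_image)
      then show ?thesis by (simp add: convex_hull_translation convex_hull_linear_image[OF linT])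
    qed
    ultimately have "range \<Psi> \<subseteq> convex hull C" by (simp add: ps.convex_hull_component)
    moreover have "L \<in> range \<Psi>" if L: "L \<in> P" for L
    proof -
      define M where "M = inverse (\<theta> \<bullet> \<theta>) *\<^sub>R (blinfun_apply L \<theta> - blinfun_apply L1 \<theta>)"
      have "M \<in> {0} \<times> Hom_perp D"
        unfolding M_def by (intro subspace_mul subspace_diff subV) (use L L1P in \<open>auto simp: P_def principal_subspace_def\<close>)
      then obtain E where E: "M = (0, E)" "E \<in> Hom_perp D" by blast
      have lin: "linear (\<lambda>u. blinfun_apply \<alpha> (blinfun_apply E u))" for \<alpha> :: "'e \<Rightarrow>\<^sub>L real"
        by (rule linearI) (simp_all add: blinfun.add_right blinfun.scaleR_right)
      have "\<exists>y. \<forall>u. blinfun_apply \<alpha> (blinfun_apply E u) = y \<bullet> u" for \<alpha> :: "'e \<Rightarrow>\<^sub>L real"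
        by (rule riesz_in_subspace[OF subspace_UNIV lin[of \<alpha>]]) auto
      then obtain x1 x2 where x: "\<And>u. blinfun_apply \<alpha>1 (blinfun_apply E u) = x1 \<bullet> u"
        "\<And>u. blinfun_apply \<alpha>2 (blinfun_apply E u) = x2 \<bullet> u" by metis
      have BE: "B (x1, x2) = E"
      proof (rule blinfun_eqI)
        fix u
        have "blinfun_apply E (u - Pr u) = 0" using E(2) Pr(3) by (auto simp: Hom_perp_def)
        then have "blinfun_apply E u = blinfun_apply E (Pr u)" by (simp add: blinfun.diff_right)
        moreover have "blinfun_apply E (Pr u) \<in> D\<^sup>\<bottom>" using E(2) by (simp add: Hom_perp_def)
        ultimately show "blinfun_apply (B (x1, x2)) u = blinfun_apply E u"
          using bspec[OF expand, of "blinfun_apply E (Pr u)"] by (simp add: B x)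
      qed
      have "L = \<Psi> (x1, x2)"
      proof (rule blinfun_eqI)
        fix v
        define c where "c = (\<theta> \<bullet> v) * inverse (\<theta> \<bullet> \<theta>)"
        have "\<theta> \<bullet> (v - c *\<^sub>R \<theta>) = 0" using \<theta>(1) by (simp add: inner_diff_right c_def)
        then have "blinfun_apply L (v - c *\<^sub>R \<theta>) = blinfun_apply L1 (v - c *\<^sub>R \<theta>)"
          using L L1P by (simp add: P_def principal_subspace_def \<theta>(2))
        then have "blinfun_apply L v = blinfun_apply L1 v + c *\<^sub>R (blinfun_apply L \<theta> - blinfun_apply L1 \<theta>)"
          by (simp add: blinfun.diff_right blinfun.scaleR_right algebra_simps)
        moreover have "c *\<^sub>R (blinfun_apply L \<theta> - blinfun_apply L1 \<theta>) = (\<theta> \<bullet> v) *\<^sub>R M" by (simp add: c_def M_def)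
        ultimately show "blinfun_apply L v = blinfun_apply (\<Psi> (x1, x2)) v"
          by (simp add: \<Psi>_def blinfun.add_left T BE E(1))
      qed
      then show ?thesis by blast
    qed
    ultimately show ?thesis by blast
  qed
  then show "convex hull C = P" using le by blast
qed

text \<open>The operator \<open>G\<close> is the connection on the vectors \<open>(v, 0)\<close>. Subtracting it from an element of the fibre leaves the vertical
  part of the differential.\<close>

lemma relation_fibre_slice:
  fixes \<A> :: "('m::{t2_space,second_countable_topology}, 'e::euclidean_space) chart set"
  assumes \<A>: "smooth_atlas \<A>" and conn: "connection (2 * N + 1) \<AA>" and D: "subspace D" "dim D = 2 * N + 1"
  shows "\<exists>G. \<forall>l. relation_fibre \<AA> (generic_relation \<A> N) (q, D) \<inter> principal_subspace ({0} \<times> Hom_perp D) \<tau> l =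
    {L \<in> principal_subspace ({0} \<times> Hom_perp D) \<tau> l. generic_jet N D (graph_jet (L - G))}"
proof -
  interpret atlas \<A> by unfold_locales (rule \<A>)
  let ?A = "\<AA> (q, D)"
  have "(q, D) \<in> Gr_bundle (2 * N + 1)" using D by (simp add: Gr_bundle_def)
  then have c: "linear_between (tangent_Gr (q, D)) (vertical (q, D)) ?A" "\<forall>w\<in>vertical (q, D). ?A w = w"
    using conn unfolding connection_def by blast+
  have tan: "(v, E) \<in> tangent_Gr (q, D)" if "E \<in> Hom_perp D" for v E
    using that by (simp add: tangent_Gr_def)
  have vert: "vertical (q, D) = {0} \<times> Hom_perp D" by (auto simp: vertical_def tangent_Gr_def)
  define G where "G = Blinfun (\<lambda>v. ?A (v, 0))"
  note z = zero_in_Hom_perp[of D]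
  have "linear (\<lambda>v. ?A (v, 0))"
  proof (rule linearI)
    show "?A (u + v, 0) = ?A (u, 0) + ?A (v, 0)" for u v
      using c(1) tan[OF z, of u] tan[OF z, of v] unfolding linear_between_def by force
    show "?A (r *\<^sub>R v, 0) = r *\<^sub>R ?A (v, 0)" for r v
      using c(1) tan[OF z, of v] unfolding linear_between_def by force
  qed
  then have G: "blinfun_apply G v = ?A (v, 0)" for v
    unfolding G_def by (simp add: bounded_linear_Blinfun_apply linear_conv_bounded_linear)
  have split: "?A (v, E) = blinfun_apply G v + (0, E)" if E: "E \<in> Hom_perp D" for v E
  proof -
    have "?A ((v, 0) + (0, E)) = ?A (v, 0) + ?A (0, E)"
      using c(1) tan[OF z, of v] tan[OF E, of 0] unfolding linear_between_def by blast
    then show ?thesis using c(2) E by (simp add: G vert)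
  qed
  have GV: "blinfun_apply G v \<in> {0} \<times> Hom_perp D" for v
    using c(1) tan[OF z, of v] unfolding linear_between_def G vert by blast
  have *: "L \<in> relation_fibre \<AA> (generic_relation \<A> N) (q, D) \<longleftrightarrow> generic_jet N D (graph_jet (L - G))"
    if L: "\<And>v. blinfun_apply L v \<in> {0} \<times> Hom_perp D" for L
  proof
    assume "L \<in> relation_fibre \<AA> (generic_relation \<A> N) (q, D)"
    then obtain j where j: "L = Blinfun (\<lambda>v. ?A (blinfun_apply j v))" "((q, D), j) \<in> generic_relation \<A> N"
      unfolding relation_fibre_def by blast
    then have ja: "admissible D j" and jg: "generic_jet N D j"
      using generic_relation_iff[OF D] by (simp_all add: generic_jet_def)
    have jv: "blinfun_apply j v = (v, snd (blinfun_apply j v))" "snd (blinfun_apply j v) \<in> Hom_perp D" for v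
      using ja by (simp_all add: admissible_def prod_eq_iff)
    have A: "?A (blinfun_apply j v) = blinfun_apply G v + (0, snd (blinfun_apply j v))" for v
      using split[OF jv(2), of v v] jv(1)[of v] by simp
    have "linear (\<lambda>v. blinfun_apply G v + (0, snd (blinfun_apply j v)))"
      by (rule linearI) (simp_all add: blinfun.add_right blinfun.scaleR_right scaleR_add_right)
    then have "blinfun_apply L v = blinfun_apply G v + (0, snd (blinfun_apply j v))" for v
      unfolding j(1) A by (simp add: bounded_linear_Blinfun_apply linear_conv_bounded_linear)
    then have "graph_jet (L - G) = j"
      by (intro blinfun_eqI) (simp add: graph_jet_apply blinfun.diff_left flip: jv(1))
    then show "generic_jet N D (graph_jet (L - G))" using jg by simp
  next
    assume g: "generic_jet N D (graph_jet (L - G))"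
    have H: "snd (blinfun_apply (L - G) v) \<in> Hom_perp D" for v
    proof -
      have "snd (blinfun_apply L v) \<in> Hom_perp D" "snd (blinfun_apply G v) \<in> Hom_perp D"
        using L[of v] GV[of v] by (auto simp: mem_Times_iff)
      then show ?thesis by (simp add: blinfun.diff_left subspace_diff subspace_Hom_perp)
    qed
    have "((q, D), graph_jet (L - G)) \<in> generic_relation \<A> N"
      unfolding generic_relation_iff[OF D] using g H by (simp add: generic_jet_def admissible_def graph_jet_apply)
    moreover have "L = Blinfun (\<lambda>v. ?A (blinfun_apply (graph_jet (L - G)) v))"
    proof -
      have "?A (blinfun_apply (graph_jet (L - G)) v) = blinfun_apply L v" for v
        using L[of v] GV[of v] unfolding graph_jet_apply split[OF H] by (simp add: prod_eq_iff mem_Times_iff blinfun.diff_left)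
      then show ?thesis by (simp add: blinfun_apply_inverse)
    qed
    ultimately show "L \<in> relation_fibre \<AA> (generic_relation \<A> N) (q, D)" unfolding relation_fibre_def by blast
  qed
  show ?thesis
    by (intro exI[of _ G] allI) (use * in \<open>auto simp: principal_subspace_def\<close>)
qed

theorem mainTheorem2:
  fixes \<A> :: "('m::{t2_space,second_countable_topology}, 'e::euclidean_space) chart set"
    and \<AA> :: "'m \<times> 'e set \<Rightarrow> 'e \<times> ('e \<Rightarrow>\<^sub>L 'e) \<Rightarrow> 'e \<times> ('e \<Rightarrow>\<^sub>L 'e)"
    and N :: nat
  assumes "N \<ge> 1"
    and "smooth_atlas \<A>"
    and "DIM('e) = 2 * N + 3"
    and "connection (2 * N + 1) \<AA>"
  shows "ample_relation (2 * N + 1) \<AA> (generic_relation \<A> N)"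
  unfolding ample_relation_def
proof (intro ballI allI impI)
  fix x :: "'m \<times> 'e set" and \<tau> :: "'e set" and l
  assume x: "x \<in> Gr_bundle (2 * N + 1)"
    and h: "subspace \<tau> \<and> dim \<tau> = DIM('e) - 1 \<and> linear_between \<tau> (vertical x) l"
  obtain q D where xq: "x = (q, D)" by (cases x)
  have D: "subspace D" "dim D = 2 * N + 1" using x by (simp_all add: xq Gr_bundle_def)
  have vert: "vertical x = {0} \<times> Hom_perp D" by (auto simp: xq vertical_def tangent_Gr_def)
  obtain G where G: "\<forall>l. relation_fibre \<AA> (generic_relation \<A> N) (q, D) \<inter> principal_subspace ({0} \<times> Hom_perp D) \<tau> l =
    {L \<in> principal_subspace ({0} \<times> Hom_perp D) \<tau> l. generic_jet N D (graph_jet (L - G))}"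
    using relation_fibre_slice[OF assms(2,4) D] ..
  show "ample_in (principal_subspace (vertical x) \<tau> l)
      (relation_fibre \<AA> (generic_relation \<A> N) x \<inter> principal_subspace (vertical x) \<tau> l)"
    unfolding vert unfolding xq spec[OF G] by (rule ample_slice[OF D assms(1,3)]) (use h in auto)
qed

end
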